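(* Let $q\in\mathbb{C}\setminus\{0\}$ be not a root of unity. Every $U_q(\mathfrak{sl}_2)$-module algebra structure on the quantum plane $\mathbb{C}_q[x,y]$ belongs to one of the following families (so this list is complete): (1) $\mathsf{k}(x)=\pm x$, $\mathsf{k}(y)=\pm y$ (independent signs), $\mathsf{e}(x)=\mathsf{e}(y)=\mathsf{f}(x)=\mathsf{f}(y)=0$; (2) $\mathsf{k}(x)=qx$, $\mathsf{k}(y)=q^{-1}y$, $\mathsf{e}(x)=0$, $\mathsf{e}(y)=\tau x$, $\mathsf{f}(x)=\tau^{-1}y$, $\mathsf{f}(y)=0$, with $\tau\in\mathbb{C}\setminus\{0\}$; (3) $\mathsf{k}(x)=qx$, $\mathsf{k}(y)=q^{-2}y$, $\mathsf{e}(x)=0$, $\mathsf{e}(y)=b_0$, $\mathsf{f}(x)=b_0^{-1}xy$, $\mathsf{f}(y)=-qb_0^{-1}y^2$, with $b_0\in\mathbb{C}\setminus\{0\}$; (4) $\mathsf{k}(x)=q^2x$, $\mathsf{k}(y)=q^{-1}y$, $\mathsf{e}(x)=-qc_0^{-1}x^2$, $\mathsf{e}(y)=c_0^{-1}xy$, $\mathsf{f}(x)=c_0$, $\mathsf{f}(y)=0$, with $c_0\in\mathbb{C}\setminus\{0\}$; (5) $\mathsf{k}(x)=q^{-2}x$, $\mathsf{k}(y)=q^{-1}y$, $\mathsf{e}(x)=a_0$, $\mathsf{e}(y)=0$, $\mathsf{f}(x)=-qa_0^{-1}x^2+ty^4$, $\mathsf{f}(y)=-qa_0^{-1}xy+sy^3$,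 with $a_0\in\mathbb{C}\setminus\{0\}$, $s,t\in\mathbb{C}$; (6) $\mathsf{k}(x)=qx$, $\mathsf{k}(y)=q^2y$, $\mathsf{e}(x)=-qd_0^{-1}xy+sx^3$, $\mathsf{e}(y)=-qd_0^{-1}y^2+tx^4$, $\mathsf{f}(x)=0$, $\mathsf{f}(y)=d_0$, with $d_0\in\mathbb{C}\setminus\{0\}$, $s,t\in\mathbb{C}$.
   Context: The quantum plane $\mathbb{C}_q[x,y]$ is the unital associative $\mathbb{C}$-algebra with generators $x,y$ and the single relation $yx=qxy$; the monomials $x^my^n$ ($m,n\ge 0$) form a basis. $U_q(\mathfrak{sl}_2)$ is the unital associative $\mathbb{C}$-algebra with generators $\mathsf{k},\mathsf{k}^{-1},\mathsf{e},\mathsf{f}$ and relations $\mathsf{k}^{-1}\mathsf{k}=\mathsf{k}\mathsf{k}^{-1}=\mathbf{1}$, $\mathsf{k}\mathsf{e}=q^2\mathsf{e}\mathsf{k}$, $\mathsf{k}\mathsf{f}=q^{-2}\mathsf{f}\mathsf{k}$, $\mathsf{e}\mathsf{f}-\mathsf{f}\mathsf{e}=\frac{\mathsf{k}-\mathsf{k}^{-1}}{q-q^{-1}}$, with Hopf algebra structure $\Delta(\mathsf{k})=\mathsf{k}\otimes\mathsf{k}$, $\Delta(\mathsf{e})=\mathbf{1}\otimes\mathsf{e}+\mathsf{e}\otimes\mathsf{k}$, $\Delta(\mathsf{f})=\mathsf{f}\otimes\mathbf{1}+\mathsf{k}^{-1}\otimes\mathsf{f}$, $\varepsilon(\mathsf{k})=1$,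 $\varepsilon(\mathsf{e})=\varepsilon(\mathsf{f})=0$, $S(\mathsf{k})=\mathsf{k}^{-1}$, $S(\mathsf{e})=-\mathsf{e}\mathsf{k}^{-1}$, $S(\mathsf{f})=-\mathsf{k}\mathsf{f}$. For a Hopf algebra $H$ and a unital algebra $A$, a structure of $H$-module algebra on $A$ is an algebra homomorphism $\pi:H\to\operatorname{End}_{\mathbb{C}}A$ such that $\pi(h)(ab)=\sum_i\pi(h_i')(a)\,\pi(h_i'')(b)$ (where $\Delta(h)=\sum_i h_i'\otimes h_i''$) and $\pi(h)(\mathbf{1})=\varepsilon(h)\mathbf{1}$ for all $h\in H$, $a,b\in A$. One writes $h(a)$ for $\pi(h)(a)$. A structure on $\mathbb{C}_q[x,y]$ is uniquely determined by the values of $\mathsf{k},\mathsf{e},\mathsf{f}$ on $x,y$. *)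

theory Defs
  imports "HOL-Algebra.Algebra" "HOL-Library.Poly_Mapping" Complex_Main
begin

section \<open>Unital associative complex algebras\<close>

definition complex_field :: "complex ring" where
  "complex_field = \<lparr>carrier = UNIV, monoid.mult = (*), one = 1, ring.zero = 0, add = (+)\<rparr>"

text \<open>The locale \<^locale>\<open>algebra\<close> of the library is restricted to commutative algebras.\<close>

locale unital_algebra = module complex_field A + ring A
  for A :: "(complex, 'a, 'm) module_scheme" (structure) +
  assumes smult_mult_left:
      "\<lbrakk>x \<in> carrier A; y \<in> carrier A\<rbrakk> \<Longrightarrow> (c \<odot> x) \<otimes> y = c \<odot> (x \<otimes> y)"
    and smult_mult_right:
      "\<lbrakk>x \<in> carrier A; y \<in> carrier A\<rbrakk> \<Longrightarrow> x \<otimes> (c \<odot> y) = c \<odot> (x \<otimes> y)"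

definition algebra_hom ::
  "(complex, 'a, 'm) module_scheme \<Rightarrow> (complex, 'b, 'n) module_scheme \<Rightarrow> ('a \<Rightarrow> 'b) set" where
  "algebra_hom A B =
    {h \<in> ring_hom A B. \<forall>c. \<forall>x\<in>carrier A. h (c \<odot>\<^bsub>A\<^esub> x) = c \<odot>\<^bsub>B\<^esub> h x}"

definition complex_algebra :: "(complex, complex) module" where
  "complex_algebra =
    \<lparr>carrier = UNIV, monoid.mult = (*), one = 1, ring.zero = 0, add = (+), smult = (*)\<rparr>"

definition opposite_algebra ::
  "(complex, 'a, 'm) module_scheme \<Rightarrow> (complex, 'a, 'm) module_scheme" where
  "opposite_algebra A = A\<lparr>monoid.mult := \<lambda>x y. y \<otimes>\<^bsub>A\<^esub> x\<rparr>"

text \<open>Linear endomorphisms are normalised by \<^const>\<open>extensional\<close> outside the carrier.\<close>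

definition End_algebra ::
  "(complex, 'a, 'm) module_scheme \<Rightarrow> (complex, 'a \<Rightarrow> 'a) module" where
  "End_algebra A =
    \<lparr>carrier = {T \<in> carrier A \<rightarrow>\<^sub>E carrier A.
        (\<forall>x\<in>carrier A. \<forall>y\<in>carrier A. T (x \<oplus>\<^bsub>A\<^esub> y) = T x \<oplus>\<^bsub>A\<^esub> T y) \<and>
        (\<forall>c. \<forall>x\<in>carrier A. T (c \<odot>\<^bsub>A\<^esub> x) = c \<odot>\<^bsub>A\<^esub> T x)},
     monoid.mult = compose (carrier A),
     one = (\<lambda>x\<in>carrier A. x),
     ring.zero = (\<lambda>x\<in>carrier A. \<zero>\<^bsub>A\<^esub>),
     add = (\<lambda>S T. \<lambda>x\<in>carrier A. S x \<oplus>\<^bsub>A\<^esub> T x),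
     smult = (\<lambda>c T. \<lambda>x\<in>carrier A. c \<odot>\<^bsub>A\<^esub> T x)\<rparr>"

lemma unital_algebraI:
  fixes A (structure)
  assumes "ring A"
    and "\<And>c x. x \<in> carrier A \<Longrightarrow> c \<odot> x \<in> carrier A"
    and "\<And>c d x. x \<in> carrier A \<Longrightarrow> (c + d) \<odot> x = c \<odot> x \<oplus> d \<odot> x"
    and "\<And>c x y. \<lbrakk>x \<in> carrier A; y \<in> carrier A\<rbrakk> \<Longrightarrow> c \<odot> (x \<oplus> y) = c \<odot> x \<oplus> c \<odot> y"
    and "\<And>c d x. x \<in> carrier A \<Longrightarrow> (c * d) \<odot> x = c \<odot> (d \<odot> x)"
    and "\<And>x. x \<in> carrier A \<Longrightarrow> 1 \<odot> x = x"
    and "\<And>c x y. \<lbrakk>x \<in> carrier A; y \<in> carrier A\<rbrakk> \<Longrightarrow> (c \<odot> x) \<otimes> y = c \<odot> (x \<otimes> y)"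
    and "\<And>c x y. \<lbrakk>x \<in> carrier A; y \<in> carrier A\<rbrakk> \<Longrightarrow> x \<otimes> (c \<odot> y) = c \<odot> (x \<otimes> y)"
  shows "unital_algebra A"
proof -
  interpret ring A by fact
  have "cring complex_field"
  proof (rule cringI)
    show "abelian_group complex_field"
      by (rule abelian_groupI) (auto simp: complex_field_def intro: exI[of _ "- _"] add.left_inverse)
    show "comm_monoid complex_field"
      by (rule comm_monoidI) (auto simp: complex_field_def)
  qed (auto simp: complex_field_def algebra_simps)
  then have "module complex_field A"
    by (rule moduleI) (auto simp: complex_field_def assms abelian_group_axioms)
  then show ?thesis
    by (intro unital_algebra.intro unital_algebra_axioms.intro assms)
qed

context unital_algebra
begin

lemma smult_in [simp, intro]: "x \<in> carrier A \<Longrightarrow> c \<odot> x \<in> carrier A"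
  using smult_closed[of c x] by (simp add: complex_field_def)

lemma smult_distrib_left: "x \<in> carrier A \<Longrightarrow> (c + d) \<odot> x = c \<odot> x \<oplus> d \<odot> x"
  using smult_l_distr[of c d x] by (simp add: complex_field_def)

lemma smult_distrib_right:
  "\<lbrakk>x \<in> carrier A; y \<in> carrier A\<rbrakk> \<Longrightarrow> c \<odot> (x \<oplus> y) = c \<odot> x \<oplus> c \<odot> y"
  using smult_r_distr[of c x y] by (simp add: complex_field_def)

lemma smult_smult: "x \<in> carrier A \<Longrightarrow> c \<odot> (d \<odot> x) = (c * d) \<odot> x"
  using smult_assoc1[of c d x] by (simp add: complex_field_def)

lemma smult_unit [simp]: "x \<in> carrier A \<Longrightarrow> 1 \<odot> x = x"
  using smult_one[of x] by (simp add: complex_field_def)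

lemma smult_zero_left [simp]: "x \<in> carrier A \<Longrightarrow> 0 \<odot> x = \<zero>"
  by (metis add_0 smult_distrib_left smult_in add.l_cancel_one)

lemma smult_minus_one: "x \<in> carrier A \<Longrightarrow> (-1) \<odot> x = \<ominus> x"
  by (metis add.left_inverse minus_equality smult_distrib_left smult_in smult_unit smult_zero_left)

end

lemma unital_algebra_complex: "unital_algebra complex_algebra"
proof (rule unital_algebraI)
  have "abelian_group complex_algebra"
    by (rule abelian_groupI) (auto simp: complex_algebra_def intro: exI[of _ "- _"] add.left_inverse)
  then show "ring complex_algebra"
    by (rule ringI[OF _ monoidI]) (auto simp: complex_algebra_def algebra_simps)
qed (auto simp: complex_algebra_def algebra_simps)

lemma unital_algebra_opposite:
  assumes "unital_algebra A"
  shows "unital_algebra (opposite_algebra A)"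
proof -
  interpret A: unital_algebra A by fact
  have "abelian_group (opposite_algebra A)"
    by (rule abelian_groupI)
      (auto simp: opposite_algebra_def A.add.m_ac intro: bexI[of _ "\<ominus>\<^bsub>A\<^esub> _"] A.l_neg)
  then have "ring (opposite_algebra A)"
    by (rule ringI[OF _ monoidI])
      (auto simp: opposite_algebra_def A.m_assoc A.l_distr A.r_distr)
  then show ?thesis
    by (rule unital_algebraI)
      (auto simp: opposite_algebra_def A.smult_distrib_left A.smult_distrib_right A.smult_smult
        A.smult_mult_left A.smult_mult_right)
qed

section \<open>Algebras given by generators and relations\<close>

datatype 'g word = Word (letters: "'g list")

instantiation word :: (type) monoid_add
begin
definition "0 = Word []"
definition "u + v = Word (letters u @ letters v)"
instance
  by standard (simp_all add: zero_word_def plus_word_def)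
end

text \<open>
  With concatenation as the (additively written) monoid operation on words, the convolution
  product of \<^typ>\<open>'g word \<Rightarrow>\<^sub>0 complex\<close> is the product of noncommutative polynomials.
\<close>

type_synonym 'g free = "'g word \<Rightarrow>\<^sub>0 complex"

definition free_gen :: "'g \<Rightarrow> 'g free" where
  "free_gen g = Poly_Mapping.single (Word [g]) 1"

definition free_scale :: "complex \<Rightarrow> 'g free \<Rightarrow> 'g free" where
  "free_scale c f = Poly_Mapping.single 0 c * f"

definition free_algebra :: "(complex, 'g free) module" where
  "free_algebra =
    \<lparr>carrier = UNIV, monoid.mult = (*), one = 1, ring.zero = 0, add = (+), smult = free_scale\<rparr>"

definition presented_class :: "'g free set \<Rightarrow> 'g free \<Rightarrow> 'g free set" where
  "presented_class R f = (Idl\<^bsub>free_algebra\<^esub> R) +>\<^bsub>free_algebra\<^esub> f"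

definition presented_algebra :: "'g free set \<Rightarrow> (complex, 'g free set) module" where
  "presented_algebra R =
    ring.extend (free_algebra Quot (Idl\<^bsub>free_algebra\<^esub> R))
      (module.fields (\<lambda>c C. \<Union>f\<in>C. presented_class R (free_scale c f)))"

definition presented_gen :: "'g free set \<Rightarrow> 'g \<Rightarrow> 'g free set" where
  "presented_gen R g = presented_class R (free_gen g)"

text \<open>Substitution of elements \<open>\<phi> g\<close> of an algebra for the generators \<open>g\<close>.\<close>

definition word_eval :: "(complex, 'a, 'm) module_scheme \<Rightarrow> ('g \<Rightarrow> 'a) \<Rightarrow> 'g word \<Rightarrow> 'a" where
  "word_eval B \<phi> w = foldr (\<lambda>g b. \<phi> g \<otimes>\<^bsub>B\<^esub> b) (letters w) \<one>\<^bsub>B\<^esub>"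

definition free_eval :: "(complex, 'a, 'm) module_scheme \<Rightarrow> ('g \<Rightarrow> 'a) \<Rightarrow> 'g free \<Rightarrow> 'a" where
  "free_eval B \<phi> f =
    (\<Oplus>\<^bsub>B\<^esub>w\<in>Poly_Mapping.keys f. Poly_Mapping.lookup f w \<odot>\<^bsub>B\<^esub> word_eval B \<phi> w)"

text \<open>
  The homomorphism out of a presented algebra with prescribed values on the generators; it is
  well defined if these values satisfy the relations, see \<open>induced_hom\<close> below.
\<close>

definition induced_hom ::
  "(complex, 'a, 'm) module_scheme \<Rightarrow> ('g \<Rightarrow> 'a) \<Rightarrow> 'g free set \<Rightarrow> 'a" where
  "induced_hom B \<phi> C = the_elem (free_eval B \<phi> ` C)"

lemma free_algebra_simps [simp]:
  "carrier free_algebra = UNIV" "f \<otimes>\<^bsub>free_algebra\<^esub> g = f * g" "\<one>\<^bsub>free_algebra\<^esub> = 1"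
  "\<zero>\<^bsub>free_algebra\<^esub> = 0" "f \<oplus>\<^bsub>free_algebra\<^esub> g = f + g" "c \<odot>\<^bsub>free_algebra\<^esub> f = free_scale c f"
  by (simp_all add: free_algebra_def)

lemma free_induct [case_names single add]:
  assumes "\<And>w c. P (Poly_Mapping.single w c)" "\<And>f g. P f \<Longrightarrow> P g \<Longrightarrow> P (f + g)"
  shows "P (f :: 'g free)"
proof (induction f rule: update_induct)
  case const
  show ?case using assms(1)[of 0 0] by simp
next
  case (update f a b)
  have "Poly_Mapping.update a b f = f + Poly_Mapping.single a b"
    using update by (intro poly_mapping_eqI) (auto simp: lookup_update lookup_add lookup_single in_keys_iff when_def)
  with update assms show ?case by simp
qed

lemma free_scale_commute: "free_scale c f = f * Poly_Mapping.single 0 c"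
  unfolding free_scale_def
  by (induction f rule: free_induct) (simp_all add: mult_single distrib_left distrib_right mult.commute)

lemma unital_algebra_free: "unital_algebra free_algebra"
proof (rule unital_algebraI)
  show "ring (free_algebra :: (complex, 'g free) module)"
  proof (rule ringI)
    show "abelian_group (free_algebra :: (complex, 'g free) module)"
      by (rule abelian_groupI) (auto simp: algebra_simps intro: exI[of _ "- _"] add.left_inverse)
    show "monoid (free_algebra :: (complex, 'g free) module)"
      by (rule monoidI) (auto simp: mult.assoc)
  qed (auto simp: distrib_left distrib_right)
  fix c x y
  show "x \<otimes>\<^bsub>free_algebra\<^esub> (c \<odot>\<^bsub>free_algebra\<^esub> y) = c \<odot>\<^bsub>free_algebra\<^esub> (x \<otimes>\<^bsub>free_algebra\<^esub> (y :: 'g free))"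
    by (simp add: free_scale_commute mult.assoc)
qed (auto simp: free_scale_def single_add distrib_left distrib_right mult.assoc mult_single
   simp flip: mult.assoc)

lemma ideal_presented: "ideal (Idl\<^bsub>free_algebra\<^esub> R) free_algebra"
proof -
  interpret unital_algebra "free_algebra :: (complex, 'a free) module" by (rule unital_algebra_free)
  show ?thesis by (rule genideal_ideal) simp
qed

lemma presented_class_eqI:
  assumes "f - g \<in> Idl\<^bsub>free_algebra\<^esub> R"
  shows "presented_class R f = presented_class R g"
proof -
  interpret I: ideal "Idl\<^bsub>free_algebra\<^esub> R" free_algebra by (rule ideal_presented)
  have "f = (f - g) + g" by simp
  then have "f \<in> presented_class R g"
    using assms by (auto simp: presented_class_def a_r_coset_def r_coset_def intro!: bexI[of _ "f - g"])
  then show ?thesis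
    using I.a_repr_independence'[of f g] by (simp add: presented_class_def)
qed

lemma presented_class_self: "f \<in> presented_class R f"
proof -
  interpret I: ideal "Idl\<^bsub>free_algebra\<^esub> R" free_algebra by (rule ideal_presented)
  show ?thesis using I.a_rcos_self[of f] by (simp add: presented_class_def)
qed

lemma carrier_presented: "carrier (presented_algebra R) = range (presented_class R)"
  by (auto simp: presented_algebra_def ring.defs module.defs FactRing_def A_RCOSETS_def
      RCOSETS_def a_r_coset_def presented_class_def)

lemma presented_simps [simp]:
  "presented_class R f \<in> carrier (presented_algebra R)"
  "presented_class R f \<otimes>\<^bsub>presented_algebra R\<^esub> presented_class R g = presented_class R (f * g)"
  "presented_class R f \<oplus>\<^bsub>presented_algebra R\<^esub> presented_class R g = presented_class R (f + g)"
  "c \<odot>\<^bsub>presented_algebra R\<^esub> presented_class R f = presented_class R (free_scale c f)"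
  "\<one>\<^bsub>presented_algebra R\<^esub> = presented_class R 1"
  "\<zero>\<^bsub>presented_algebra R\<^esub> = presented_class R 0"
proof -
  interpret I: ideal "Idl\<^bsub>free_algebra\<^esub> R" free_algebra by (rule ideal_presented)
  note defs = presented_algebra_def ring.defs module.defs FactRing_def
  show "presented_class R f \<in> carrier (presented_algebra R)" by (simp add: carrier_presented)
  show "presented_class R f \<otimes>\<^bsub>presented_algebra R\<^esub> presented_class R g = presented_class R (f * g)"
    using I.rcoset_mult_add[of f g] by (simp add: defs presented_class_def)
  show "presented_class R f \<oplus>\<^bsub>presented_algebra R\<^esub> presented_class R g = presented_class R (f + g)"
    using I.a_rcos_sum[of f g] by (simp add: defs presented_class_def)
  show "\<one>\<^bsub>presented_algebra R\<^esub> = presented_class R 1"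
    by (simp add: defs presented_class_def)
  show "\<zero>\<^bsub>presented_algebra R\<^esub> = presented_class R 0"
    using I.a_coset_add_zero[OF I.a_subset] by (simp add: defs presented_class_def)
  have *: "presented_class R (free_scale c g) = presented_class R (free_scale c f)"
    if g: "g \<in> presented_class R f" for g
  proof (rule presented_class_eqI)
    from g obtain h where h: "h \<in> Idl\<^bsub>free_algebra\<^esub> R" "g = h + f"
      by (auto simp: presented_class_def a_r_coset_def r_coset_def)
    then show "free_scale c g - free_scale c f \<in> Idl\<^bsub>free_algebra\<^esub> R"
      using I.I_l_closed[OF h(1)] by (simp add: free_scale_def distrib_left)
  qed
  have "(\<Union>g\<in>presented_class R f. presented_class R (free_scale c g)) =
      presented_class R (free_scale c f)"
    using * presented_class_self[of f R] by blast
  then show "c \<odot>\<^bsub>presented_algebra R\<^esub> presented_class R f = presented_class R (free_scale c f)"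
    by (simp add: defs)
qed

lemma unital_algebra_presented: "unital_algebra (presented_algebra R)"
proof (rule unital_algebraI)
  have "abelian_group (presented_algebra R)"
  proof (rule abelian_groupI)
    fix x assume "x \<in> carrier (presented_algebra R)"
    then obtain f where "x = presented_class R f" by (auto simp: carrier_presented)
    then show "\<exists>y\<in>carrier (presented_algebra R). y \<oplus>\<^bsub>presented_algebra R\<^esub> x = \<zero>\<^bsub>presented_algebra R\<^esub>"
      by (intro bexI[of _ "presented_class R (- f)"]) simp_all
  qed (auto simp: carrier_presented algebra_simps)
  then show "ring (presented_algebra R)"
    by (rule ringI[OF _ monoidI]) (auto simp: carrier_presented mult.assoc distrib_left distrib_right)
  fix c x y
  assume "x \<in> carrier (presented_algebra R)" "y \<in> carrier (presented_algebra R)"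
  then obtain f g where fg: "x = presented_class R f" "y = presented_class R g"
    by (auto simp: carrier_presented)
  have "f * free_scale c g = free_scale c (f * g)"
    by (simp add: free_scale_commute mult.assoc)
  with fg show "x \<otimes>\<^bsub>presented_algebra R\<^esub> (c \<odot>\<^bsub>presented_algebra R\<^esub> y) =
      c \<odot>\<^bsub>presented_algebra R\<^esub> (x \<otimes>\<^bsub>presented_algebra R\<^esub> y)"
    by simp
qed (auto simp: carrier_presented free_scale_def single_add distrib_left distrib_right mult_single
   mult.assoc simp flip: mult.assoc)

lemma presented_relation:
  assumes "f - g \<in> R"
  shows "presented_class R f = presented_class R g"
proof (rule presented_class_eqI)
  show "f - g \<in> Idl\<^bsub>free_algebra\<^esub> R" using assms by (auto simp: genideal_def)
qed

context unital_algebra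
begin

context
  fixes \<phi> :: "'g \<Rightarrow> 'a"
  assumes \<phi>: "\<phi> g \<in> carrier A"
begin

lemma word_eval_closed [simp]: "word_eval A \<phi> w \<in> carrier A"
proof -
  have "foldr (\<lambda>g b. \<phi> g \<otimes> b) xs \<one> \<in> carrier A" for xs
    by (induction xs) (simp_all add: \<phi>)
  then show ?thesis by (simp add: word_eval_def)
qed

lemma word_eval_plus: "word_eval A \<phi> (u + v) = word_eval A \<phi> u \<otimes> word_eval A \<phi> v"
proof -
  have "foldr (\<lambda>g b. \<phi> g \<otimes> b) xs (word_eval A \<phi> v) = foldr (\<lambda>g b. \<phi> g \<otimes> b) xs \<one> \<otimes> word_eval A \<phi> v
      \<and> foldr (\<lambda>g b. \<phi> g \<otimes> b) xs \<one> \<in> carrier A" for xs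
    by (induction xs) (simp_all add: \<phi> m_assoc)
  then show ?thesis by (simp add: word_eval_def plus_word_def)
qed

lemma free_eval_superset:
  assumes "finite S" "Poly_Mapping.keys f \<subseteq> S"
  shows "free_eval A \<phi> f = (\<Oplus>w\<in>S. Poly_Mapping.lookup f w \<odot> word_eval A \<phi> w)"
  unfolding free_eval_def
  by (rule add.finprod_mono_neutral_cong_left) (use assms in \<open>auto simp: in_keys_iff\<close>)

lemma free_eval_closed [simp]: "free_eval A \<phi> f \<in> carrier A"
  unfolding free_eval_def by (rule finsum_closed) auto

lemma free_eval_single: "free_eval A \<phi> (Poly_Mapping.single w c) = c \<odot> word_eval A \<phi> w"
  by (subst free_eval_superset[of "{w}"]) (auto simp: lookup_single)

lemma free_eval_add: "free_eval A \<phi> (f + g) = free_eval A \<phi> f \<oplus> free_eval A \<phi> g"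
proof -
  let ?S = "Poly_Mapping.keys f \<union> Poly_Mapping.keys g"
  have "free_eval A \<phi> (f + g) =
      (\<Oplus>w\<in>?S. Poly_Mapping.lookup (f + g) w \<odot> word_eval A \<phi> w)"
    by (rule free_eval_superset) (use keys_add[of f g] in auto)
  also have "\<dots> = (\<Oplus>w\<in>?S. Poly_Mapping.lookup f w \<odot> word_eval A \<phi> w) \<oplus>
      (\<Oplus>w\<in>?S. Poly_Mapping.lookup g w \<odot> word_eval A \<phi> w)"
    by (subst finsum_addf[symmetric]) (auto simp: lookup_add smult_distrib_left)
  also have "\<dots> = free_eval A \<phi> f \<oplus> free_eval A \<phi> g"
    by (intro arg_cong2[where f = "(\<oplus>)"] free_eval_superset[symmetric]) auto
  finally show ?thesis .
qed

lemma free_eval_mult: "free_eval A \<phi> (f * g) = free_eval A \<phi> f \<otimes> free_eval A \<phi> g"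
proof (induction f rule: free_induct)
  case (single u a)
  show ?case
  proof (induction g rule: free_induct)
    case (single v b)
    show ?case
      by (simp add: mult_single free_eval_single word_eval_plus smult_mult_left smult_mult_right
          smult_smult mult.commute)
  qed (simp_all add: distrib_left free_eval_add r_distr)
qed (simp_all add: distrib_right free_eval_add l_distr)

lemma free_eval_const: "free_eval A \<phi> (Poly_Mapping.single 0 c) = c \<odot> \<one>"
  by (simp add: free_eval_single word_eval_def zero_word_def)

lemma free_eval_one [simp]: "free_eval A \<phi> 1 = \<one>"
  using free_eval_const[of 1] by simp

lemma free_eval_scale: "free_eval A \<phi> (free_scale c f) = c \<odot> free_eval A \<phi> f"
  by (simp add: free_scale_def free_eval_mult free_eval_const smult_mult_left)

lemma free_eval_gen: "free_eval A \<phi> (free_gen g) = \<phi> g"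
  using \<phi>[of g] by (simp add: free_gen_def free_eval_single word_eval_def)

lemma free_eval_hom: "free_eval A \<phi> \<in> algebra_hom free_algebra A"
  by (auto simp: algebra_hom_def ring_hom_def free_eval_add free_eval_mult free_eval_scale)

lemma free_eval_diff: "free_eval A \<phi> (f - g) = free_eval A \<phi> f \<ominus> free_eval A \<phi> g"
proof -
  have eq: "free_eval A \<phi> f = free_eval A \<phi> (f - g) \<oplus> free_eval A \<phi> g"
    by (simp flip: free_eval_add)
  show ?thesis
    by (subst eq) (simp add: minus_eq a_assoc r_neg)
qed

lemma free_eval_ring_hom:
  "ring_hom_ring (free_algebra :: (complex, 'g free) module) A (free_eval A \<phi>)"
proof (rule ring_hom_ringI2)
  show "ring (free_algebra :: (complex, 'g free) module)"
    using unital_algebra_free unital_algebra.axioms(2) by blast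
  show "free_eval A \<phi> \<in> ring_hom free_algebra A"
    using free_eval_hom by (simp add: algebra_hom_def)
qed (rule ring_axioms)

lemma free_eval_ideal:
  assumes "\<And>r. r \<in> R \<Longrightarrow> free_eval A \<phi> r = \<zero>" and "f \<in> Idl\<^bsub>free_algebra\<^esub> R"
  shows "free_eval A \<phi> f = \<zero>"
proof -
  have "ideal (a_kernel free_algebra A (free_eval A \<phi>)) free_algebra"
    by (rule ring_hom_ring.kernel_is_ideal[OF free_eval_ring_hom])
  moreover have "R \<subseteq> a_kernel free_algebra A (free_eval A \<phi>)"
    unfolding a_kernel_def' using assms(1) by auto
  ultimately have "f \<in> a_kernel free_algebra A (free_eval A \<phi>)"
    using assms(2) unfolding genideal_def by blast
  then show ?thesis unfolding a_kernel_def' by blast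
qed

lemma induced_hom_class:
  assumes "\<And>r. r \<in> R \<Longrightarrow> free_eval A \<phi> r = \<zero>"
  shows "induced_hom A \<phi> (presented_class R f) = free_eval A \<phi> f"
proof -
  have "free_eval A \<phi> ` presented_class R f = {free_eval A \<phi> f}"
  proof -
    have "free_eval A \<phi> g = free_eval A \<phi> f" if "g \<in> presented_class R f" for g
      using that free_eval_ideal[OF assms]
      by (auto simp: presented_class_def a_r_coset_def r_coset_def free_eval_add)
    moreover have "f \<in> presented_class R f"
      by (rule presented_class_self)
    ultimately show ?thesis by blast
  qed
  then show ?thesis by (simp add: induced_hom_def)
qed

lemma induced_hom:
  assumes "\<And>r. r \<in> R \<Longrightarrow> free_eval A \<phi> r = \<zero>"
  shows "induced_hom A \<phi> \<in> algebra_hom (presented_algebra R) A"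
    and "induced_hom A \<phi> (presented_gen R g) = \<phi> g"
  using induced_hom_class[OF assms]
  by (auto simp: algebra_hom_def ring_hom_def carrier_presented free_eval_add free_eval_mult
      free_eval_scale presented_gen_def free_eval_gen)

end
end

section \<open>Tensor products\<close>

text \<open>
  Since bilinear forms separate the elements of a tensor product over a field, \<open>A \<otimes> B\<close> is
  realised as a space of functionals on the bilinear forms on \<open>A \<times> B\<close>, with \<open>a \<otimes> b\<close> being
  evaluation at \<open>(a, b)\<close>. Arguments that are not bilinear forms are mapped to \<open>0\<close>.
  The product is the one with \<open>(a \<otimes> b)(c \<otimes> d) = ac \<otimes> bd\<close>.
\<close>

type_synonym ('a, 'b) tensor = "('a \<Rightarrow> 'b \<Rightarrow> complex) \<Rightarrow> complex"

definition bilinear_forms ::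
  "(complex, 'a, 'm) module_scheme \<Rightarrow> (complex, 'b, 'n) module_scheme \<Rightarrow>
    ('a \<Rightarrow> 'b \<Rightarrow> complex) set" where
  "bilinear_forms A B =
    {\<beta>. (\<forall>a\<in>carrier A. \<forall>a'\<in>carrier A. \<forall>b\<in>carrier B. \<beta> (a \<oplus>\<^bsub>A\<^esub> a') b = \<beta> a b + \<beta> a' b) \<and>
        (\<forall>a\<in>carrier A. \<forall>b\<in>carrier B. \<forall>b'\<in>carrier B. \<beta> a (b \<oplus>\<^bsub>B\<^esub> b') = \<beta> a b + \<beta> a b') \<and>
        (\<forall>c. \<forall>a\<in>carrier A. \<forall>b\<in>carrier B.
          \<beta> (c \<odot>\<^bsub>A\<^esub> a) b = c * \<beta> a b \<and> \<beta> a (c \<odot>\<^bsub>B\<^esub> b) = c * \<beta> a b)}"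

definition pure_tensor ::
  "(complex, 'a, 'm) module_scheme \<Rightarrow> (complex, 'b, 'n) module_scheme \<Rightarrow>
    'a \<Rightarrow> 'b \<Rightarrow> ('a, 'b) tensor" where
  "pure_tensor A B a b = (\<lambda>\<beta>. if \<beta> \<in> bilinear_forms A B then \<beta> a b else 0)"

definition tensor_algebra ::
  "(complex, 'a, 'm) module_scheme \<Rightarrow> (complex, 'b, 'n) module_scheme \<Rightarrow>
    (complex, ('a, 'b) tensor) module" where
  "tensor_algebra A B =
    \<lparr>carrier = {\<lambda>\<beta>. \<Sum>i<n. pure_tensor A B (a i) (b i) \<beta> | (n::nat) a b.
        a \<in> {..<n} \<rightarrow> carrier A \<and> b \<in> {..<n} \<rightarrow> carrier B},
     monoid.mult = (\<lambda>s t \<beta>. if \<beta> \<in> bilinear_forms A B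
        then s (\<lambda>a b. t (\<lambda>c d. \<beta> (a \<otimes>\<^bsub>A\<^esub> c) (b \<otimes>\<^bsub>B\<^esub> d))) else 0),
     one = pure_tensor A B \<one>\<^bsub>A\<^esub> \<one>\<^bsub>B\<^esub>,
     ring.zero = (\<lambda>\<beta>. 0),
     add = (\<lambda>s t \<beta>. s \<beta> + t \<beta>),
     smult = (\<lambda>c t \<beta>. c * t \<beta>)\<rparr>"

lemma bilinear_formsD:
  assumes "\<beta> \<in> bilinear_forms A B"
  shows "\<lbrakk>a \<in> carrier A; a' \<in> carrier A; b \<in> carrier B\<rbrakk> \<Longrightarrow> \<beta> (a \<oplus>\<^bsub>A\<^esub> a') b = \<beta> a b + \<beta> a' b"
    and "\<lbrakk>a \<in> carrier A; b \<in> carrier B; b' \<in> carrier B\<rbrakk> \<Longrightarrow> \<beta> a (b \<oplus>\<^bsub>B\<^esub> b') = \<beta> a b + \<beta> a b'"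
    and "\<lbrakk>a \<in> carrier A; b \<in> carrier B\<rbrakk> \<Longrightarrow> \<beta> (c \<odot>\<^bsub>A\<^esub> a) b = c * \<beta> a b"
    and "\<lbrakk>a \<in> carrier A; b \<in> carrier B\<rbrakk> \<Longrightarrow> \<beta> a (c \<odot>\<^bsub>B\<^esub> b) = c * \<beta> a b"
  using assms by (simp_all add: bilinear_forms_def)

lemma bilinear_forms_add:
  "\<lbrakk>\<beta> \<in> bilinear_forms A B; \<gamma> \<in> bilinear_forms A B\<rbrakk> \<Longrightarrow>
    (\<lambda>a b. \<beta> a b + \<gamma> a b) \<in> bilinear_forms A B"
  by (simp add: bilinear_forms_def distrib_left)

lemma bilinear_forms_scale:
  "\<beta> \<in> bilinear_forms A B \<Longrightarrow> (\<lambda>a b. c * \<beta> a b) \<in> bilinear_forms A B"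
  by (simp add: bilinear_forms_def distrib_left)

lemma bilinear_forms_zero: "(\<lambda>a b. 0) \<in> bilinear_forms A B"
  by (simp add: bilinear_forms_def)

lemma tensor_algebra_simps:
  "\<one>\<^bsub>tensor_algebra A B\<^esub> = pure_tensor A B \<one>\<^bsub>A\<^esub> \<one>\<^bsub>B\<^esub>"
  "\<zero>\<^bsub>tensor_algebra A B\<^esub> = (\<lambda>\<beta>. 0)"
  "s \<oplus>\<^bsub>tensor_algebra A B\<^esub> t = (\<lambda>\<beta>. s \<beta> + t \<beta>)"
  "c \<odot>\<^bsub>tensor_algebra A B\<^esub> t = (\<lambda>\<beta>. c * t \<beta>)"
  "s \<otimes>\<^bsub>tensor_algebra A B\<^esub> t = (\<lambda>\<beta>. if \<beta> \<in> bilinear_forms A B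
     then s (\<lambda>a b. t (\<lambda>c d. \<beta> (a \<otimes>\<^bsub>A\<^esub> c) (b \<otimes>\<^bsub>B\<^esub> d))) else 0)"
  by (simp_all add: tensor_algebra_def)

lemma tensor_zero_closed: "(\<lambda>\<beta>. 0) \<in> carrier (tensor_algebra A B)"
  by (auto simp: tensor_algebra_def intro!: exI[of _ "0::nat"])

lemma tensor_add_pure_closed:
  assumes "t \<in> carrier (tensor_algebra A B)" "a0 \<in> carrier A" "b0 \<in> carrier B"
  shows "(\<lambda>\<beta>. t \<beta> + pure_tensor A B a0 b0 \<beta>) \<in> carrier (tensor_algebra A B)"
proof -
  from assms(1) obtain n :: nat and a b where t:
    "t = (\<lambda>\<beta>. \<Sum>i<n. pure_tensor A B (a i) (b i) \<beta>)"
    "a \<in> {..<n} \<rightarrow> carrier A" "b \<in> {..<n} \<rightarrow> carrier B"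
    by (auto simp: tensor_algebra_def)
  define a' b' where "a' = a(n := a0)" and "b' = b(n := b0)"
  have "(\<lambda>\<beta>. t \<beta> + pure_tensor A B a0 b0 \<beta>) =
      (\<lambda>\<beta>. \<Sum>i<Suc n. pure_tensor A B (a' i) (b' i) \<beta>)"
    by (auto simp: t(1) fun_eq_iff a'_def b'_def intro!: sum.cong)
  moreover have "a' \<in> {..<Suc n} \<rightarrow> carrier A" "b' \<in> {..<Suc n} \<rightarrow> carrier B"
    using t assms(2,3) by (auto simp: Pi_iff less_Suc_eq a'_def b'_def)
  ultimately show ?thesis
    unfolding tensor_algebra_def by (simp del: sum.lessThan_Suc) blast
qed

lemma tensor_induct0 [consumes 1, case_names zero add_pure]:
  assumes "t \<in> carrier (tensor_algebra A B)"
    and "P (\<lambda>\<beta>. 0)"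
    and "\<And>t a b. \<lbrakk>t \<in> carrier (tensor_algebra A B); P t; a \<in> carrier A; b \<in> carrier B\<rbrakk> \<Longrightarrow>
      P (\<lambda>\<beta>. t \<beta> + pure_tensor A B a b \<beta>)"
  shows "P t"
proof -
  from assms(1) obtain n :: nat and a b where t:
    "t = (\<lambda>\<beta>. \<Sum>i<n. pure_tensor A B (a i) (b i) \<beta>)"
    "a \<in> {..<n} \<rightarrow> carrier A" "b \<in> {..<n} \<rightarrow> carrier B"
    by (auto simp: tensor_algebra_def)
  have "m \<le> n \<Longrightarrow> (\<lambda>\<beta>. \<Sum>i<m. pure_tensor A B (a i) (b i) \<beta>) \<in> carrier (tensor_algebra A B) \<and>
    P (\<lambda>\<beta>. \<Sum>i<m. pure_tensor A B (a i) (b i) \<beta>)" for m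
  proof (induction m)
    case (Suc m)
    then have "a m \<in> carrier A" "b m \<in> carrier B" using t by (auto simp: Pi_iff)
    with Suc show ?case by (auto intro: assms(3) tensor_add_pure_closed)
  qed (simp add: tensor_zero_closed assms(2))
  with t(1) show ?thesis by auto
qed

lemma tensor_add_closed:
  assumes "s \<in> carrier (tensor_algebra A B)" "t \<in> carrier (tensor_algebra A B)"
  shows "(\<lambda>\<beta>. s \<beta> + t \<beta>) \<in> carrier (tensor_algebra A B)"
  using assms(2)
proof (induction t rule: tensor_induct0)
  case (add_pure t a b)
  from tensor_add_pure_closed[OF add_pure.IH add_pure.hyps(2,3)] show ?case by (simp add: add.assoc)
qed (simp add: assms(1))

lemma pure_tensor_closed:
  "\<lbrakk>a \<in> carrier A; b \<in> carrier B\<rbrakk> \<Longrightarrow> pure_tensor A B a b \<in> carrier (tensor_algebra A B)"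
  using tensor_add_pure_closed[OF tensor_zero_closed, of a A b B] by simp

lemma tensor_induct [consumes 1, case_names zero pure add]:
  assumes "t \<in> carrier (tensor_algebra A B)"
    and "P (\<lambda>\<beta>. 0)"
    and "\<And>a b. \<lbrakk>a \<in> carrier A; b \<in> carrier B\<rbrakk> \<Longrightarrow> P (pure_tensor A B a b)"
    and "\<And>s t. \<lbrakk>s \<in> carrier (tensor_algebra A B); t \<in> carrier (tensor_algebra A B); P s; P t\<rbrakk> \<Longrightarrow>
      P (\<lambda>\<beta>. s \<beta> + t \<beta>)"
  shows "P t"
  using assms(1)
proof (induction t rule: tensor_induct0)
  case (add_pure t a b)
  then show ?case by (intro assms(3,4) pure_tensor_closed)
qed (rule assms(2))

lemma tensor_cong:
  assumes "t \<in> carrier (tensor_algebra A B)" "\<beta> \<in> bilinear_forms A B" "\<gamma> \<in> bilinear_forms A B"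
    and "\<And>a b. \<lbrakk>a \<in> carrier A; b \<in> carrier B\<rbrakk> \<Longrightarrow> \<beta> a b = \<gamma> a b"
  shows "t \<beta> = t \<gamma>"
  using assms(1) by (induction t rule: tensor_induct) (use assms(2-) in \<open>simp_all add: pure_tensor_def\<close>)

lemma tensor_linear:
  assumes "t \<in> carrier (tensor_algebra A B)" "\<beta> \<in> bilinear_forms A B"
  shows "\<gamma> \<in> bilinear_forms A B \<Longrightarrow> t (\<lambda>a b. \<beta> a b + \<gamma> a b) = t \<beta> + t \<gamma>"
    and "t (\<lambda>a b. c * \<beta> a b) = c * t \<beta>"
  using assms(1)
  by (induction t rule: tensor_induct)
    (use assms(2) in \<open>simp_all add: pure_tensor_def bilinear_forms_add bilinear_forms_scale distrib_left\<close>)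

lemma tensor_outside:
  "t \<in> carrier (tensor_algebra A B) \<Longrightarrow> \<beta> \<notin> bilinear_forms A B \<Longrightarrow> t \<beta> = 0"
  by (induction t rule: tensor_induct) (simp_all add: pure_tensor_def)

context
  fixes A :: "(complex, 'a, 'm) module_scheme" and B :: "(complex, 'b, 'n) module_scheme"
  assumes A: "unital_algebra A" and B: "unital_algebra B"
begin

interpretation A: unital_algebra A by (rule A)
interpretation B: unital_algebra B by (rule B)

lemma bilinear_forms_mult:
  assumes "\<beta> \<in> bilinear_forms A B" "c \<in> carrier A" "d \<in> carrier B"
  shows "(\<lambda>a b. \<beta> (a \<otimes>\<^bsub>A\<^esub> c) (b \<otimes>\<^bsub>B\<^esub> d)) \<in> bilinear_forms A B"
    and "(\<lambda>a b. \<beta> (c \<otimes>\<^bsub>A\<^esub> a) (d \<otimes>\<^bsub>B\<^esub> b)) \<in> bilinear_forms A B"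
  using assms(2-) bilinear_formsD[OF assms(1)]
  by (simp_all add: bilinear_forms_def[of A B] A.l_distr B.l_distr A.r_distr B.r_distr
      A.smult_mult_left B.smult_mult_left A.smult_mult_right B.smult_mult_right)

lemma bilinear_forms_cong:
  assumes "\<gamma> \<in> bilinear_forms A B"
    and "\<And>a b. \<lbrakk>a \<in> carrier A; b \<in> carrier B\<rbrakk> \<Longrightarrow> \<beta> a b = \<gamma> a b"
  shows "\<beta> \<in> bilinear_forms A B"
  using assms by (simp add: bilinear_forms_def)

lemma bilinear_forms_inner:
  assumes "t \<in> carrier (tensor_algebra A B)" and \<beta>: "\<beta> \<in> bilinear_forms A B"
  shows "(\<lambda>a b. t (\<lambda>c d. \<beta> (a \<otimes>\<^bsub>A\<^esub> c) (b \<otimes>\<^bsub>B\<^esub> d))) \<in> bilinear_forms A B"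
  using assms(1)
proof (induction t rule: tensor_induct)
  case (pure c d)
  show ?case
    by (rule bilinear_forms_cong[OF bilinear_forms_mult(1)[OF \<beta> pure]])
      (simp add: pure_tensor_def bilinear_forms_mult(2) \<beta>)
qed (simp_all add: bilinear_forms_zero bilinear_forms_add)

lemma pure_tensor_mult:
  assumes "a \<in> carrier A" "b \<in> carrier B" "c \<in> carrier A" "d \<in> carrier B"
  shows "pure_tensor A B a b \<otimes>\<^bsub>tensor_algebra A B\<^esub> pure_tensor A B c d =
    pure_tensor A B (a \<otimes>\<^bsub>A\<^esub> c) (b \<otimes>\<^bsub>B\<^esub> d)"
proof
  fix \<beta>
  show "(pure_tensor A B a b \<otimes>\<^bsub>tensor_algebra A B\<^esub> pure_tensor A B c d) \<beta> =
    pure_tensor A B (a \<otimes>\<^bsub>A\<^esub> c) (b \<otimes>\<^bsub>B\<^esub> d) \<beta>"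
  proof (cases "\<beta> \<in> bilinear_forms A B")
    case True
    then show ?thesis
      using assms bilinear_forms_inner[OF pure_tensor_closed[OF assms(3,4)] True]
      by (simp add: tensor_algebra_simps pure_tensor_def[of A B a b])
        (simp add: pure_tensor_def bilinear_forms_mult(2))
  qed (simp add: tensor_algebra_simps pure_tensor_def)
qed

lemma pure_tensor_linear:
  shows "\<lbrakk>a \<in> carrier A; a' \<in> carrier A; b \<in> carrier B\<rbrakk> \<Longrightarrow> pure_tensor A B (a \<oplus>\<^bsub>A\<^esub> a') b =
      pure_tensor A B a b \<oplus>\<^bsub>tensor_algebra A B\<^esub> pure_tensor A B a' b"
    and "\<lbrakk>a \<in> carrier A; b \<in> carrier B; b' \<in> carrier B\<rbrakk> \<Longrightarrow> pure_tensor A B a (b \<oplus>\<^bsub>B\<^esub> b') =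
      pure_tensor A B a b \<oplus>\<^bsub>tensor_algebra A B\<^esub> pure_tensor A B a b'"
    and "\<lbrakk>a \<in> carrier A; b \<in> carrier B\<rbrakk> \<Longrightarrow>
      pure_tensor A B (c \<odot>\<^bsub>A\<^esub> a) b = c \<odot>\<^bsub>tensor_algebra A B\<^esub> pure_tensor A B a b"
    and "\<lbrakk>a \<in> carrier A; b \<in> carrier B\<rbrakk> \<Longrightarrow>
      pure_tensor A B a (c \<odot>\<^bsub>B\<^esub> b) = c \<odot>\<^bsub>tensor_algebra A B\<^esub> pure_tensor A B a b"
  by (auto simp: pure_tensor_def tensor_algebra_simps bilinear_formsD)

lemma tensor_mult_distrib:
  assumes "r \<in> carrier (tensor_algebra A B)" "s \<in> carrier (tensor_algebra A B)"
    "t \<in> carrier (tensor_algebra A B)"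
  shows "(r \<oplus>\<^bsub>tensor_algebra A B\<^esub> s) \<otimes>\<^bsub>tensor_algebra A B\<^esub> t =
      r \<otimes>\<^bsub>tensor_algebra A B\<^esub> t \<oplus>\<^bsub>tensor_algebra A B\<^esub> s \<otimes>\<^bsub>tensor_algebra A B\<^esub> t"
    and "t \<otimes>\<^bsub>tensor_algebra A B\<^esub> (r \<oplus>\<^bsub>tensor_algebra A B\<^esub> s) =
      t \<otimes>\<^bsub>tensor_algebra A B\<^esub> r \<oplus>\<^bsub>tensor_algebra A B\<^esub> t \<otimes>\<^bsub>tensor_algebra A B\<^esub> s"
  using assms
    tensor_linear(1)[OF assms(3) bilinear_forms_inner[OF assms(1)] bilinear_forms_inner[OF assms(2)]]
  by (simp_all add: tensor_algebra_simps fun_eq_iff)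

lemma tensor_mult_zero:
  assumes "t \<in> carrier (tensor_algebra A B)"
  shows "t \<otimes>\<^bsub>tensor_algebra A B\<^esub> \<zero>\<^bsub>tensor_algebra A B\<^esub> = \<zero>\<^bsub>tensor_algebra A B\<^esub>"
    and "\<zero>\<^bsub>tensor_algebra A B\<^esub> \<otimes>\<^bsub>tensor_algebra A B\<^esub> t = \<zero>\<^bsub>tensor_algebra A B\<^esub>"
  using tensor_linear(2)[OF assms bilinear_forms_zero, of 0]
  by (auto simp: tensor_algebra_simps)

lemma tensor_induct' [consumes 1, case_names zero pure add]:
  assumes "t \<in> carrier (tensor_algebra A B)"
    and "P \<zero>\<^bsub>tensor_algebra A B\<^esub>"
    and "\<And>a b. \<lbrakk>a \<in> carrier A; b \<in> carrier B\<rbrakk> \<Longrightarrow> P (pure_tensor A B a b)"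
    and "\<And>s t. \<lbrakk>s \<in> carrier (tensor_algebra A B); t \<in> carrier (tensor_algebra A B); P s; P t\<rbrakk> \<Longrightarrow>
      P (s \<oplus>\<^bsub>tensor_algebra A B\<^esub> t)"
  shows "P t"
  using assms(1)
  by (induction t rule: tensor_induct)
    (use assms(2-) in \<open>simp_all add: tensor_algebra_simps(2,3)\<close>)

lemma tensor_mult_closed:
  assumes "s \<in> carrier (tensor_algebra A B)" "t \<in> carrier (tensor_algebra A B)"
  shows "s \<otimes>\<^bsub>tensor_algebra A B\<^esub> t \<in> carrier (tensor_algebra A B)"
proof -
  have zero: "\<zero>\<^bsub>tensor_algebra A B\<^esub> \<in> carrier (tensor_algebra A B)"
    by (simp add: tensor_algebra_simps tensor_zero_closed)
  have add: "u \<oplus>\<^bsub>tensor_algebra A B\<^esub> v \<in> carrier (tensor_algebra A B)"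
    if "u \<in> carrier (tensor_algebra A B)" "v \<in> carrier (tensor_algebra A B)" for u v
    using that by (simp add: tensor_algebra_simps tensor_add_closed)
  have pure: "pure_tensor A B a b \<otimes>\<^bsub>tensor_algebra A B\<^esub> t \<in> carrier (tensor_algebra A B)"
    if "a \<in> carrier A" "b \<in> carrier B" for a b
    using assms(2)
    by (induction t rule: tensor_induct')
      (simp_all add: that tensor_mult_zero tensor_mult_distrib pure_tensor_mult pure_tensor_closed
        zero add)
  from assms(1) show ?thesis
    by (induction s rule: tensor_induct')
      (simp_all add: assms(2) tensor_mult_zero tensor_mult_distrib zero add pure)
qed

lemma tensor_smult_closed:
  assumes "t \<in> carrier (tensor_algebra A B)"
  shows "c \<odot>\<^bsub>tensor_algebra A B\<^esub> t \<in> carrier (tensor_algebra A B)"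
  using assms
proof (induction t rule: tensor_induct)
  case (pure a b)
  then show ?case
    by (simp add: pure_tensor_closed flip: pure_tensor_linear(3))
qed (simp_all add: tensor_algebra_simps tensor_zero_closed tensor_add_closed distrib_left)

lemma tensor_mult_assoc:
  assumes "r \<in> carrier (tensor_algebra A B)" "s \<in> carrier (tensor_algebra A B)"
    "t \<in> carrier (tensor_algebra A B)"
  shows "(r \<otimes>\<^bsub>tensor_algebra A B\<^esub> s) \<otimes>\<^bsub>tensor_algebra A B\<^esub> t =
    r \<otimes>\<^bsub>tensor_algebra A B\<^esub> (s \<otimes>\<^bsub>tensor_algebra A B\<^esub> t)"
proof -
  have pure2: "(pure_tensor A B a b \<otimes>\<^bsub>tensor_algebra A B\<^esub> pure_tensor A B c d) \<otimes>\<^bsub>tensor_algebra A B\<^esub> t =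
      pure_tensor A B a b \<otimes>\<^bsub>tensor_algebra A B\<^esub> (pure_tensor A B c d \<otimes>\<^bsub>tensor_algebra A B\<^esub> t)"
    if "a \<in> carrier A" "b \<in> carrier B" "c \<in> carrier A" "d \<in> carrier B" for a b c d
    using assms(3)
    by (induction t rule: tensor_induct')
      (simp_all add: that tensor_mult_zero tensor_mult_distrib tensor_mult_closed
        pure_tensor_mult pure_tensor_closed A.m_assoc B.m_assoc)
  have pure1: "(pure_tensor A B a b \<otimes>\<^bsub>tensor_algebra A B\<^esub> s) \<otimes>\<^bsub>tensor_algebra A B\<^esub> t =
      pure_tensor A B a b \<otimes>\<^bsub>tensor_algebra A B\<^esub> (s \<otimes>\<^bsub>tensor_algebra A B\<^esub> t)"
    if "a \<in> carrier A" "b \<in> carrier B" for a b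
    using assms(2)
    by (induction s rule: tensor_induct')
      (simp_all add: that assms(3) tensor_mult_zero tensor_mult_distrib tensor_mult_closed
        pure_tensor_closed pure2)
  from assms(1) show ?thesis
    by (induction r rule: tensor_induct')
      (simp_all add: assms(2,3) tensor_mult_zero tensor_mult_distrib tensor_mult_closed pure1)
qed

lemma tensor_mult_one:
  assumes "t \<in> carrier (tensor_algebra A B)"
  shows "t \<otimes>\<^bsub>tensor_algebra A B\<^esub> \<one>\<^bsub>tensor_algebra A B\<^esub> = t"
    and "\<one>\<^bsub>tensor_algebra A B\<^esub> \<otimes>\<^bsub>tensor_algebra A B\<^esub> t = t"
  unfolding tensor_algebra_simps(1) using assms
  by (induction t rule: tensor_induct')
    (simp_all add: tensor_mult_zero tensor_mult_distrib pure_tensor_closed pure_tensor_mult)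

lemma tensor_one_closed: "\<one>\<^bsub>tensor_algebra A B\<^esub> \<in> carrier (tensor_algebra A B)"
  by (simp add: tensor_algebra_simps pure_tensor_closed)

lemma unital_algebra_tensor: "unital_algebra (tensor_algebra A B)"
proof (rule unital_algebraI)
  have "abelian_group (tensor_algebra A B)"
  proof (rule abelian_groupI)
    fix t assume t: "t \<in> carrier (tensor_algebra A B)"
    show "\<exists>s\<in>carrier (tensor_algebra A B).
        s \<oplus>\<^bsub>tensor_algebra A B\<^esub> t = \<zero>\<^bsub>tensor_algebra A B\<^esub>"
      by (rule bexI[OF _ tensor_smult_closed[OF t, of "-1"]]) (simp add: tensor_algebra_simps)
  qed (auto simp: tensor_algebra_simps tensor_add_closed tensor_zero_closed)
  then show "ring (tensor_algebra A B)"
    by (rule ringI[OF _ monoidI])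
      (simp_all add: tensor_mult_closed tensor_mult_assoc tensor_mult_one tensor_mult_distrib
        tensor_one_closed)
  fix c s t
  assume "s \<in> carrier (tensor_algebra A B)" "t \<in> carrier (tensor_algebra A B)"
  from tensor_linear(2)[OF this(1) bilinear_forms_inner[OF this(2)]]
  show "s \<otimes>\<^bsub>tensor_algebra A B\<^esub> (c \<odot>\<^bsub>tensor_algebra A B\<^esub> t) =
      c \<odot>\<^bsub>tensor_algebra A B\<^esub> (s \<otimes>\<^bsub>tensor_algebra A B\<^esub> t)"
    by (simp add: tensor_algebra_simps fun_eq_iff)
qed (use tensor_smult_closed in \<open>auto simp: tensor_algebra_simps algebra_simps\<close>)

end

section \<open>Hopf algebras and module algebras\<close>

record 'h hopf_algebra = "(complex, 'h) module" +
  comult :: "'h \<Rightarrow> ('h, 'h) tensor"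
  counit :: "'h \<Rightarrow> complex"
  antipode :: "'h \<Rightarrow> 'h"

definition module_algebra_structure ::
  "('h, 'm) hopf_algebra_scheme \<Rightarrow> (complex, 'a, 'n) module_scheme \<Rightarrow> ('h \<Rightarrow> 'a \<Rightarrow> 'a) \<Rightarrow> bool"
  where
  "module_algebra_structure H A \<pi> \<longleftrightarrow>
    \<pi> \<in> algebra_hom H (End_algebra A) \<and>
    (\<forall>h\<in>carrier H. \<forall>(n::nat) h' h''.
      h' \<in> {..<n} \<rightarrow> carrier H \<longrightarrow> h'' \<in> {..<n} \<rightarrow> carrier H \<longrightarrow>
      comult H h = (\<Oplus>\<^bsub>tensor_algebra H H\<^esub>i\<in>{..<n}. pure_tensor H H (h' i) (h'' i)) \<longrightarrow>
      (\<forall>a\<in>carrier A. \<forall>b\<in>carrier A.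
        \<pi> h (a \<otimes>\<^bsub>A\<^esub> b) = (\<Oplus>\<^bsub>A\<^esub>i\<in>{..<n}. \<pi> (h' i) a \<otimes>\<^bsub>A\<^esub> \<pi> (h'' i) b))) \<and>
    (\<forall>h\<in>carrier H. \<pi> h \<one>\<^bsub>A\<^esub> = counit H h \<odot>\<^bsub>A\<^esub> \<one>\<^bsub>A\<^esub>)"

section \<open>The quantum plane\<close>

datatype plane_gen = gen_x | gen_y

definition plane_relations :: "complex \<Rightarrow> plane_gen free set" where
  "plane_relations q =
    {free_gen gen_y * free_gen gen_x - free_scale q (free_gen gen_x * free_gen gen_y)}"

definition quantum_plane :: "complex \<Rightarrow> (complex, plane_gen free set) module" where
  "quantum_plane q = presented_algebra (plane_relations q)"

definition plane_x :: "complex \<Rightarrow> plane_gen free set" where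
  "plane_x q = presented_gen (plane_relations q) gen_x"

definition plane_y :: "complex \<Rightarrow> plane_gen free set" where
  "plane_y q = presented_gen (plane_relations q) gen_y"

section \<open>The quantum group \<open>U\<^sub>q(sl\<^sub>2)\<close>\<close>

datatype uq_gen = gen_k | gen_kinv | gen_e | gen_f

definition uq_relations :: "complex \<Rightarrow> uq_gen free set" where
  "uq_relations q =
    {free_gen gen_kinv * free_gen gen_k - 1,
     free_gen gen_k * free_gen gen_kinv - 1,
     free_gen gen_k * free_gen gen_e - free_scale (q\<^sup>2) (free_gen gen_e * free_gen gen_k),
     free_gen gen_k * free_gen gen_f - free_scale (inverse (q\<^sup>2)) (free_gen gen_f * free_gen gen_k),
     free_gen gen_e * free_gen gen_f - free_gen gen_f * free_gen gen_e
       - free_scale (1 / (q - inverse q)) (free_gen gen_k - free_gen gen_kinv)}"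

definition uq_algebra :: "complex \<Rightarrow> (complex, uq_gen free set) module" where
  "uq_algebra q = presented_algebra (uq_relations q)"

definition uq_gen :: "complex \<Rightarrow> uq_gen \<Rightarrow> uq_gen free set" where
  "uq_gen q g = presented_gen (uq_relations q) g"

definition uq_comult ::
  "complex \<Rightarrow> uq_gen free set \<Rightarrow> (uq_gen free set, uq_gen free set) tensor" where
  "uq_comult q =
    (let U = uq_algebra q; T = tensor_algebra U U; tensor = pure_tensor U U; u = uq_gen q in
      induced_hom T (\<lambda>g. case g of
          gen_k \<Rightarrow> tensor (u gen_k) (u gen_k)
        | gen_kinv \<Rightarrow> tensor (u gen_kinv) (u gen_kinv)
        | gen_e \<Rightarrow> tensor \<one>\<^bsub>U\<^esub> (u gen_e) \<oplus>\<^bsub>T\<^esub> tensor (u gen_e) (u gen_k)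
        | gen_f \<Rightarrow> tensor (u gen_f) \<one>\<^bsub>U\<^esub> \<oplus>\<^bsub>T\<^esub> tensor (u gen_kinv) (u gen_f)))"

definition uq_counit :: "complex \<Rightarrow> uq_gen free set \<Rightarrow> complex" where
  "uq_counit q =
    induced_hom complex_algebra (\<lambda>g. case g of gen_k \<Rightarrow> 1 | gen_kinv \<Rightarrow> 1 | gen_e \<Rightarrow> 0 | gen_f \<Rightarrow> 0)"

text \<open>The antipode is an antihomomorphism, i.e. a homomorphism into the opposite algebra.\<close>

definition uq_antipode :: "complex \<Rightarrow> uq_gen free set \<Rightarrow> uq_gen free set" where
  "uq_antipode q =
    (let U = uq_algebra q; u = uq_gen q in
      induced_hom (opposite_algebra U) (\<lambda>g. case g of
          gen_k \<Rightarrow> u gen_kinv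
        | gen_kinv \<Rightarrow> u gen_k
        | gen_e \<Rightarrow> \<ominus>\<^bsub>U\<^esub> (u gen_e \<otimes>\<^bsub>U\<^esub> u gen_kinv)
        | gen_f \<Rightarrow> \<ominus>\<^bsub>U\<^esub> (u gen_k \<otimes>\<^bsub>U\<^esub> u gen_f)))"

definition Uq :: "complex \<Rightarrow> uq_gen free set hopf_algebra" where
  "Uq q = module.extend (uq_algebra q)
    (hopf_algebra.fields (uq_comult q) (uq_counit q) (uq_antipode q))"

lemma unital_algebra_uq: "unital_algebra (uq_algebra q)"
  by (simp add: uq_algebra_def unital_algebra_presented)

lemma uq_gen_closed [simp]: "uq_gen q g \<in> carrier (uq_algebra q)"
  by (simp add: uq_gen_def uq_algebra_def presented_gen_def)

lemma uq_algebra_relations: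
  fixes q
  defines "U \<equiv> uq_algebra q" and "k \<equiv> uq_gen q gen_k" and "k' \<equiv> uq_gen q gen_kinv"
    and "e \<equiv> uq_gen q gen_e" and "f \<equiv> uq_gen q gen_f"
  shows "k' \<otimes>\<^bsub>U\<^esub> k = \<one>\<^bsub>U\<^esub>" "k \<otimes>\<^bsub>U\<^esub> k' = \<one>\<^bsub>U\<^esub>"
    "k \<otimes>\<^bsub>U\<^esub> e = q\<^sup>2 \<odot>\<^bsub>U\<^esub> (e \<otimes>\<^bsub>U\<^esub> k)"
    "k \<otimes>\<^bsub>U\<^esub> f = inverse (q\<^sup>2) \<odot>\<^bsub>U\<^esub> (f \<otimes>\<^bsub>U\<^esub> k)"
    "e \<otimes>\<^bsub>U\<^esub> f \<ominus>\<^bsub>U\<^esub> f \<otimes>\<^bsub>U\<^esub> e = (1 / (q - inverse q)) \<odot>\<^bsub>U\<^esub> (k \<ominus>\<^bsub>U\<^esub> k')"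
proof -
  interpret U: unital_algebra U unfolding U_def by (rule unital_algebra_uq)
  have minus: "presented_class (uq_relations q) g \<ominus>\<^bsub>U\<^esub> presented_class (uq_relations q) h =
      presented_class (uq_relations q) (g - h)" for g h
  proof -
    have "presented_class (uq_relations q) g =
        presented_class (uq_relations q) (g - h) \<oplus>\<^bsub>U\<^esub> presented_class (uq_relations q) h"
      by (simp add: U_def uq_algebra_def)
    moreover have "presented_class (uq_relations q) g' \<in> carrier U" for g'
      by (simp add: U_def uq_algebra_def)
    ultimately show ?thesis
      by (metis U.add.inv_solve_right U.minus_eq)
  qed
  note simps = U_def k_def k'_def e_def f_def uq_gen_def presented_gen_def uq_algebra_def
  show "k' \<otimes>\<^bsub>U\<^esub> k = \<one>\<^bsub>U\<^esub>" "k \<otimes>\<^bsub>U\<^esub> k' = \<one>\<^bsub>U\<^esub>"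
    "k \<otimes>\<^bsub>U\<^esub> e = q\<^sup>2 \<odot>\<^bsub>U\<^esub> (e \<otimes>\<^bsub>U\<^esub> k)"
    "k \<otimes>\<^bsub>U\<^esub> f = inverse (q\<^sup>2) \<odot>\<^bsub>U\<^esub> (f \<otimes>\<^bsub>U\<^esub> k)"
    by (auto simp: simps uq_relations_def intro!: presented_relation)
  have "e \<otimes>\<^bsub>U\<^esub> f \<ominus>\<^bsub>U\<^esub> f \<otimes>\<^bsub>U\<^esub> e = presented_class (uq_relations q)
      (free_gen gen_e * free_gen gen_f - free_gen gen_f * free_gen gen_e)"
    by (simp flip: minus) (simp add: simps)
  also have "\<dots> = presented_class (uq_relations q)
      (free_scale (1 / (q - inverse q)) (free_gen gen_k - free_gen gen_kinv))"
    by (rule presented_relation) (simp add: uq_relations_def)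
  also have "\<dots> = (1 / (q - inverse q)) \<odot>\<^bsub>U\<^esub>
      presented_class (uq_relations q) (free_gen gen_k - free_gen gen_kinv)"
    by (simp add: U_def uq_algebra_def)
  also have "presented_class (uq_relations q) (free_gen gen_k - free_gen gen_kinv) = k \<ominus>\<^bsub>U\<^esub> k'"
    by (simp flip: minus) (simp add: simps)
  finally show "e \<otimes>\<^bsub>U\<^esub> f \<ominus>\<^bsub>U\<^esub> f \<otimes>\<^bsub>U\<^esub> e = (1 / (q - inverse q)) \<odot>\<^bsub>U\<^esub> (k \<ominus>\<^bsub>U\<^esub> k')" .
qed

text \<open>
  A choice of values in \<open>B\<close> satisfying the relations induces a homomorphism on \<open>U\<^sub>q(sl\<^sub>2)\<close>.
\<close>

lemma uq_induced_hom:
  assumes "unital_algebra B" and \<phi>: "\<And>g. \<phi> g \<in> carrier B"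
    and "\<phi> gen_kinv \<otimes>\<^bsub>B\<^esub> \<phi> gen_k = \<one>\<^bsub>B\<^esub>" "\<phi> gen_k \<otimes>\<^bsub>B\<^esub> \<phi> gen_kinv = \<one>\<^bsub>B\<^esub>"
    "\<phi> gen_k \<otimes>\<^bsub>B\<^esub> \<phi> gen_e = q\<^sup>2 \<odot>\<^bsub>B\<^esub> (\<phi> gen_e \<otimes>\<^bsub>B\<^esub> \<phi> gen_k)"
    "\<phi> gen_k \<otimes>\<^bsub>B\<^esub> \<phi> gen_f = inverse (q\<^sup>2) \<odot>\<^bsub>B\<^esub> (\<phi> gen_f \<otimes>\<^bsub>B\<^esub> \<phi> gen_k)"
    "\<phi> gen_e \<otimes>\<^bsub>B\<^esub> \<phi> gen_f \<ominus>\<^bsub>B\<^esub> \<phi> gen_f \<otimes>\<^bsub>B\<^esub> \<phi> gen_e =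
      (1 / (q - inverse q)) \<odot>\<^bsub>B\<^esub> (\<phi> gen_k \<ominus>\<^bsub>B\<^esub> \<phi> gen_kinv)"
  shows "induced_hom B \<phi> \<in> algebra_hom (uq_algebra q) B"
    and "induced_hom B \<phi> (uq_gen q g) = \<phi> g"
proof -
  interpret B: unital_algebra B by fact
  have "free_eval B \<phi> r = \<zero>\<^bsub>B\<^esub>" if "r \<in> uq_relations q" for r
    using that unfolding uq_relations_def
    by (auto simp: B.free_eval_diff B.free_eval_mult B.free_eval_scale B.free_eval_gen assms
        B.minus_eq[of "\<phi> _"] B.r_neg B.minus_eq[of "\<one>\<^bsub>B\<^esub>"] B.minus_eq[of "_ \<odot>\<^bsub>B\<^esub> _"])
  from B.induced_hom[OF \<phi> this] show
    "induced_hom B \<phi> \<in> algebra_hom (uq_algebra q) B" "induced_hom B \<phi> (uq_gen q g) = \<phi> g"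
    by (simp_all add: uq_algebra_def uq_gen_def)
qed

lemma uq_counit:
  "uq_counit q \<in> algebra_hom (uq_algebra q) complex_algebra"
  "uq_counit q (uq_gen q gen_k) = 1" "uq_counit q (uq_gen q gen_kinv) = 1"
  "uq_counit q (uq_gen q gen_e) = 0" "uq_counit q (uq_gen q gen_f) = 0"
proof -
  interpret C: unital_algebra complex_algebra by (rule unital_algebra_complex)
  define \<phi> :: "uq_gen \<Rightarrow> complex" where
    "\<phi> = (\<lambda>g. case g of gen_k \<Rightarrow> 1 | gen_kinv \<Rightarrow> 1 | gen_e \<Rightarrow> 0 | gen_f \<Rightarrow> 0)"
  have minus: "x \<ominus>\<^bsub>complex_algebra\<^esub> x = 0" for x
    using C.r_neg[of x] unfolding C.minus_eq by (simp add: complex_algebra_def)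
  have "induced_hom complex_algebra \<phi> \<in> algebra_hom (uq_algebra q) complex_algebra \<and>
      induced_hom complex_algebra \<phi> (uq_gen q g) = \<phi> g" for g
    by (intro conjI uq_induced_hom unital_algebra_complex)
      (simp_all add: \<phi>_def minus, simp_all add: complex_algebra_def)
  moreover have "uq_counit q = induced_hom complex_algebra \<phi>"
    by (simp add: uq_counit_def \<phi>_def)
  ultimately show
    "uq_counit q \<in> algebra_hom (uq_algebra q) complex_algebra"
    "uq_counit q (uq_gen q gen_k) = 1" "uq_counit q (uq_gen q gen_kinv) = 1"
    "uq_counit q (uq_gen q gen_e) = 0" "uq_counit q (uq_gen q gen_f) = 0"
    by (simp_all add: \<phi>_def)
qed

lemma uq_antipode:
  fixes q :: complex
  defines "U \<equiv> uq_algebra q" and "k \<equiv> uq_gen q gen_k" and "k' \<equiv> uq_gen q gen_kinv"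
    and "e \<equiv> uq_gen q gen_e" and "f \<equiv> uq_gen q gen_f"
  assumes q0: "q \<noteq> 0"
  shows "uq_antipode q \<in> algebra_hom U (opposite_algebra U)"
    and "uq_antipode q k = k'" "uq_antipode q k' = k"
      "uq_antipode q e = \<ominus>\<^bsub>U\<^esub> (e \<otimes>\<^bsub>U\<^esub> k')" "uq_antipode q f = \<ominus>\<^bsub>U\<^esub> (k \<otimes>\<^bsub>U\<^esub> f)"
proof -
  interpret U: unital_algebra U unfolding U_def by (rule unital_algebra_uq)
  interpret V: unital_algebra "opposite_algebra U"
    by (rule unital_algebra_opposite) (rule U.unital_algebra_axioms)
  have car [simp]: "k \<in> carrier U" "k' \<in> carrier U" "e \<in> carrier U" "f \<in> carrier U"
    by (simp_all add: U_def k_def k'_def e_def f_def)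
  note rel = uq_algebra_relations[of q, folded U_def k_def k'_def e_def f_def]
  have op: "carrier (opposite_algebra U) = carrier U" "a \<otimes>\<^bsub>opposite_algebra U\<^esub> b = b \<otimes>\<^bsub>U\<^esub> a"
    "\<one>\<^bsub>opposite_algebra U\<^esub> = \<one>\<^bsub>U\<^esub>" "c \<odot>\<^bsub>opposite_algebra U\<^esub> a = c \<odot>\<^bsub>U\<^esub> a"
    "a \<ominus>\<^bsub>opposite_algebra U\<^esub> b = a \<ominus>\<^bsub>U\<^esub> b" for a b c
    by (simp_all add: opposite_algebra_def a_minus_def a_inv_def)
  have neg: "\<ominus>\<^bsub>U\<^esub> a = (-1) \<odot>\<^bsub>U\<^esub> a" if "a \<in> carrier U" for a
    using that by (simp add: U.smult_minus_one)
  have canc: "k' \<otimes>\<^bsub>U\<^esub> (k \<otimes>\<^bsub>U\<^esub> a) = a" "k \<otimes>\<^bsub>U\<^esub> (k' \<otimes>\<^bsub>U\<^esub> a) = a" if "a \<in> carrier U" for a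
    using that by (simp_all add: rel flip: U.m_assoc)
  have ek': "e \<otimes>\<^bsub>U\<^esub> k' = q\<^sup>2 \<odot>\<^bsub>U\<^esub> (k' \<otimes>\<^bsub>U\<^esub> e)"
  proof -
    have "e \<otimes>\<^bsub>U\<^esub> k' = k' \<otimes>\<^bsub>U\<^esub> ((k \<otimes>\<^bsub>U\<^esub> e) \<otimes>\<^bsub>U\<^esub> k')"
      by (simp add: canc U.m_assoc)
    also have "\<dots> = q\<^sup>2 \<odot>\<^bsub>U\<^esub> (k' \<otimes>\<^bsub>U\<^esub> e)"
      by (simp add: rel U.smult_mult_left U.smult_mult_right U.m_assoc)
    finally show ?thesis .
  qed
  have kfek': "(k \<otimes>\<^bsub>U\<^esub> f) \<otimes>\<^bsub>U\<^esub> (e \<otimes>\<^bsub>U\<^esub> k') = f \<otimes>\<^bsub>U\<^esub> e"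
    using q0
    by (simp add: ek' rel(4) U.smult_mult_left U.smult_mult_right U.smult_smult U.m_assoc canc)
  have ek'kf: "(e \<otimes>\<^bsub>U\<^esub> k') \<otimes>\<^bsub>U\<^esub> (k \<otimes>\<^bsub>U\<^esub> f) = e \<otimes>\<^bsub>U\<^esub> f"
    by (simp add: U.m_assoc canc)
  have kfk': "k \<otimes>\<^bsub>U\<^esub> (f \<otimes>\<^bsub>U\<^esub> k') = inverse (q\<^sup>2) \<odot>\<^bsub>U\<^esub> f"
  proof -
    have "k \<otimes>\<^bsub>U\<^esub> (f \<otimes>\<^bsub>U\<^esub> k') = (k \<otimes>\<^bsub>U\<^esub> f) \<otimes>\<^bsub>U\<^esub> k'"
      by (simp add: U.m_assoc)
    also have "\<dots> = inverse (q\<^sup>2) \<odot>\<^bsub>U\<^esub> f"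
      by (simp add: rel U.smult_mult_left U.m_assoc)
    finally show ?thesis .
  qed
  define \<phi> where "\<phi> = (\<lambda>g. case g of gen_k \<Rightarrow> k' | gen_kinv \<Rightarrow> k
        | gen_e \<Rightarrow> \<ominus>\<^bsub>U\<^esub> (e \<otimes>\<^bsub>U\<^esub> k') | gen_f \<Rightarrow> \<ominus>\<^bsub>U\<^esub> (k \<otimes>\<^bsub>U\<^esub> f))"
  have swap: "b \<ominus>\<^bsub>U\<^esub> a = (-1) \<odot>\<^bsub>U\<^esub> (a \<ominus>\<^bsub>U\<^esub> b)" if "a \<in> carrier U" "b \<in> carrier U" for a b
    using that by (simp add: U.minus_eq U.smult_minus_one U.minus_add U.add.m_comm)
  have closed: "\<phi> g \<in> carrier (opposite_algebra U)" for g
    by (simp add: \<phi>_def op split: uq_gen.split)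
  have "(k \<otimes>\<^bsub>U\<^esub> f) \<otimes>\<^bsub>U\<^esub> (e \<otimes>\<^bsub>U\<^esub> k') \<ominus>\<^bsub>U\<^esub> (e \<otimes>\<^bsub>U\<^esub> k') \<otimes>\<^bsub>U\<^esub> (k \<otimes>\<^bsub>U\<^esub> f) =
      (1 / (q - inverse q)) \<odot>\<^bsub>U\<^esub> (k' \<ominus>\<^bsub>U\<^esub> k)"
    using swap[of "e \<otimes>\<^bsub>U\<^esub> f" "f \<otimes>\<^bsub>U\<^esub> e"] swap[of k k']
    by (simp add: kfek' ek'kf rel(5) U.smult_smult)
  then have EF: "\<phi> gen_e \<otimes>\<^bsub>opposite_algebra U\<^esub> \<phi> gen_f
      \<ominus>\<^bsub>opposite_algebra U\<^esub> \<phi> gen_f \<otimes>\<^bsub>opposite_algebra U\<^esub> \<phi> gen_e =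
      (1 / (q - inverse q)) \<odot>\<^bsub>opposite_algebra U\<^esub> (\<phi> gen_k \<ominus>\<^bsub>opposite_algebra U\<^esub> \<phi> gen_kinv)"
    by (simp add: op \<phi>_def neg U.smult_mult_left U.smult_mult_right U.smult_smult)
  have KE: "\<phi> gen_k \<otimes>\<^bsub>opposite_algebra U\<^esub> \<phi> gen_e =
      q\<^sup>2 \<odot>\<^bsub>opposite_algebra U\<^esub> (\<phi> gen_e \<otimes>\<^bsub>opposite_algebra U\<^esub> \<phi> gen_k)"
    by (simp add: op \<phi>_def neg U.smult_mult_left U.smult_mult_right U.smult_smult ek'
        U.m_assoc mult.commute)
  have KF: "\<phi> gen_k \<otimes>\<^bsub>opposite_algebra U\<^esub> \<phi> gen_f =
      inverse (q\<^sup>2) \<odot>\<^bsub>opposite_algebra U\<^esub> (\<phi> gen_f \<otimes>\<^bsub>opposite_algebra U\<^esub> \<phi> gen_k)"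
    by (simp add: op \<phi>_def neg U.smult_mult_left U.smult_mult_right U.smult_smult U.m_assoc
        mult.commute canc kfk')
  have "induced_hom (opposite_algebra U) \<phi> \<in> algebra_hom U (opposite_algebra U) \<and>
      induced_hom (opposite_algebra U) \<phi> (uq_gen q g) = \<phi> g" for g
    unfolding U_def
    by (intro conjI uq_induced_hom)
      (use closed EF KE KF V.unital_algebra_axioms in
        \<open>simp_all add: U_def[symmetric]\<close>, simp_all add: op \<phi>_def rel)
  moreover have "uq_antipode q = induced_hom (opposite_algebra U) \<phi>"
    unfolding uq_antipode_def \<phi>_def U_def k_def k'_def e_def f_def Let_def by (rule refl)
  ultimately show "uq_antipode q \<in> algebra_hom U (opposite_algebra U)"
    and "uq_antipode q k = k'" "uq_antipode q k' = k"
      "uq_antipode q e = \<ominus>\<^bsub>U\<^esub> (e \<otimes>\<^bsub>U\<^esub> k')" "uq_antipode q f = \<ominus>\<^bsub>U\<^esub> (k \<otimes>\<^bsub>U\<^esub> f)"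
    by (simp_all add: \<phi>_def k_def k'_def e_def f_def)
qed

lemma uq_comult:
  fixes q :: complex
  defines "U \<equiv> uq_algebra q" and "k \<equiv> uq_gen q gen_k" and "k' \<equiv> uq_gen q gen_kinv"
    and "e \<equiv> uq_gen q gen_e" and "f \<equiv> uq_gen q gen_f"
  defines "T \<equiv> tensor_algebra U U" and "tensor \<equiv> pure_tensor U U"
  assumes q0: "q \<noteq> 0"
  shows "uq_comult q \<in> algebra_hom U T"
    and "uq_comult q k = tensor k k" "uq_comult q k' = tensor k' k'"
      "uq_comult q e = tensor \<one>\<^bsub>U\<^esub> e \<oplus>\<^bsub>T\<^esub> tensor e k"
      "uq_comult q f = tensor f \<one>\<^bsub>U\<^esub> \<oplus>\<^bsub>T\<^esub> tensor k' f"
proof -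
  interpret U: unital_algebra U unfolding U_def by (rule unital_algebra_uq)
  interpret T: unital_algebra T
    unfolding T_def by (rule unital_algebra_tensor) (rule U.unital_algebra_axioms)+
  have car [simp]: "k \<in> carrier U" "k' \<in> carrier U" "e \<in> carrier U" "f \<in> carrier U"
    by (simp_all add: U_def k_def k'_def e_def f_def)
  note rel = uq_algebra_relations[of q, folded U_def k_def k'_def e_def f_def]
  note lin = pure_tensor_linear[OF U.unital_algebra_axioms U.unital_algebra_axioms,
      folded T_def tensor_def]
  have tmult [simp]: "tensor a b \<otimes>\<^bsub>T\<^esub> tensor c d = tensor (a \<otimes>\<^bsub>U\<^esub> c) (b \<otimes>\<^bsub>U\<^esub> d)"
    if "a \<in> carrier U" "b \<in> carrier U" "c \<in> carrier U" "d \<in> carrier U" for a b c d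
    using that pure_tensor_mult[OF U.unital_algebra_axioms U.unital_algebra_axioms]
    by (simp add: T_def tensor_def)
  have tcl [simp]: "tensor a b \<in> carrier T" if "a \<in> carrier U" "b \<in> carrier U" for a b
    using that by (simp add: T_def tensor_def pure_tensor_closed)
  have canc: "k' \<otimes>\<^bsub>U\<^esub> (k \<otimes>\<^bsub>U\<^esub> a) = a" "k \<otimes>\<^bsub>U\<^esub> (k' \<otimes>\<^bsub>U\<^esub> a) = a" if "a \<in> carrier U" for a
    using that by (simp_all add: rel flip: U.m_assoc)
  have ek': "e \<otimes>\<^bsub>U\<^esub> k' = q\<^sup>2 \<odot>\<^bsub>U\<^esub> (k' \<otimes>\<^bsub>U\<^esub> e)"
  proof -
    have "e \<otimes>\<^bsub>U\<^esub> k' = k' \<otimes>\<^bsub>U\<^esub> ((k \<otimes>\<^bsub>U\<^esub> e) \<otimes>\<^bsub>U\<^esub> k')"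
      by (simp add: canc U.m_assoc)
    also have "\<dots> = q\<^sup>2 \<odot>\<^bsub>U\<^esub> (k' \<otimes>\<^bsub>U\<^esub> e)"
      by (simp add: rel U.smult_mult_left U.smult_mult_right U.m_assoc)
    finally show ?thesis .
  qed
  define c where "c = 1 / (q - inverse q)"
  define z where "z = c \<odot>\<^bsub>U\<^esub> (k \<ominus>\<^bsub>U\<^esub> k')"
  have z [simp]: "z \<in> carrier U" by (simp add: z_def)
  have ef: "e \<otimes>\<^bsub>U\<^esub> f = f \<otimes>\<^bsub>U\<^esub> e \<oplus>\<^bsub>U\<^esub> z"
  proof -
    have "e \<otimes>\<^bsub>U\<^esub> f = (e \<otimes>\<^bsub>U\<^esub> f \<ominus>\<^bsub>U\<^esub> f \<otimes>\<^bsub>U\<^esub> e) \<oplus>\<^bsub>U\<^esub> f \<otimes>\<^bsub>U\<^esub> e"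
      by (simp add: U.minus_eq U.a_assoc U.l_neg)
    then show ?thesis
      by (simp add: rel(5) z_def c_def U.add.m_comm)
  qed
  define K K' E F where "K = tensor k k" and "K' = tensor k' k'"
    and "E = tensor \<one>\<^bsub>U\<^esub> e \<oplus>\<^bsub>T\<^esub> tensor e k" and "F = tensor f \<one>\<^bsub>U\<^esub> \<oplus>\<^bsub>T\<^esub> tensor k' f"
  note KEF = K_def K'_def E_def F_def
  have cl: "K \<in> carrier T" "K' \<in> carrier T" "E \<in> carrier T" "F \<in> carrier T"
    by (simp_all add: KEF)
  have KK': "K \<otimes>\<^bsub>T\<^esub> K' = \<one>\<^bsub>T\<^esub>" "K' \<otimes>\<^bsub>T\<^esub> K = \<one>\<^bsub>T\<^esub>"
    by (simp_all add: KEF rel) (simp_all add: T_def tensor_def tensor_algebra_simps)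
  have KE: "K \<otimes>\<^bsub>T\<^esub> E = q\<^sup>2 \<odot>\<^bsub>T\<^esub> (E \<otimes>\<^bsub>T\<^esub> K)"
    by (simp add: KEF T.l_distr T.r_distr rel lin T.smult_distrib_right)
  have KF: "K \<otimes>\<^bsub>T\<^esub> F = inverse (q\<^sup>2) \<odot>\<^bsub>T\<^esub> (F \<otimes>\<^bsub>T\<^esub> K)"
    by (simp add: KEF T.l_distr T.r_distr rel lin T.smult_distrib_right)
  have cross: "tensor (e \<otimes>\<^bsub>U\<^esub> k') (k \<otimes>\<^bsub>U\<^esub> f) = tensor (k' \<otimes>\<^bsub>U\<^esub> e) (f \<otimes>\<^bsub>U\<^esub> k)"
    using q0 by (simp add: ek' rel(4) lin T.smult_smult)
  have diff: "tensor k' z \<oplus>\<^bsub>T\<^esub> tensor z k = c \<odot>\<^bsub>T\<^esub> (K \<ominus>\<^bsub>T\<^esub> K')"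
  proof -
    have neg: "k \<ominus>\<^bsub>U\<^esub> k' = k \<oplus>\<^bsub>U\<^esub> (-1) \<odot>\<^bsub>U\<^esub> k'" "K \<ominus>\<^bsub>T\<^esub> K' = K \<oplus>\<^bsub>T\<^esub> (-1) \<odot>\<^bsub>T\<^esub> K'"
      using cl by (simp_all add: U.minus_eq U.smult_minus_one T.minus_eq T.smult_minus_one)
    have "tensor k' z \<oplus>\<^bsub>T\<^esub> tensor z k = c \<odot>\<^bsub>T\<^esub> (tensor k' k \<oplus>\<^bsub>T\<^esub> (-1) \<odot>\<^bsub>T\<^esub> tensor k' k')
        \<oplus>\<^bsub>T\<^esub> c \<odot>\<^bsub>T\<^esub> (tensor k k \<oplus>\<^bsub>T\<^esub> (-1) \<odot>\<^bsub>T\<^esub> tensor k' k)"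
      by (simp add: z_def neg lin)
    also have "\<dots> = c \<odot>\<^bsub>T\<^esub> (K \<ominus>\<^bsub>T\<^esub> K')"
      unfolding neg by (simp add: KEF T_def tensor_algebra_simps fun_eq_iff algebra_simps)
    finally show ?thesis .
  qed
  have "E \<otimes>\<^bsub>T\<^esub> F = F \<otimes>\<^bsub>T\<^esub> E \<oplus>\<^bsub>T\<^esub> (tensor k' z \<oplus>\<^bsub>T\<^esub> tensor z k)"
    by (simp add: KEF T.l_distr T.r_distr cross ef lin T.add.m_ac)
  then have "E \<otimes>\<^bsub>T\<^esub> F \<ominus>\<^bsub>T\<^esub> F \<otimes>\<^bsub>T\<^esub> E = tensor k' z \<oplus>\<^bsub>T\<^esub> tensor z k"
    using cl by (simp add: T.minus_eq T.add.m_ac T.r_neg T.r_neg1 T.r_neg2)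
  then have EF: "E \<otimes>\<^bsub>T\<^esub> F \<ominus>\<^bsub>T\<^esub> F \<otimes>\<^bsub>T\<^esub> E = (1 / (q - inverse q)) \<odot>\<^bsub>T\<^esub> (K \<ominus>\<^bsub>T\<^esub> K')"
    by (simp add: diff c_def)
  define \<phi> where "\<phi> = (\<lambda>g. case g of gen_k \<Rightarrow> K | gen_kinv \<Rightarrow> K' | gen_e \<Rightarrow> E | gen_f \<Rightarrow> F)"
  have "induced_hom T \<phi> \<in> algebra_hom U T \<and> induced_hom T \<phi> (uq_gen q g) = \<phi> g" for g
    unfolding U_def
    by (intro conjI uq_induced_hom T.unital_algebra_axioms)
      (simp_all add: \<phi>_def cl KK' KE KF EF split: uq_gen.split)
  moreover have "uq_comult q = induced_hom T \<phi>"
    unfolding uq_comult_def \<phi>_def KEF tensor_def T_def U_def k_def k'_def e_def f_def Let_def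
    by (rule refl)
  ultimately show "uq_comult q \<in> algebra_hom U T"
    and "uq_comult q k = tensor k k" "uq_comult q k' = tensor k' k'"
      "uq_comult q e = tensor \<one>\<^bsub>U\<^esub> e \<oplus>\<^bsub>T\<^esub> tensor e k"
      "uq_comult q f = tensor f \<one>\<^bsub>U\<^esub> \<oplus>\<^bsub>T\<^esub> tensor k' f"
    by (simp_all add: \<phi>_def KEF k_def[symmetric] k'_def[symmetric] e_def[symmetric] f_def[symmetric])
      (simp_all add: \<phi>_def KEF k_def k'_def e_def f_def)
qed

lemma Uq_simps:
  "carrier (Uq q) = carrier (uq_algebra q)" "x \<otimes>\<^bsub>Uq q\<^esub> y = x \<otimes>\<^bsub>uq_algebra q\<^esub> y"
  "\<one>\<^bsub>Uq q\<^esub> = \<one>\<^bsub>uq_algebra q\<^esub>" "\<zero>\<^bsub>Uq q\<^esub> = \<zero>\<^bsub>uq_algebra q\<^esub>"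
  "x \<oplus>\<^bsub>Uq q\<^esub> y = x \<oplus>\<^bsub>uq_algebra q\<^esub> y" "c \<odot>\<^bsub>Uq q\<^esub> x = c \<odot>\<^bsub>uq_algebra q\<^esub> x"
  "comult (Uq q) = uq_comult q" "counit (Uq q) = uq_counit q" "antipode (Uq q) = uq_antipode q"
  by (simp_all add: Uq_def module.defs hopf_algebra.defs)

lemma tensor_algebra_Uq:
  "pure_tensor (Uq q) (Uq q) = pure_tensor (uq_algebra q) (uq_algebra q)"
  "tensor_algebra (Uq q) (Uq q) = tensor_algebra (uq_algebra q) (uq_algebra q)"
proof -
  have "bilinear_forms (Uq q) (Uq q) = bilinear_forms (uq_algebra q) (uq_algebra q)"
    by (simp add: bilinear_forms_def Uq_simps)
  then show "pure_tensor (Uq q) (Uq q) = pure_tensor (uq_algebra q) (uq_algebra q)"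
    "tensor_algebra (Uq q) (Uq q) = tensor_algebra (uq_algebra q) (uq_algebra q)"
    by (simp_all add: tensor_algebra_def pure_tensor_def Uq_simps fun_eq_iff cong: if_cong)
qed

definition action_on_generators where
  "action_on_generators q \<pi> kx ky ex ey fx fy \<longleftrightarrow>
    \<pi> (uq_gen q gen_k) (plane_x q) = kx \<and> \<pi> (uq_gen q gen_k) (plane_y q) = ky \<and>
    \<pi> (uq_gen q gen_e) (plane_x q) = ex \<and> \<pi> (uq_gen q gen_e) (plane_y q) = ey \<and>
    \<pi> (uq_gen q gen_f) (plane_x q) = fx \<and> \<pi> (uq_gen q gen_f) (plane_y q) = fy"

end

theory Submission
  imports Defs "HOL-Library.Product_Plus"
begin

text \<open>
  Write \<open>K\<close>, \<open>K'\<close>, \<open>E\<close>, \<open>F\<close> for the operators by which \<open>k\<close>, \<open>k\<^sup>-\<^sup>1\<close>, \<open>e\<close>, \<open>f\<close> act.  The coproduct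
  turns \<open>K\<close> into an automorphism and \<open>E\<close>, \<open>F\<close> into skew derivations of the quantum plane.  The idea of the
  proof is to embed the quantum plane in the quantum torus, where \<open>x\<close> and \<open>y\<close> are invertible: over the
  torus the two skew derivations are inner, and the classification becomes a statement about two Laurent
  polynomials \<open>w\<close> and \<open>v\<close>.

  The automorphism \<open>K\<close> is diagonal, \<open>K x = \<alpha> x\<close> and \<open>K y = \<beta> y\<close>, because \<open>x y\<close> generates the
  commutator ideal and its only factors are monomials (\<open>plane_automorphism\<close>).  The weights \<open>q\<^sup>2\<close> and
  \<open>q\<^sup>-\<^sup>2\<close> of \<open>E\<close> and \<open>F\<close> differ from 1, which removes the only obstruction to
  \<open>E p = w K(p) - p w\<close> and \<open>F p = v p - K'(p) v\<close> with \<open>w\<close>, \<open>v\<close> in the torus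
  (\<open>skew_derivation_inner\<close>).  As \<open>E\<close> and \<open>F\<close> preserve the plane, the exponents in \<open>w\<close> and \<open>v\<close> are at
  least \<open>-1\<close>; moreover \<open>-1\<close> occurs for \<open>x\<close> only if \<open>\<beta> = q\<^sup>-\<^sup>1\<close> and for \<open>y\<close> only if \<open>\<alpha> = q\<close>.

  The relation for \<open>e f - f e\<close> now says that \<open>z = v w - q\<^sup>-\<^sup>2 w v\<close> equals \<open>-1/(q - q\<^sup>-\<^sup>1)\<close> up to one
  exceptional monomial.  If \<open>\<alpha>\<^sup>2 = \<beta>\<^sup>2 = 1\<close>, no exponent has weight \<open>q\<^sup>2\<close> or \<open>q\<^sup>-\<^sup>2\<close>, so
  \<open>w = v = 0\<close>, which is family (1).  Otherwise the constant term of \<open>z\<close> is nonzero, so some monomials of \<open>v\<close>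
  and \<open>w\<close> have opposite exponents; by the bounds on the exponents there are only five
  possibilities for \<open>(\<alpha>, \<beta>)\<close> (\<open>weights\<close>), one for each of the families (2) to (6).  In the families
  (2), (3), (4) a comparison of leading terms in \<open>z\<close> shows that \<open>w\<close> and \<open>v\<close> are monomials (\<open>rigid\<close>).  In
  the families (5) and (6) the weights already leave one monomial in one of \<open>w\<close>, \<open>v\<close> and three in
  the other.  The constant term of \<open>z\<close> finally relates the coefficients.
\<close>

section \<open>Laurent polynomials in two variables\<close>

lemma poly_mapping_keys_induct [consumes 1, case_names zero single add]:
  fixes p :: "'a \<Rightarrow>\<^sub>0 'b::comm_monoid_add"
  assumes "Poly_Mapping.keys p \<subseteq> S" and "Q 0"
    and "\<And>u c. u \<in> S \<Longrightarrow> Q (Poly_Mapping.single u c)"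
    and "\<And>f g. \<lbrakk>Poly_Mapping.keys f \<subseteq> S; Poly_Mapping.keys g \<subseteq> S; Q f; Q g\<rbrakk> \<Longrightarrow> Q (f + g)"
  shows "Q p"
  using assms(1)
proof (induction p rule: update_induct)
  case const
  show ?case using assms(2) by simp
next
  case (update f a b)
  have eq: "Poly_Mapping.update a b f = f + Poly_Mapping.single a b"
    using update(1)
    by (intro poly_mapping_eqI) (auto simp: lookup_update lookup_add lookup_single in_keys_iff when_def)
  have S: "a \<in> S" "Poly_Mapping.keys f \<subseteq> S"
    using update(2,4) by (auto simp: keys_update)
  show ?case
    unfolding eq by (rule assms(4)) (use S update(2,3) assms(3) in \<open>auto\<close>)
qed

text \<open>
  A finitely supported function on \<open>\<int> \<times> \<int>\<close> stands for the element of the quantum torus whose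
  coefficient at the ordered monomial \<open>x\<^sup>i y\<^sup>j\<close> is its value at \<open>(i, j)\<close>.  Its product \<open>\<star>\<close> depends
  on \<open>q\<close>; the product \<open>*\<close> of this type is the commutative convolution, that is the case \<open>q = 1\<close>.
\<close>

type_synonym torus = "int \<times> int \<Rightarrow>\<^sub>0 complex"

abbreviation mon :: "int \<times> int \<Rightarrow> complex \<Rightarrow> torus" where
  "mon \<equiv> Poly_Mapping.single"

definition scale :: "complex \<Rightarrow> torus \<Rightarrow> torus" where
  "scale c f = Poly_Mapping.map ((*) c) f"

lemma lookup_scale [simp]: "Poly_Mapping.lookup (scale c f) u = c * Poly_Mapping.lookup f u"
  by (simp add: scale_def map.rep_eq when_def)

lemma scale_simps [simp]:
  "scale c (mon u a) = mon u (c * a)" "scale c 0 = 0" "scale 0 f = 0" "scale 1 f = f"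
  "scale c (scale d f) = scale (c * d) f"
  by (rule poly_mapping_eqI; simp add: lookup_single when_def)+

lemma scale_add: "scale c (f + g) = scale c f + scale c g" "scale (c + d) f = scale c f + scale d f"
  "scale c (f - g) = scale c f - scale c g"
  by (rule poly_mapping_eqI; simp add: lookup_add lookup_minus algebra_simps)+

definition quadrant :: "(int \<times> int) set" where
  "quadrant = {u. 0 \<le> fst u \<and> 0 \<le> snd u}"

definition plane :: "torus set" where
  "plane = {f. Poly_Mapping.keys f \<subseteq> quadrant}"

lemma plane_induct [consumes 1, case_names zero single add]:
  assumes "p \<in> plane" "Q 0" "\<And>i j c. \<lbrakk>0 \<le> i; 0 \<le> j\<rbrakk> \<Longrightarrow> Q (mon (i, j) c)"
    and "\<And>f g. \<lbrakk>f \<in> plane; g \<in> plane; Q f; Q g\<rbrakk> \<Longrightarrow> Q (f + g)"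
  shows "Q p"
proof -
  have "Poly_Mapping.keys p \<subseteq> quadrant" using assms(1) by (simp add: plane_def)
  then show ?thesis
    by (induction p rule: poly_mapping_keys_induct) (use assms(2-) in \<open>auto simp: quadrant_def plane_def\<close>)
qed

lemma plane_zero [simp]: "0 \<in> plane"
  by (simp add: plane_def)

lemma plane_mon [simp]: "mon (i, j) c \<in> plane \<longleftrightarrow> c = 0 \<or> 0 \<le> i \<and> 0 \<le> j"
  by (auto simp: plane_def quadrant_def)

lemma plane_add [simp]: "\<lbrakk>f \<in> plane; g \<in> plane\<rbrakk> \<Longrightarrow> f + g \<in> plane"
  using keys_add[of f g] by (auto simp: plane_def)

lemma plane_scale [simp]: "f \<in> plane \<Longrightarrow> scale c f \<in> plane"
  by (auto simp: plane_def in_keys_iff subset_iff)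

lemma plane_lookup: "\<lbrakk>f \<in> plane; Poly_Mapping.lookup f u \<noteq> 0\<rbrakk> \<Longrightarrow> 0 \<le> fst u \<and> 0 \<le> snd u"
  unfolding plane_def quadrant_def by (cases u) (auto simp: in_keys_iff subset_iff)

section \<open>Extreme monomials of a Laurent polynomial\<close>

definition lex :: "int \<times> int \<Rightarrow> int \<times> int \<Rightarrow> bool" where
  "lex u v \<longleftrightarrow> fst u < fst v \<or> fst u = fst v \<and> snd u < snd v"

definition extreme :: "(int \<times> int \<Rightarrow> int \<times> int \<Rightarrow> bool) \<Rightarrow> int \<times> int \<Rightarrow> torus \<Rightarrow> bool" where
  "extreme r u f \<longleftrightarrow> u \<in> Poly_Mapping.keys f \<and> (\<forall>v\<in>Poly_Mapping.keys f. v = u \<or> r u v)"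

text \<open>
  Every argument about leading monomials is needed for leading and for trailing ones.  Both orders are
  covered by a parameter \<open>r\<close>: an \<open>r\<close>-extreme monomial is the least one for \<^const>\<open>lex\<close> and the
  greatest one for its converse.
\<close>

definition lex_like :: "(int \<times> int \<Rightarrow> int \<times> int \<Rightarrow> bool) \<Rightarrow> bool" where
  "lex_like r \<longleftrightarrow> r = lex \<or> r = (\<lambda>u v. lex v u)"

lemma lex_like [simp]: "lex_like lex" "lex_like (\<lambda>u v. lex v u)"
  by (simp_all add: lex_like_def)

lemma extreme_exists:
  assumes "lex_like r" "f \<noteq> 0"
  shows "\<exists>u. extreme r u f"
proof -
  have r: "u = v \<or> r u v \<or> r v u" "r u v \<Longrightarrow> r v w \<Longrightarrow> r u w" for u v w
    using assms(1) by (auto simp: lex_like_def lex_def prod_eq_iff)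
  have "finite S \<Longrightarrow> S \<noteq> {} \<Longrightarrow> \<exists>u\<in>S. \<forall>v\<in>S. v = u \<or> r u v" for S
  proof (induction S rule: finite_ne_induct)
    case (insert x S)
    then obtain u where "u \<in> S" "\<forall>v\<in>S. v = u \<or> r u v" by blast
    then show ?case using r[of u x] r(2) by (metis insert_iff)
  qed auto
  from this[OF finite_keys, of f] assms(2) show ?thesis
    by (auto simp: extreme_def)
qed

text \<open>
  This is all that products need: an \<open>r\<close>-extreme exponent of a product arises from exactly one pair
  of exponents of the factors.
\<close>

lemma lex_like_add:
  assumes "lex_like r" "u = u' \<or> r u u'" "v = v' \<or> r v v'"
  shows "u = u' \<and> v = v' \<or> r (u + v) (u' + v')"
  using assms by (auto simp: lex_like_def lex_def)

lemma extreme_unique: "\<lbrakk>lex_like r; extreme r u f; extreme r v f\<rbrakk> \<Longrightarrow> u = v"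
  unfolding extreme_def lex_like_def lex_def by fastforce

lemma extreme_both:
  assumes "extreme lex u f" "extreme (\<lambda>u v. lex v u) u f"
  shows "\<exists>c. c \<noteq> 0 \<and> f = mon u c"
proof -
  have "v = u" if "v \<in> Poly_Mapping.keys f" for v
    using assms that unfolding extreme_def lex_def by fastforce
  then have "f = mon u (Poly_Mapping.lookup f u)"
    by (intro poly_mapping_eqI) (auto simp: lookup_single when_def in_keys_iff)
  moreover have "Poly_Mapping.lookup f u \<noteq> 0"
    using assms(1) by (simp add: extreme_def in_keys_iff)
  ultimately show ?thesis by blast
qed

lemma extreme_le:
  assumes "extreme lex b f" "extreme (\<lambda>u v. lex v u) t f"
  shows "b = t \<or> lex b t"
  using assms unfolding extreme_def by blast

section \<open>The quantum torus\<close>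

locale quantum_torus =
  fixes q :: complex
  assumes q_nonzero: "q \<noteq> 0"
begin

text \<open>
  The relation \<open>y x = q x y\<close> forces
  \<open>x\<^sup>i y\<^sup>j \<cdot> x\<^sup>m y\<^sup>n = q\<^bsup>jm\<^esup> x\<^bsup>i+m\<^esup> y\<^bsup>j+n\<^esup>\<close>, also for negative exponents.
\<close>

definition mul :: "torus \<Rightarrow> torus \<Rightarrow> torus" (infixl \<open>\<star>\<close> 70) where
  "f \<star> g = (\<Sum>u\<in>Poly_Mapping.keys f. \<Sum>v\<in>Poly_Mapping.keys g.
     mon (u + v) (Poly_Mapping.lookup f u * Poly_Mapping.lookup g v * q powi (snd u * fst v)))"

lemma mul_superset:
  assumes "finite S" "Poly_Mapping.keys f \<subseteq> S" "finite T" "Poly_Mapping.keys g \<subseteq> T"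
  shows "f \<star> g = (\<Sum>u\<in>S. \<Sum>v\<in>T.
     mon (u + v) (Poly_Mapping.lookup f u * Poly_Mapping.lookup g v * q powi (snd u * fst v)))"
proof -
  have "(\<Sum>v\<in>T. mon (u + v) (Poly_Mapping.lookup f u * Poly_Mapping.lookup g v * q powi (snd u * fst v)))
    = (\<Sum>v\<in>Poly_Mapping.keys g. mon (u + v) (Poly_Mapping.lookup f u * Poly_Mapping.lookup g v * q powi (snd u * fst v)))" for u
    by (rule sum.mono_neutral_right) (use assms in \<open>auto simp: in_keys_iff\<close>)
  then show ?thesis
    unfolding mul_def
    by (simp only:) (rule sum.mono_neutral_left, use assms in \<open>auto simp: in_keys_iff\<close>)
qed

lemma mul_mon [simp]: "mon u a \<star> mon v b = mon (u + v) (a * b * q powi (snd u * fst v))"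
  by (subst mul_superset[of "{u}" _ "{v}"]) (auto)

lemma mul_add_left: "(f + g) \<star> h = f \<star> h + g \<star> h"
proof -
  let ?S = "Poly_Mapping.keys f \<union> Poly_Mapping.keys g" and ?T = "Poly_Mapping.keys h"
  show ?thesis
    using keys_add[of f g]
    by (simp add: mul_superset[of ?S _ ?T] lookup_add distrib_right single_add sum.distrib)
qed

lemma mul_add_right: "h \<star> (f + g) = h \<star> f + h \<star> g"
proof -
  let ?S = "Poly_Mapping.keys f \<union> Poly_Mapping.keys g" and ?T = "Poly_Mapping.keys h"
  show ?thesis
    using keys_add[of f g]
    by (simp add: mul_superset[of ?T _ ?S] lookup_add distrib_left distrib_right single_add sum.distrib)
qed

lemma mul_zero [simp]: "0 \<star> f = 0" "f \<star> 0 = 0"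
  by (simp_all add: mul_def)

lemma torus_induct [case_names zero single add]:
  assumes "Q 0" "\<And>i j c. Q (mon (i, j) c)" "\<And>f g. \<lbrakk>Q f; Q g\<rbrakk> \<Longrightarrow> Q (f + g)"
  shows "Q (p :: torus)"
proof -
  have "Poly_Mapping.keys p \<subseteq> UNIV" by simp
  then show ?thesis
    by (induction p rule: poly_mapping_keys_induct) (use assms in \<open>auto\<close>)
qed

lemma mul_scale: "scale c f \<star> g = scale c (f \<star> g)" "f \<star> scale c g = scale c (f \<star> g)"
proof -
  have k: "Poly_Mapping.keys (scale c f) \<subseteq> Poly_Mapping.keys f" for f
    by (auto simp: in_keys_iff)
  have s: "scale c (sum h S) = (\<Sum>u\<in>S. scale c (h u))" for h :: "int \<times> int \<Rightarrow> torus" and S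
    by (induction S rule: infinite_finite_induct) (simp_all add: scale_add)
  show "scale c f \<star> g = scale c (f \<star> g)"
    using k[of f]
    by (simp add: mul_superset[of "Poly_Mapping.keys f" _ "Poly_Mapping.keys g"] s mult.assoc)
  show "f \<star> scale c g = scale c (f \<star> g)"
    using k[of g]
    by (simp add: mul_superset[of "Poly_Mapping.keys f" _ "Poly_Mapping.keys g"] s mult_ac)
qed

lemma mul_minus: "(f - g) \<star> h = f \<star> h - g \<star> h" "h \<star> (f - g) = h \<star> f - h \<star> g"
  using mul_add_left[of "f - g" g h] mul_add_right[of h "f - g" g]
  by (simp_all add: algebra_simps)

lemma mul_assoc: "(f \<star> g) \<star> h = f \<star> (g \<star> h)"
proof (induction f rule: torus_induct)
  case (single i j c)
  show ?case
  proof (induction g rule: torus_induct)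
    case (single i' j' c')
    show ?case
      by (induction h rule: torus_induct)
        (auto simp: mul_add_right q_nonzero algebra_simps simp flip: power_int_add)
  qed (simp_all add: mul_add_left mul_add_right)
qed (simp_all add: mul_add_left)

lemma mul_one [simp]: "mon (0, 0) 1 \<star> f = f" "f \<star> mon (0, 0) 1 = f"
  by (induction f rule: torus_induct) (simp_all add: mul_add_left mul_add_right)

lemma lookup_mul:
  "Poly_Mapping.lookup (f \<star> g) w = (\<Sum>u\<in>Poly_Mapping.keys f.
     Poly_Mapping.lookup f u * Poly_Mapping.lookup g (w - u) * q powi (snd u * fst (w - u)))"
proof -
  have "(\<Sum>v\<in>Poly_Mapping.keys g. Poly_Mapping.lookup (mon (u + v)
      (Poly_Mapping.lookup f u * Poly_Mapping.lookup g v * q powi (snd u * fst v))) w) =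
     Poly_Mapping.lookup f u * Poly_Mapping.lookup g (w - u) * q powi (snd u * fst (w - u))" for u
  proof -
    have *: "(\<Sum>v\<in>Poly_Mapping.keys g. Poly_Mapping.lookup (mon (u + v)
      (Poly_Mapping.lookup f u * Poly_Mapping.lookup g v * q powi (snd u * fst v))) w) =
       (\<Sum>v\<in>Poly_Mapping.keys g. if v = w - u then Poly_Mapping.lookup f u * Poly_Mapping.lookup g v * q powi (snd u * fst v) else 0)"
      by (rule sum.cong) (auto simp: lookup_single when_def)
    show ?thesis unfolding * by (auto simp: sum.delta in_keys_iff)
  qed
  then show ?thesis
    by (simp add: mul_def lookup_sum)
qed

lemma lookup_mul_mon:
  "Poly_Mapping.lookup (mon (a, b) c \<star> f) (i, j) = c * Poly_Mapping.lookup f (i - a, j - b) * q powi (b * (i - a))"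
  "Poly_Mapping.lookup (f \<star> mon (a, b) c) (i, j) = c * Poly_Mapping.lookup f (i - a, j - b) * q powi ((j - b) * a)"
proof -
  show "Poly_Mapping.lookup (mon (a, b) c \<star> f) (i, j) = c * Poly_Mapping.lookup f (i - a, j - b) * q powi (b * (i - a))"
    by (simp add: lookup_mul)
  show "Poly_Mapping.lookup (f \<star> mon (a, b) c) (i, j) = c * Poly_Mapping.lookup f (i - a, j - b) * q powi ((j - b) * a)"
    by (induction f rule: torus_induct)
      (auto simp: mul_add_left lookup_add lookup_single when_def algebra_simps)
qed

lemma plane_mul [simp]: "\<lbrakk>f \<in> plane; g \<in> plane\<rbrakk> \<Longrightarrow> f \<star> g \<in> plane"
proof (induction f rule: plane_induct)
  case (single i j c)
  show ?case
    using single(3) by (induction g rule: plane_induct) (use single(1,2) in \<open>simp_all add: mul_add_right\<close>)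
qed (simp_all add: mul_add_left)

text \<open>
  Extreme monomials multiply, since the structure constants are nonzero.  The coefficient in the second
  statement is what distinguishes \<open>v \<star> w\<close> from \<open>w \<star> v\<close> in lemma \<open>rigid\<close> below.
\<close>

lemma extreme_mul:
  assumes "lex_like r" "extreme r u f" "extreme r v g"
  shows "extreme r (u + v) (f \<star> g)"
    and "Poly_Mapping.lookup (f \<star> g) (u + v) =
      Poly_Mapping.lookup f u * Poly_Mapping.lookup g v * q powi (snd u * fst v)"
proof -
  have big: "w = u + v \<and> u' = u \<or> r (u + v) w"
    if "u' \<in> Poly_Mapping.keys f" "w - u' \<in> Poly_Mapping.keys g" for u' w
  proof -
    have "u' = u \<or> r u u'" "w - u' = v \<or> r v (w - u')"
      using assms(2,3) that by (auto simp: extreme_def)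
    with lex_like_add[OF assms(1), of u u' v "w - u'"] show ?thesis by auto
  qed
  have irrefl: "\<not> r (u + v) (u + v)"
    using assms(1) by (auto simp: lex_like_def lex_def)
  have "Poly_Mapping.lookup (f \<star> g) (u + v) = (\<Sum>u'\<in>Poly_Mapping.keys f. if u' = u then
      Poly_Mapping.lookup f u * Poly_Mapping.lookup g v * q powi (snd u * fst v) else 0)"
    unfolding lookup_mul
  proof (rule sum.cong)
    fix x assume "x \<in> Poly_Mapping.keys f"
    then have "x \<noteq> u \<Longrightarrow> Poly_Mapping.lookup g (u + v - x) = 0"
      using big[of x "u + v"] irrefl by (auto simp: in_keys_iff)
    then show "Poly_Mapping.lookup f x * Poly_Mapping.lookup g (u + v - x) *
        q powi (snd x * fst (u + v - x)) = (if x = u then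
        Poly_Mapping.lookup f u * Poly_Mapping.lookup g v * q powi (snd u * fst v) else 0)"
      by (cases "x = u") simp_all
  qed simp
  also have "\<dots> = Poly_Mapping.lookup f u * Poly_Mapping.lookup g v * q powi (snd u * fst v)"
    by (auto simp: sum.delta in_keys_iff)
  finally show *: "Poly_Mapping.lookup (f \<star> g) (u + v) =
      Poly_Mapping.lookup f u * Poly_Mapping.lookup g v * q powi (snd u * fst v)" .
  have "w = u + v \<or> r (u + v) w" if "w \<in> Poly_Mapping.keys (f \<star> g)" for w
  proof -
    have "\<exists>u'\<in>Poly_Mapping.keys f. w - u' \<in> Poly_Mapping.keys g"
    proof (rule ccontr)
      assume "\<not> ?thesis"
      then have "Poly_Mapping.lookup (f \<star> g) w = 0"
        unfolding lookup_mul by (intro sum.neutral) (auto simp: in_keys_iff)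
      with that show False by (simp add: in_keys_iff)
    qed
    then show ?thesis using big by blast
  qed
  then show "extreme r (u + v) (f \<star> g)"
    using assms(2,3) * by (auto simp: extreme_def in_keys_iff q_nonzero)
qed

end

section \<open>Diagonal automorphisms and linear operators on the plane\<close>

definition plane_linear :: "(torus \<Rightarrow> torus) \<Rightarrow> bool" where
  "plane_linear T \<longleftrightarrow> (\<forall>p\<in>plane. T p \<in> plane) \<and>
    (\<forall>p\<in>plane. \<forall>r\<in>plane. T (p + r) = T p + T r) \<and> (\<forall>c. \<forall>p\<in>plane. T (scale c p) = scale c (T p))"

lemma plane_linearD:
  assumes "plane_linear T" "p \<in> plane"
  shows "T p \<in> plane" "r \<in> plane \<Longrightarrow> T (p + r) = T p + T r" "T (scale c p) = scale c (T p)"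
  using assms by (auto simp: plane_linear_def)

definition diag :: "complex \<Rightarrow> complex \<Rightarrow> torus \<Rightarrow> torus" where
  "diag a b p = Poly_Mapping.mapp (\<lambda>u c. a powi fst u * b powi snd u * c) p"

lemma lookup_diag [simp]:
  "Poly_Mapping.lookup (diag a b p) u = a powi fst u * b powi snd u * Poly_Mapping.lookup p u"
  by (simp add: diag_def lookup_mapp when_def in_keys_iff)

lemma diag_mon [simp]: "diag a b (mon (i, j) c) = mon (i, j) (a powi i * b powi j * c)"
  by (rule poly_mapping_eqI) (auto simp: lookup_single when_def)

lemma diag_linear: "diag a b (f + g) = diag a b f + diag a b g"
  "diag a b (f - g) = diag a b f - diag a b g"
  "diag a b (scale c f) = scale c (diag a b f)" "diag a b 0 = 0"
  by (rule poly_mapping_eqI; simp add: lookup_add lookup_minus algebra_simps)+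

lemma diag_plane [simp]: "p \<in> plane \<Longrightarrow> diag a b p \<in> plane"
  by (auto simp: plane_def in_keys_iff subset_iff)

lemma diag_inverse [simp]:
  assumes "a \<noteq> 0" "b \<noteq> 0"
  shows "diag a b (diag (inverse a) (inverse b) p) = p" "diag (inverse a) (inverse b) (diag a b p) = p"
  using assms by (auto intro!: poly_mapping_eqI simp: power_int_inverse field_simps)

lemma diag_weight:
  assumes "\<And>i j. Poly_Mapping.lookup p (i, j) \<noteq> 0 \<Longrightarrow> a powi i * b powi j = \<mu>"
  shows "diag a b p = scale \<mu> p"
proof (rule poly_mapping_eqI)
  fix u
  show "Poly_Mapping.lookup (diag a b p) u = Poly_Mapping.lookup (scale \<mu> p) u"
    using assms[of "fst u" "snd u"] by (cases "Poly_Mapping.lookup p u = 0") simp_all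
qed

abbreviation mon_x :: torus where "mon_x \<equiv> mon (1, 0) 1"
abbreviation mon_y :: torus where "mon_y \<equiv> mon (0, 1) 1"

lemma mon_eq_iff: "mon u c = mon u d \<longleftrightarrow> c = d" "mon u c = 0 \<longleftrightarrow> c = 0"
  by (metis lookup_single_eq, metis lookup_single_eq single_zero)

context quantum_torus
begin

lemma diag_mul:
  assumes "a \<noteq> 0" "b \<noteq> 0"
  shows "diag a b (f \<star> g) = diag a b f \<star> diag a b g"
proof (induction f rule: torus_induct)
  case (single i j c)
  show ?case
    by (induction g rule: torus_induct)
      (simp_all add: diag_linear mul_add_right power_int_add assms mult_ac)
qed (simp_all add: diag_linear mul_add_left)

text \<open>
  Two algebra homomorphisms, or two skew derivations, agree once they agree on \<open>x\<close> and \<open>y\<close>; this rule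
  gives such conclusions.
\<close>

lemma plane_generated [consumes 1, case_names one mon_x mon_y mul scale add]:
  assumes "p \<in> plane"
    and "Q (mon (0, 0) 1)" "Q mon_x" "Q mon_y"
    and mul: "\<And>p r. \<lbrakk>p \<in> plane; r \<in> plane; Q p; Q r\<rbrakk> \<Longrightarrow> Q (p \<star> r)"
    and scale: "\<And>c p. \<lbrakk>p \<in> plane; Q p\<rbrakk> \<Longrightarrow> Q (scale c p)"
    and add: "\<And>p r. \<lbrakk>p \<in> plane; r \<in> plane; Q p; Q r\<rbrakk> \<Longrightarrow> Q (p + r)"
  shows "Q p"
  using assms(1)
proof (induction p rule: plane_induct)
  case zero
  show ?case using scale[of "mon (0, 0) 1" 0] assms(2) by simp
next
  case (single i j c)
  have x: "Q (mon (int m, 0) 1)" for m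
  proof (induction m)
    case (Suc m)
    then show ?case using mul[OF _ _ assms(3), of "mon (int m, 0) 1"] by simp
  qed (use assms(2) in simp)
  have y: "Q (mon (0, int m) 1)" for m
  proof (induction m)
    case (Suc m)
    then show ?case using mul[OF _ _ assms(4), of "mon (0, int m) 1"] by simp
  qed (use assms(2) in simp)
  have "Q (scale c (mon (int (nat i), 0) 1 \<star> mon (0, int (nat j)) 1))"
    by (intro scale mul x y) simp_all
  with single show ?case by simp
qed (use add in auto)

text \<open>
  The coefficients on an axis are computed in a quotient of the plane by \<open>x\<close> or by \<open>y\<close>, which is a
  commutative polynomial ring.
\<close>

lemma commute_on_axes:
  assumes "f \<in> plane" "g \<in> plane" "i = 0 \<or> j = 0"
  shows "Poly_Mapping.lookup (f \<star> g) (i, j) = Poly_Mapping.lookup (g \<star> f) (i, j)"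
  using assms(1)
proof (induction f rule: plane_induct)
  case (single a b c)
  show ?case
    using assms(2)
    by (induction g rule: plane_induct)
      (use single assms(3) in \<open>auto simp: mul_add_left mul_add_right lookup_add lookup_single when_def add_nonneg_eq_0_iff\<close>)
qed (simp_all add: mul_add_left mul_add_right lookup_add)

text \<open>
  The least exponents of the factors add up to \<open>u\<close>, and so do the greatest ones.  As the least exponent
  of each factor is at most its greatest one, they agree, so every factor is a monomial.
\<close>

lemma factor_of_monomial:
  assumes "f \<star> g \<star> h = mon u c" "c \<noteq> 0"
  shows "\<exists>s t r a d. f = mon s a \<and> extreme lex t g \<and> h = mon r d \<and> a \<noteq> 0 \<and> d \<noteq> 0 \<and> s + t + r = u"
proof -
  have nz: "f \<noteq> 0" "g \<noteq> 0" "h \<noteq> 0"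
    using assms mon_eq_iff(2)[of u c] by auto
  have sum: "s + t + r = u" if "lex_like R" "extreme R s f" "extreme R t g" "extreme R r h" for R s t r
  proof (rule extreme_unique[OF that(1)])
    show "extreme R (s + t + r) (mon u c)"
      using extreme_mul(1)[OF that(1) extreme_mul(1)[OF that(1,2,3)] that(4)] assms by simp
    show "extreme R u (mon u c)"
      using assms by (simp add: extreme_def)
  qed
  let ?R = "\<lambda>u v. lex v u"
  obtain s t r where lo: "extreme lex s f" "extreme lex t g" "extreme lex r h"
    using nz extreme_exists[OF lex_like(1)] by meson
  obtain s' t' r' where hi: "extreme ?R s' f" "extreme ?R t' g" "extreme ?R r' h"
    using nz extreme_exists[OF lex_like(2)] by meson
  have "s = s' \<or> lex s s'" "t = t' \<or> lex t t'" "r = r' \<or> lex r r'"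
    using extreme_le lo hi by blast+
  moreover have "s + t + r = u" "s' + t' + r' = u"
    by (rule sum[OF lex_like(1) lo], rule sum[OF lex_like(2) hi])
  ultimately have "s = s'" "r = r'"
    unfolding lex_def prod_eq_iff by auto
  with extreme_both lo hi sum[OF _ lo] show ?thesis
    by (metis lex_like(1))
qed

end

section \<open>Automorphisms and skew derivations of the plane\<close>

locale generic_torus = quantum_torus +
  assumes not_root: "\<And>n::nat. n > 0 \<Longrightarrow> q ^ n \<noteq> 1"
begin

lemma powi_eq_1: "q powi n = 1 \<longleftrightarrow> n = 0"
proof
  assume n: "q powi n = 1"
  show "n = 0"
  proof (rule ccontr)
    assume "n \<noteq> 0"
    then have "q ^ nat \<bar>n\<bar> \<noteq> 1" by (intro not_root) simp
    moreover have "q ^ nat \<bar>n\<bar> = 1"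
      using n by (auto simp: power_int_def power_inverse split: if_splits)
    ultimately show False by contradiction
  qed
qed simp

lemma powi_inj: "q powi m = q powi n \<longleftrightarrow> m = n"
proof
  assume "q powi m = q powi n"
  then have "q powi (m - n) = 1" by (simp add: power_int_diff q_nonzero)
  then show "m = n" by (simp add: powi_eq_1)
qed simp

text \<open>
  A commutator of plane elements has no terms on the coordinate axes, as setting \<open>x = 0\<close> or \<open>y = 0\<close>
  makes the plane commutative.  Since \<open>x y\<close> is a multiple of a commutator, so is its preimage
  \<open>K'(x y)\<close>, which is therefore of the form \<open>x g y\<close>.  Applying \<open>K\<close> gives \<open>K x \<cdot> K g \<cdot> K y = x y\<close>,
  so \<open>K x\<close> and \<open>K y\<close> are monomials.  Their exponents have sum at most \<open>(1, 1)\<close>, and the relation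
  \<open>y x = q x y\<close> says that the exponents have determinant 1; this leaves multiples of \<open>x\<close> and \<open>y\<close>.
\<close>

theorem plane_automorphism:
  assumes lin: "plane_linear K" "plane_linear K'"
    and mult: "\<And>p r. \<lbrakk>p \<in> plane; r \<in> plane\<rbrakk> \<Longrightarrow> K (p \<star> r) = K p \<star> K r"
      "\<And>p r. \<lbrakk>p \<in> plane; r \<in> plane\<rbrakk> \<Longrightarrow> K' (p \<star> r) = K' p \<star> K' r"
    and inv: "\<And>p. p \<in> plane \<Longrightarrow> K (K' p) = p" "\<And>p. p \<in> plane \<Longrightarrow> K' (K p) = p"
  obtains \<alpha> \<beta> where "\<alpha> \<noteq> 0" "\<beta> \<noteq> 0" "\<And>p. p \<in> plane \<Longrightarrow> K p = diag \<alpha> \<beta> p"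
    "\<And>p. p \<in> plane \<Longrightarrow> K' p = diag (inverse \<alpha>) (inverse \<beta>) p"
proof -
  note [simp] = plane_linearD(1)[OF lin(1)] plane_linearD(1)[OF lin(2)]
  have yx: "mon_y \<star> mon_x = scale q (mon_x \<star> mon_y)" by simp
  define h where "h = K' mon_x \<star> K' mon_y"
  have h: "h \<in> plane" "K h = mon (1, 1) 1"
    by (simp_all add: h_def inv mult)
  have comm: "K' mon_y \<star> K' mon_x = scale q h"
    unfolding h_def mult(2)[OF plane_mon[THEN iffD2] plane_mon[THEN iffD2], symmetric, simplified]
    using yx plane_linearD(3)[OF lin(2), of "mon_x \<star> mon_y" q] mult(2)[of mon_x mon_y] mult(2)[of mon_y mon_x] by simp
  have q1: "q \<noteq> 1" using not_root[of 1] by simp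
  have "Poly_Mapping.keys h \<subseteq> {u. 1 \<le> fst u \<and> 1 \<le> snd u}"
  proof
    fix u assume u: "u \<in> Poly_Mapping.keys h"
    then have "0 \<le> fst u" "0 \<le> snd u"
      using h(1) plane_lookup by (auto simp: in_keys_iff)
    moreover have "fst u \<noteq> 0 \<and> snd u \<noteq> 0"
    proof (rule ccontr)
      assume "\<not> ?thesis"
      then have "fst u = 0 \<or> snd u = 0" by blast
      from commute_on_axes[OF _ _ this, of "K' mon_x" "K' mon_y"]
      have "Poly_Mapping.lookup (scale q h) u = Poly_Mapping.lookup h u"
        unfolding comm h_def[symmetric] by simp
      with q1 u show False by (simp add: in_keys_iff)
    qed
    ultimately show "u \<in> {u. 1 \<le> fst u \<and> 1 \<le> snd u}" by auto
  qed
  then have "\<exists>g\<in>plane. h = mon_x \<star> g \<star> mon_y"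
  proof (induction h rule: poly_mapping_keys_induct)
    case (single u c)
    then show ?case
      by (intro bexI[of _ "mon (fst u - 1, snd u - 1) c"]) (auto simp: prod_eq_iff)
  next
    case (add f g)
    then obtain f' g' where "f' \<in> plane" "f = mon_x \<star> f' \<star> mon_y" "g' \<in> plane" "g = mon_x \<star> g' \<star> mon_y"
      by blast
    then show ?case by (intro bexI[of _ "f' + g'"]) (simp_all add: mul_add_left mul_add_right)
  qed (simp add: bexI[of _ 0])
  then obtain g where g: "g \<in> plane" "h = mon_x \<star> g \<star> mon_y" by blast
  have "K mon_x \<star> K g \<star> K mon_y = mon (1, 1) 1"
    using h(2) g by (simp add: mult)
  from factor_of_monomial[OF this] obtain s t r \<alpha> \<beta> where
    f: "K mon_x = mon s \<alpha>" "extreme lex t (K g)" "K mon_y = mon r \<beta>" "\<alpha> \<noteq> 0" "\<beta> \<noteq> 0" "s + t + r = (1, 1)"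
    by auto
  have "K mon_y \<star> K mon_x = scale q (K mon_x \<star> K mon_y)"
    using yx plane_linearD(3)[OF lin(1), of "mon_x \<star> mon_y" q] mult(1)[of mon_x mon_y] mult(1)[of mon_y mon_x] by simp
  then have "q powi (snd r * fst s) = q powi (1 + snd s * fst r)"
    using f(4,5) by (auto simp: f(1,3) add.commute q_nonzero power_int_add mon_eq_iff)
  then have det: "snd r * fst s = 1 + snd s * fst r"
    by (simp add: powi_inj)
  have pos: "0 \<le> fst s" "0 \<le> snd s" "0 \<le> fst r" "0 \<le> snd r" "0 \<le> fst t" "0 \<le> snd t"
  proof -
    have "K mon_x \<in> plane" "K mon_y \<in> plane" "K g \<in> plane" using g by simp_all
    then show "0 \<le> fst s" "0 \<le> snd s" "0 \<le> fst r" "0 \<le> snd r" "0 \<le> fst t" "0 \<le> snd t"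
      using f(2,4,5) plane_lookup[of "K g" t] unfolding f(1,3)
      by (cases s; cases r; auto simp: extreme_def in_keys_iff)+
  qed
  have sum: "fst s + fst t + fst r = 1" "snd s + snd t + snd r = 1"
    using f(6) by (auto simp: prod_eq_iff)
  have "fst s \<in> {0, 1}" "snd r \<in> {0, 1}" using pos sum by auto
  moreover have "snd r * fst s \<ge> 1" unfolding det using pos by simp
  ultimately have "fst s = 1" "snd r = 1" by auto
  with pos sum have "s = (1, 0)" "r = (0, 1)" by (auto simp: prod_eq_iff)
  with f have K: "K mon_x = diag \<alpha> \<beta> mon_x" "K mon_y = diag \<alpha> \<beta> mon_y" by simp_all
  have one: "K (mon (0, 0) 1) = mon (0, 0) 1"
    using mult(1)[of "mon (0, 0) 1" "K' (mon (0, 0) 1)"] inv(1)[of "mon (0, 0) 1"] by simp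
  have D: "K p = diag \<alpha> \<beta> p" if "p \<in> plane" for p
    using that
    by (induction p rule: plane_generated)
      (simp_all add: K[simplified] one mult diag_mul f diag_linear plane_linearD[OF lin(1)])
  moreover have "K' p = diag (inverse \<alpha>) (inverse \<beta>) p" if p: "p \<in> plane" for p
    using inv(2)[of "diag (inverse \<alpha>) (inverse \<beta>) p"] D f p by simp
  ultimately show ?thesis using that f by blast
qed

text \<open>
  A skew derivation \<open>\<delta>\<close> with \<open>\<delta>(p r) = p \<delta>(r) + \<delta>(p) K(r)\<close> becomes inner over the quantum torus.
  At the exponent \<open>(i, j)\<close>, an element \<open>w\<close> contributes \<open>w\<^sub>i\<^sub>j (\<alpha> q\<^sup>j - 1)\<close> to \<open>\<delta>(x)\<close> and
  \<open>w\<^sub>i\<^sub>j (\<beta> - q\<^sup>i)\<close> to \<open>\<delta>(y)\<close>, and the relation \<open>y x = q x y\<close> makes the values of \<open>\<delta>\<close> proportional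
  to these two numbers.  The only obstruction is an exponent where both numbers vanish.  There the weight
  \<open>\<alpha>\<^sup>i \<beta>\<^sup>j\<close> is 1, whereas \<open>\<delta>\<close> has weight \<open>\<mu> \<noteq> 1\<close>.  Since \<open>\<delta>\<close> maps the plane to itself,
  negative exponents occur in \<open>w\<close> only as \<open>-1\<close>, and only for one value of \<open>\<alpha>\<close> or \<open>\<beta>\<close>.
\<close>

theorem skew_derivation_inner:
  assumes nz: "\<alpha> \<noteq> 0" "\<beta> \<noteq> 0" and lin: "plane_linear \<delta>"
    and leibniz: "\<And>p r. \<lbrakk>p \<in> plane; r \<in> plane\<rbrakk> \<Longrightarrow> \<delta> (p \<star> r) = p \<star> \<delta> r + \<delta> p \<star> diag \<alpha> \<beta> r"
    and weight: "\<And>p. p \<in> plane \<Longrightarrow> diag \<alpha> \<beta> (\<delta> p) = scale \<mu> (\<delta> (diag \<alpha> \<beta> p))"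
    and \<mu>: "\<mu> \<noteq> 1"
  obtains w where "\<And>p. p \<in> plane \<Longrightarrow> \<delta> p = w \<star> diag \<alpha> \<beta> p - p \<star> w"
    "\<And>i j. Poly_Mapping.lookup w (i, j) \<noteq> 0 \<Longrightarrow> -1 \<le> i \<and> -1 \<le> j \<and> (i = -1 \<longrightarrow> \<beta> = inverse q) \<and>
      (j = -1 \<longrightarrow> \<alpha> = q) \<and> \<alpha> powi i * \<beta> powi j = \<mu>"
proof -
  note [simp] = plane_linearD(1)[OF lin]
  define a where "a i j = Poly_Mapping.lookup (\<delta> mon_x) (i, j)" for i j
  define b where "b i j = Poly_Mapping.lookup (\<delta> mon_y) (i, j)" for i j
  have rel: "a (i + 1) j * (q powi i - \<beta>) + b i (j + 1) * (\<alpha> * q powi j - 1) = 0" for i j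
  proof -
    have "mon_y \<star> \<delta> mon_x + \<delta> mon_y \<star> mon (1, 0) \<alpha> = scale q (mon_x \<star> \<delta> mon_y + \<delta> mon_x \<star> mon (0, 1) \<beta>)"
      using plane_linearD(3)[OF lin, of "mon_x \<star> mon_y" q] leibniz[of mon_x mon_y] leibniz[of mon_y mon_x] by simp
    from arg_cong[OF this, of "\<lambda>p. Poly_Mapping.lookup p (i + 1, j + 1)"]
    have "q * (a (i + 1) j * (q powi i - \<beta>) + b i (j + 1) * (\<alpha> * q powi j - 1)) = 0"
      by (simp add: lookup_add lookup_mul_mon a_def b_def power_int_add q_nonzero algebra_simps)
    then show ?thesis using q_nonzero by simp
  qed
  have wa: "\<alpha> powi i * \<beta> powi j = \<mu>" if "a (i + 1) j \<noteq> 0" for i j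
    using arg_cong[OF weight[of mon_x], of "\<lambda>p. Poly_Mapping.lookup p (i + 1, j)"] that nz
      plane_linearD(3)[OF lin, of mon_x \<alpha>]
    by (simp add: a_def power_int_add mult_ac)
  have wb: "\<alpha> powi i * \<beta> powi j = \<mu>" if "b i (j + 1) \<noteq> 0" for i j
    using arg_cong[OF weight[of mon_y], of "\<lambda>p. Poly_Mapping.lookup p (i, j + 1)"] that nz
      plane_linearD(3)[OF lin, of mon_y \<beta>]
    by (simp add: b_def power_int_add mult_ac)
  \<comment> \<open>The coefficient is the quotient from \<open>\<delta> x\<close> or from \<open>\<delta> y\<close>, whichever has a nonzero denominator.
    Where neither does, the value 0 keeps the support within the asserted bounds.\<close>
  define W where "W u = (case u of (i, j) \<Rightarrow>
    if \<alpha> * q powi j \<noteq> 1 then a (i + 1) j / (\<alpha> * q powi j - 1)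
    else if \<beta> \<noteq> q powi i then b i (j + 1) / (\<beta> - q powi i) else 0)" for u
  have fin: "finite {u. W u \<noteq> 0}"
  proof (rule finite_subset)
    show "{u. W u \<noteq> 0} \<subseteq> (\<lambda>u. u - (1, 0)) ` Poly_Mapping.keys (\<delta> mon_x) \<union>
        (\<lambda>u. u - (0, 1)) ` Poly_Mapping.keys (\<delta> mon_y)"
    proof
      fix u assume "u \<in> {u. W u \<noteq> 0}"
      then have "u + (1, 0) \<in> Poly_Mapping.keys (\<delta> mon_x) \<or> u + (0, 1) \<in> Poly_Mapping.keys (\<delta> mon_y)"
        by (cases u) (auto simp: W_def a_def b_def in_keys_iff split: if_splits)
      moreover have "u = (u + (1, 0)) - (1, 0)" "u = (u + (0, 1)) - (0, 1)" by (simp_all add: prod_eq_iff)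
      ultimately show "u \<in> (\<lambda>u. u - (1, 0)) ` Poly_Mapping.keys (\<delta> mon_x) \<union>
        (\<lambda>u. u - (0, 1)) ` Poly_Mapping.keys (\<delta> mon_y)" by blast
    qed
  qed simp
  define w where "w = Abs_poly_mapping W"
  have lw: "Poly_Mapping.lookup w = W" unfolding w_def by (rule lookup_Abs_poly_mapping[OF fin])
  \<comment> \<open>Where both factors vanish, the weight is 1, so no coefficient of a value of \<open>\<delta>\<close> lies over this exponent.\<close>
  have no_outer: "a (i + 1) j = 0 \<and> b i (j + 1) = 0" if "\<alpha> * q powi j = 1" "\<beta> = q powi i" for i j
  proof -
    have "\<alpha> = q powi (- j)" using that(1) q_nonzero by (simp add: power_int_minus field_simps)
    then have "\<alpha> powi i * \<beta> powi j = q powi ((- j) * i) * q powi (i * j)"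
      by (simp only: that(2) power_int_mult)
    also have "\<dots> = 1" by (simp add: q_nonzero flip: power_int_add)
    finally show ?thesis using wa[of i j] wb[of i j] \<mu> by auto
  qed
  have aW: "a (i + 1) j = W (i, j) * (\<alpha> * q powi j - 1)" for i j
    using rel[of i j] no_outer[of j i] by (auto simp: W_def)
  have bW: "b i (j + 1) = W (i, j) * (\<beta> - q powi i)" for i j
  proof (cases "\<alpha> * q powi j = 1")
    case True
    then show ?thesis using no_outer[of j i] by (auto simp: W_def)
  next
    case False
    have "b i (j + 1) * (\<alpha> * q powi j - 1) = a (i + 1) j * (\<beta> - q powi i)"
      using rel[of i j] by (simp add: algebra_simps)
    with False show ?thesis by (simp add: W_def field_simps)
  qed
  have x: "\<delta> mon_x = w \<star> diag \<alpha> \<beta> mon_x - mon_x \<star> w"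
  proof (rule poly_mapping_eqI)
    fix u show "Poly_Mapping.lookup (\<delta> mon_x) u = Poly_Mapping.lookup (w \<star> diag \<alpha> \<beta> mon_x - mon_x \<star> w) u"
      using aW[of "fst u - 1" "snd u"]
      by (cases u) (simp add: lookup_minus lookup_mul_mon lw a_def algebra_simps)
  qed
  have y: "\<delta> mon_y = w \<star> diag \<alpha> \<beta> mon_y - mon_y \<star> w"
  proof (rule poly_mapping_eqI)
    fix u show "Poly_Mapping.lookup (\<delta> mon_y) u = Poly_Mapping.lookup (w \<star> diag \<alpha> \<beta> mon_y - mon_y \<star> w) u"
      using bW[of "fst u" "snd u - 1"]
      by (cases u) (simp add: lookup_minus lookup_mul_mon lw b_def algebra_simps)
  qed
  have one: "\<delta> (mon (0, 0) 1) = 0"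
    using leibniz[of "mon (0, 0) 1" "mon (0, 0) 1"] by simp
  have "\<delta> p = w \<star> diag \<alpha> \<beta> p - p \<star> w" if "p \<in> plane" for p
    using that
  proof (induction p rule: plane_generated)
    case (mul p r)
    then show ?case
      by (simp add: leibniz diag_mul[OF nz] mul_minus mul_assoc)
  next
    case (add p r)
    then show ?case
      by (simp add: plane_linearD[OF lin] diag_linear mul_add_left mul_add_right)
  qed (use x y in \<open>simp_all add: one plane_linearD[OF lin] diag_linear mul_scale scale_add\<close>)
  moreover have "-1 \<le> i \<and> -1 \<le> j \<and> (i = -1 \<longrightarrow> \<beta> = inverse q) \<and>
      (j = -1 \<longrightarrow> \<alpha> = q) \<and> \<alpha> powi i * \<beta> powi j = \<mu>" if "Poly_Mapping.lookup w (i, j) \<noteq> 0" for i j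
  proof -
    have ab: "a (i + 1) j \<noteq> 0 \<longleftrightarrow> \<alpha> * q powi j \<noteq> 1" "b i (j + 1) \<noteq> 0 \<longleftrightarrow> \<beta> \<noteq> q powi i"
      using that by (simp_all add: aW bW lw)
    have or: "a (i + 1) j \<noteq> 0 \<or> b i (j + 1) \<noteq> 0"
      using that by (auto simp: lw W_def split: if_splits)
    have pa: "a (i + 1) j \<noteq> 0 \<Longrightarrow> 0 \<le> i + 1 \<and> 0 \<le> j"
      using plane_lookup[of "\<delta> mon_x" "(i + 1, j)"] by (simp add: a_def)
    have pb: "b i (j + 1) \<noteq> 0 \<Longrightarrow> 0 \<le> i \<and> 0 \<le> j + 1"
      using plane_lookup[of "\<delta> mon_y" "(i, j + 1)"] by (simp add: b_def)
    have "i = -1 \<Longrightarrow> \<beta> = inverse q" using pb ab(2) by auto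
    moreover have "j = -1 \<Longrightarrow> \<alpha> = q" using pa ab(1) q_nonzero by (auto simp: field_simps)
    ultimately show ?thesis using or pa pb wa[of i j] wb[of i j] by auto
  qed
  ultimately show ?thesis using that by blast
qed

end

context generic_torus
begin

lemma weight_iff: "(q powi a) powi i * (q powi b) powi j = q powi n \<longleftrightarrow> a * i + b * j = n"
  by (simp add: powi_inj q_nonzero flip: power_int_mult power_int_add)

lemma q_minus_inverse_nonzero: "q - inverse q \<noteq> 0"
  using not_root[of 2] q_nonzero by (simp add: field_simps power2_eq_square)

end

section \<open>Pairs of elements implementing the action\<close>

text \<open>
  Here \<open>E p = w K(p) - p w\<close> and \<open>F p = v p - K'(p) v\<close> for the diagonal automorphism \<open>K\<close> and its inverse
  \<open>K'\<close>.  Expanding, \<open>(E F - F E) p = K'(p) z - z K(p)\<close> with \<open>z = v w - q\<^sup>-\<^sup>2 w v\<close>, so the last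
  assumption is the relation between \<open>E\<close> and \<open>F\<close>.
\<close>

locale implementing_pair = generic_torus +
  fixes \<alpha> \<beta> :: complex and w v :: torus
  assumes \<alpha>: "\<alpha> \<noteq> 0" and \<beta>: "\<beta> \<noteq> 0"
    and support_w: "\<And>i j. Poly_Mapping.lookup w (i, j) \<noteq> 0 \<Longrightarrow> -1 \<le> i \<and> -1 \<le> j \<and>
      (i = -1 \<longrightarrow> \<beta> = inverse q) \<and> (j = -1 \<longrightarrow> \<alpha> = q) \<and> \<alpha> powi i * \<beta> powi j = q powi 2"
    and support_v: "\<And>i j. Poly_Mapping.lookup v (i, j) \<noteq> 0 \<Longrightarrow> -1 \<le> i \<and> -1 \<le> j \<and>
      (i = -1 \<longrightarrow> \<beta> = inverse q) \<and> (j = -1 \<longrightarrow> \<alpha> = q) \<and> \<alpha> powi i * \<beta> powi j = q powi (-2)"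
    and commutator: "\<And>p. p \<in> plane \<Longrightarrow>
      diag (inverse \<alpha>) (inverse \<beta>) p \<star> (v \<star> w - scale (q powi (-2)) (w \<star> v))
        - (v \<star> w - scale (q powi (-2)) (w \<star> v)) \<star> diag \<alpha> \<beta> p
      = scale (1 / (q - inverse q)) (diag \<alpha> \<beta> p - diag (inverse \<alpha>) (inverse \<beta>) p)"
begin

definition z :: torus where
  "z = v \<star> w - scale (q powi (-2)) (w \<star> v)"

text \<open>
  The element \<open>z + 1/(q - q\<^sup>-\<^sup>1)\<close> intertwines \<open>K\<close> and \<open>K'\<close>.  On a diagonal automorphism this is a
  condition on each coefficient separately; the next two lemmas are this condition for \<open>p = x\<close> and \<open>p = y\<close>.
\<close>

lemma z_x: "Poly_Mapping.lookup z (k, l) * (inverse \<alpha> - \<alpha> * q powi l) =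
  (if k = 0 \<and> l = 0 then (\<alpha> - inverse \<alpha>) / (q - inverse q) else 0)"
proof -
  define N where "N = 1 / (q - inverse q)"
  have "inverse \<alpha> * Poly_Mapping.lookup z (k, l) - \<alpha> * Poly_Mapping.lookup z (k, l) * q powi l =
      (if k = 0 \<and> l = 0 then N * (\<alpha> - inverse \<alpha>) else 0)"
    using arg_cong[OF commutator[of mon_x, folded z_def N_def], of "\<lambda>p. Poly_Mapping.lookup p (k + 1, l)"]
    by (simp add: lookup_minus lookup_mul_mon lookup_single when_def)
  then show ?thesis by (auto simp: N_def algebra_simps)
qed

lemma z_y: "Poly_Mapping.lookup z (k, l) * (inverse \<beta> * q powi k - \<beta>) =
  (if k = 0 \<and> l = 0 then (\<beta> - inverse \<beta>) / (q - inverse q) else 0)"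
proof -
  define N where "N = 1 / (q - inverse q)"
  have "inverse \<beta> * Poly_Mapping.lookup z (k, l) * q powi k - \<beta> * Poly_Mapping.lookup z (k, l) =
      (if k = 0 \<and> l = 0 then N * (\<beta> - inverse \<beta>) else 0)"
    using arg_cong[OF commutator[of mon_y, folded z_def N_def], of "\<lambda>p. Poly_Mapping.lookup p (k, l + 1)"]
    by (simp add: lookup_minus lookup_mul_mon lookup_single when_def)
  then show ?thesis by (auto simp: N_def algebra_simps)
qed

lemma z_const:
  assumes "\<alpha>\<^sup>2 \<noteq> 1 \<or> \<beta>\<^sup>2 \<noteq> 1"
  shows "Poly_Mapping.lookup z (0, 0) = - 1 / (q - inverse q)"
proof -
  have *: "Z = - 1 / D" if "Z * (inverse a - a) = (a - inverse a) / D" "a\<^sup>2 \<noteq> 1" "a \<noteq> 0" for Z D a :: complex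
  proof -
    have "inverse a - a \<noteq> 0" using that(2,3) by (simp add: field_simps power2_eq_square)
    moreover have "Z * (inverse a - a) = (- 1 / D) * (inverse a - a)"
      unfolding that(1) by (simp add: algebra_simps diff_divide_distrib)
    ultimately show ?thesis by (metis mult_right_cancel)
  qed
  show ?thesis
    using assms *[of _ \<alpha>] *[of _ \<beta>] z_x[of 0 0] z_y[of 0 0] \<alpha> \<beta> by auto
qed

lemma involutive_case:
  assumes "\<alpha>\<^sup>2 = 1" "\<beta>\<^sup>2 = 1"
  shows "w = 0" "v = 0"
proof -
  have one: "(\<alpha> powi i * \<beta> powi j)\<^sup>2 = 1" for i j
  proof -
    have "(\<alpha> powi i * \<beta> powi j)\<^sup>2 = (\<alpha>\<^sup>2) powi i * (\<beta>\<^sup>2) powi j"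
      by (simp add: power2_eq_square power_int_mult_distrib mult_ac)
    then show ?thesis by (simp add: assms)
  qed
  have "(q powi n)\<^sup>2 \<noteq> 1" if "n \<noteq> 0" for n
    using that powi_eq_1[of "n * 2"] by (simp add: power_int_mult)
  then have ne: "\<alpha> powi i * \<beta> powi j \<noteq> q powi n" if "n \<noteq> 0" for i j n
    using that by (metis one)
  show "w = 0"
  proof (rule poly_mapping_eqI)
    fix u show "Poly_Mapping.lookup w u = Poly_Mapping.lookup 0 u"
      using support_w[of "fst u" "snd u"] ne[of 2 "fst u" "snd u"] by auto
  qed
  show "v = 0"
  proof (rule poly_mapping_eqI)
    fix u show "Poly_Mapping.lookup v u = Poly_Mapping.lookup 0 u"
      using support_v[of "fst u" "snd u"] ne[of "-2" "fst u" "snd u"] by auto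
  qed
qed

text \<open>
  The constant term of \<open>z\<close> is nonzero, so some exponent \<open>u\<close> of \<open>w\<close> has \<open>-u\<close> among the exponents of
  \<open>v\<close>.  All exponents are at least \<open>-1\<close>, so \<open>u\<close> is one of nine pairs, and each nonzero coordinate of
  \<open>u\<close> determines \<open>\<alpha>\<close> or \<open>\<beta>\<close>, as it is \<open>-1\<close> either in \<open>u\<close> or in \<open>-u\<close>.  The weight of \<open>u\<close> is
  \<open>q\<^sup>2\<close>, which gives the other parameter and excludes the remaining pairs.
\<close>

lemma weights:
  assumes "\<alpha>\<^sup>2 \<noteq> 1 \<or> \<beta>\<^sup>2 \<noteq> 1"
  obtains (tau) "\<alpha> = q powi 1" "\<beta> = q powi (-1)" | (b0) "\<alpha> = q powi 1" "\<beta> = q powi (-2)"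
    | (c0) "\<alpha> = q powi 2" "\<beta> = q powi (-1)" | (a0) "\<alpha> = q powi (-2)" "\<beta> = q powi (-1)"
    | (d0) "\<alpha> = q powi 1" "\<beta> = q powi 2"
proof -
  have "\<exists>u. Poly_Mapping.lookup w u \<noteq> 0 \<and> Poly_Mapping.lookup v (- u) \<noteq> 0"
  proof (rule ccontr)
    assume no: "\<not> ?thesis"
    have "Poly_Mapping.lookup (v \<star> w) (0, 0) = 0"
      unfolding lookup_mul
    proof (rule sum.neutral, rule ballI)
      fix u assume "u \<in> Poly_Mapping.keys v"
      with no have "Poly_Mapping.lookup w (- u) = 0"
        by (metis in_keys_iff minus_minus)
      moreover have "(0, 0) - u = - u" by (simp add: prod_eq_iff)
      ultimately have "Poly_Mapping.lookup w ((0, 0) - u) = 0" by simp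
      then show "Poly_Mapping.lookup v u * Poly_Mapping.lookup w ((0, 0) - u) * q powi (snd u * fst ((0, 0) - u)) = 0"
        by simp
    qed
    moreover have "Poly_Mapping.lookup (w \<star> v) (0, 0) = 0"
      unfolding lookup_mul
    proof (rule sum.neutral, rule ballI)
      fix u assume "u \<in> Poly_Mapping.keys w"
      with no have "Poly_Mapping.lookup v ((0, 0) - u) = 0"
        by (cases u) (auto simp: in_keys_iff)
      then show "Poly_Mapping.lookup w u * Poly_Mapping.lookup v ((0, 0) - u) * q powi (snd u * fst ((0, 0) - u)) = 0"
        by simp
    qed
    ultimately show False
      using z_const[OF assms] q_minus_inverse_nonzero by (simp add: z_def lookup_minus)
  qed
  then obtain m n where mn: "Poly_Mapping.lookup w (m, n) \<noteq> 0" "Poly_Mapping.lookup v (- m, - n) \<noteq> 0"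
    by auto
  note w = support_w[OF mn(1)] and v = support_v[OF mn(2)]
  have "-1 \<le> m" "-1 \<le> n" "-1 \<le> - m" "-1 \<le> - n" using w v by blast+
  then have m: "m = -1 \<or> m = 0 \<or> m = 1" and n: "n = -1 \<or> n = 0 \<or> n = 1" by arith+
  have a: "n \<noteq> 0 \<Longrightarrow> \<alpha> = q powi 1" and b: "m \<noteq> 0 \<Longrightarrow> \<beta> = q powi (-1)"
    using w v m n by force+
  have W: "\<alpha> powi m * \<beta> powi n = q powi 2" using w by blast
  have inv: "c = q powi (-2)" if "inverse c = q powi 2" for c
    using arg_cong[OF that, of inverse] by (simp add: power_int_minus)
  consider "m \<noteq> 0" "n \<noteq> 0" | "m = 0" "n = 0" | "m = 0" "n \<noteq> 0" | "m \<noteq> 0" "n = 0" by blast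
  then show thesis
  proof cases
    case 1
    from W have "1 * m + (-1) * n = 2" unfolding a[OF 1(2)] b[OF 1(1)] weight_iff .
    with 1 a b tau m n show ?thesis by auto
  next
    case 2
    with W powi_eq_1[of 2] show ?thesis by simp
  next
    case 3
    with W n inv[of \<beta>] have "\<beta> = q powi 2 \<or> \<beta> = q powi (-2)" by auto
    with 3 a b0 d0 show ?thesis by blast
  next
    case 4
    with W m inv[of \<alpha>] have "\<alpha> = q powi 2 \<or> \<alpha> = q powi (-2)" by auto
    with 4 b a0 c0 show ?thesis by blast
  qed
qed

lemma support_w_exponents:
  assumes "\<alpha> = q powi a" "\<beta> = q powi b" "Poly_Mapping.lookup w (i, j) \<noteq> 0"
  shows "-1 \<le> i \<and> -1 \<le> j \<and> (i = -1 \<longrightarrow> b = -1) \<and> (j = -1 \<longrightarrow> a = 1) \<and> a * i + b * j = 2"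
  using support_w[OF assms(3)] powi_inj[of b "-1"] powi_inj[of a 1]
  unfolding assms(1,2) weight_iff by auto

lemma support_v_exponents:
  assumes "\<alpha> = q powi a" "\<beta> = q powi b" "Poly_Mapping.lookup v (i, j) \<noteq> 0"
  shows "-1 \<le> i \<and> -1 \<le> j \<and> (i = -1 \<longrightarrow> b = -1) \<and> (j = -1 \<longrightarrow> a = 1) \<and> a * i + b * j = -2"
  using support_v[OF assms(3)] powi_inj[of b "-1"] powi_inj[of a 1]
  unfolding assms(1,2) weight_iff by auto

text \<open>
  Here the supports of \<open>w\<close> and \<open>v\<close> lie on opposite rays with common direction \<open>(d, d')\<close>.  The leading
  terms of \<open>v w\<close> and \<open>q\<^sup>-\<^sup>2 w v\<close> have the same exponent but different powers of \<open>q\<close>, since the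
  determinant condition makes the difference of the powers \<open>2 + 2 (m + n)\<close>.  So the leading term
  survives in \<open>z\<close>.  As \<open>z\<close> has no nonconstant monomials with nonnegative exponents, \<open>m = n = 0\<close>, and
  \<open>w\<close> and \<open>v\<close> are monomials.
\<close>

lemma rigid:
  assumes \<alpha>_powi: "\<alpha> = q powi e" "e \<ge> 1"
    and w: "\<And>u. Poly_Mapping.lookup w u \<noteq> 0 \<Longrightarrow> \<exists>n\<ge>0. u = (a + n * d, b + n * d')"
    and v: "\<And>u. Poly_Mapping.lookup v u \<noteq> 0 \<Longrightarrow> \<exists>n\<ge>0. u = (- a + n * d, - b + n * d')"
    and d: "d \<ge> 1" "d' \<ge> 1" and det: "a * d' - b * d = 2"
  obtains c c' where "w = mon (a, b) c" "v = mon (- a, - b) c'"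
    "Poly_Mapping.lookup z (0, 0) = - 1 / (q - inverse q)"
proof -
  let ?R = "\<lambda>u v. lex v u"
  have "\<alpha>\<^sup>2 = q powi (e * 2)" by (simp add: \<alpha>_powi power_int_mult)
  then have "\<alpha>\<^sup>2 \<noteq> 1" using \<alpha>_powi(2) by (simp add: powi_eq_1)
  then have z00: "Poly_Mapping.lookup z (0, 0) = - 1 / (q - inverse q)" by (simp add: z_const)
  with q_minus_inverse_nonzero have "z \<noteq> 0" by auto
  then have nz: "w \<noteq> 0" "v \<noteq> 0" by (auto simp: z_def)
  obtain s t where s: "extreme ?R s v" and t: "extreme ?R t w"
    using extreme_exists[OF lex_like(2)] nz by blast
  obtain m where m: "m \<ge> 0" "s = (- a + m * d, - b + m * d')"
    using v[of s] s unfolding extreme_def in_keys_iff by blast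
  obtain n where n: "n \<ge> 0" "t = (a + n * d, b + n * d')"
    using w[of t] t unfolding extreme_def in_keys_iff by blast
  have st: "s + t = ((m + n) * d, (m + n) * d')" by (simp add: m n algebra_simps)
  \<comment> \<open>The power of \<open>q\<close> in the leading term of \<open>q\<^sup>-\<^sup>2 w v\<close>.\<close>
  define e' where "e' = snd t * fst s - 2"
  have "snd s * fst t - e' = 2 + (m + n) * (a * d' - b * d)"
    by (simp add: e'_def m n algebra_simps)
  then have ne: "snd s * fst t \<noteq> e'" using m n det by simp
  have "Poly_Mapping.lookup z (s + t) =
      Poly_Mapping.lookup v s * Poly_Mapping.lookup w t * (q powi (snd s * fst t) - q powi e')"
    using extreme_mul(2)[OF lex_like(2) s t] extreme_mul(2)[OF lex_like(2) t s]
    by (simp add: z_def lookup_minus add.commute[of t s] e'_def power_int_diff power_int_minus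
        q_nonzero field_simps)
  moreover have "Poly_Mapping.lookup v s \<noteq> 0" "Poly_Mapping.lookup w t \<noteq> 0"
    using s t by (auto simp: extreme_def in_keys_iff)
  ultimately have top: "Poly_Mapping.lookup z (s + t) \<noteq> 0"
    using ne by (simp add: powi_inj)
  have "m + n = 0"
  proof (rule ccontr)
    assume "m + n \<noteq> 0"
    then have "(m + n) * d' \<noteq> 0" using d by simp
    then have "inverse \<alpha> - \<alpha> * q powi ((m + n) * d') = 0"
      using top z_x[of "(m + n) * d" "(m + n) * d'"] unfolding st by (simp del: mult_eq_0_iff) simp
    \<comment> \<open>The coefficient of \<open>z\<close> could only survive at an exponent of \<open>y\<close> equal to \<open>-2 e < 0\<close>.\<close>
    then have "q powi (- e) = q powi (e + (m + n) * d')"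
      by (simp add: \<alpha>_powi power_int_minus power_int_add q_nonzero)
    then have "- e = e + (m + n) * d'" by (simp only: powi_inj)
    moreover have "(m + n) * d' \<ge> 0" using m n d by simp
    ultimately show False using \<alpha>_powi(2) by simp
  qed
  with m n have "m = 0" "n = 0" by auto
  then have st0: "s = (- a, - b)" "t = (a, b)" by (simp_all add: m n)
  have "u = (a, b)" if "Poly_Mapping.lookup w u \<noteq> 0" for u
  proof -
    obtain k where k: "k \<ge> 0" "u = (a + k * d, b + k * d')" using w \<open>Poly_Mapping.lookup w u \<noteq> 0\<close> by blast
    have "u = (a, b) \<or> lex u (a, b)" using t that by (auto simp: extreme_def in_keys_iff st0)
    moreover have "0 \<le> k * d" "0 \<le> k * d'" using k d by simp_all
    ultimately show ?thesis unfolding k lex_def by auto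
  qed
  then have "w = mon (a, b) (Poly_Mapping.lookup w (a, b))"
    by (intro poly_mapping_eqI) (auto simp: lookup_single when_def)
  moreover have "u = (- a, - b)" if "Poly_Mapping.lookup v u \<noteq> 0" for u
  proof -
    obtain k where k: "k \<ge> 0" "u = (- a + k * d, - b + k * d')" using v \<open>Poly_Mapping.lookup v u \<noteq> 0\<close> by blast
    have "u = (- a, - b) \<or> lex u (- a, - b)" using s that by (auto simp: extreme_def in_keys_iff st0)
    moreover have "0 \<le> k * d" "0 \<le> k * d'" using k d by simp_all
    ultimately show ?thesis unfolding k lex_def by auto
  qed
  then have "v = mon (- a, - b) (Poly_Mapping.lookup v (- a, - b))"
    by (intro poly_mapping_eqI) (auto simp: lookup_single when_def)
  ultimately show ?thesis using that z00 by blast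
qed

text \<open>
  The case lemmas are named after the parameter of the family that arises.  In the cases \<open>a0\<close> and
  \<open>d0\<close> one of the two supports is a single point and the other one consists of three points.  The
  extra monomials carry the two free parameters: one has no effect on the first generator and another
  one none on the second.
\<close>

abbreviation "E x \<equiv> w \<star> diag \<alpha> \<beta> x - x \<star> w"
abbreviation "F x \<equiv> v \<star> x - diag (inverse \<alpha>) (inverse \<beta>) x \<star> v"

lemma case_tau:
  assumes "\<alpha> = q powi 1" "\<beta> = q powi (-1)"
  shows "\<exists>\<tau>. \<tau> \<noteq> 0 \<and> E mon_x = 0 \<and> E mon_y = mon (1, 0) \<tau> \<and> F mon_x = mon (0, 1) (inverse \<tau>) \<and> F mon_y = 0"
proof -
  have w: "\<exists>n\<ge>0. u = (1 + n * 1, -1 + n * 1)" if "Poly_Mapping.lookup w u \<noteq> 0" for u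
    using support_w_exponents[OF assms, of "fst u" "snd u"] that
    by (intro exI[of _ "snd u + 1"]) (auto simp: prod_eq_iff)
  have v: "\<exists>n\<ge>0. u = (- 1 + n * 1, - (-1) + n * 1)" if "Poly_Mapping.lookup v u \<noteq> 0" for u
    using support_v_exponents[OF assms, of "fst u" "snd u"] that
    by (intro exI[of _ "fst u + 1"]) (auto simp: prod_eq_iff)
  obtain c d where wv: "w = mon (1, -1) c" "v = mon (-1, 1) d"
    and z00: "Poly_Mapping.lookup z (0, 0) = - 1 / (q - inverse q)"
    by (rule rigid[OF assms(1) _ w v]) auto
  define N where "N = q - inverse q"
  have N: "N \<noteq> 0" "inverse q - q = - N" "inverse (q * q) * q = inverse q" "q = N + inverse q"
    using q_minus_inverse_nonzero q_nonzero by (simp_all add: N_def)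
  have "d * c * q - inverse (q * q) * (c * d * q) = - 1 / N"
    using z00[unfolded z_def, unfolded wv] q_nonzero
    by (simp add: lookup_minus power_int_minus N_def power2_eq_square)
  then have "d * c * (q - inverse (q * q) * q) = - 1 / N"
    by (simp add: algebra_simps)
  then have "d * c * N = - 1 / N"
    by (simp only: N(3) N_def)
  then have "(c * (- N)) * (d * N) = 1"
    using N(1) by (simp add: field_simps)
  then have "c * (- N) \<noteq> 0 \<and> d * N = inverse (c * (- N))"
    by (metis inverse_unique mult_zero_left zero_neq_one)
  moreover have "E mon_x = 0" "E mon_y = mon (1, 0) (c * (- N))" "F mon_x = mon (0, 1) (d * N)" "F mon_y = 0"
    using assms q_nonzero
    by (auto simp: wv power_int_minus N_def algebra_simps simp flip: single_diff)
  ultimately show ?thesis by metis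
qed

lemma q_cancel:
  "a * q * inverse q = a" "q * a * inverse q = a" "a * inverse q * q = a" "inverse q * a * q = a"
  "q * (a * inverse q) = a" "inverse q * (a * q) = a"
  using q_nonzero by simp_all

lemma scalar_identities:
  assumes "d * c - inverse q * inverse q * (c * d) = - 1 / (q - inverse q)"
  shows "c * (inverse q * inverse q) - c \<noteq> 0" "d - inverse q * inverse q * d \<noteq> 0"
    "d * q - inverse q * d = inverse (c * (inverse q * inverse q) - c)"
    "d - q * q * d = - q * inverse (c * (inverse q * inverse q) - c)"
    "c * inverse q - c * q = inverse (d - inverse q * inverse q * d)"
    "c * (q * q) - c = - q * inverse (d - inverse q * inverse q * d)"
proof -
  define N where "N = q - inverse q"
  have N: "N \<noteq> 0" "q * N = q * q - 1" "N * inverse q = 1 - inverse q * inverse q"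
    using q_minus_inverse_nonzero q_nonzero by (simp_all add: N_def algebra_simps)
  have "d * c * (1 - inverse q * inverse q) = - 1 / N"
    using assms by (simp add: N_def algebra_simps)
  then have prod: "d * c * (N * inverse q) * N = - 1"
    using N(1) unfolding N(3) by simp
  have e: "c * (inverse q * inverse q) - c = - c * (N * inverse q)"
    "d - inverse q * inverse q * d = d * (N * inverse q)"
    unfolding N(3) by (simp_all add: algebra_simps)
  have f: "d * q - inverse q * d = d * N" "c * inverse q - c * q = - c * N"
    by (simp_all add: N_def algebra_simps)
  have g: "d - q * q * d = - q * (d * N)" "c * (q * q) - c = - q * (- c * N)"
  proof -
    have "- q * (d * N) = - d * (q * N)" "- q * (- c * N) = c * (q * N)" by simp_all
    then show "d - q * q * d = - q * (d * N)" "c * (q * q) - c = - q * (- c * N)"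
      unfolding N(2) by (simp_all add: algebra_simps)
  qed
  have "(- c * (N * inverse q)) * (d * N) = 1" "(d * (N * inverse q)) * (- c * N) = 1"
    using prod by (simp_all add: algebra_simps)
  then have h: "d * N = inverse (- c * (N * inverse q))" "- c * N = inverse (d * (N * inverse q))"
    "- c * (N * inverse q) \<noteq> 0" "d * (N * inverse q) \<noteq> 0"
    by (metis inverse_unique, metis inverse_unique, auto)
  show "c * (inverse q * inverse q) - c \<noteq> 0" "d - inverse q * inverse q * d \<noteq> 0"
    "d * q - inverse q * d = inverse (c * (inverse q * inverse q) - c)"
    "d - q * q * d = - q * inverse (c * (inverse q * inverse q) - c)"
    "c * inverse q - c * q = inverse (d - inverse q * inverse q * d)"
    "c * (q * q) - c = - q * inverse (d - inverse q * inverse q * d)"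
    unfolding e f g h(1,2) using h(3,4) by blast+
qed

lemma case_b0:
  assumes "\<alpha> = q powi 1" "\<beta> = q powi (-2)"
  shows "\<exists>b0. b0 \<noteq> 0 \<and> E mon_x = 0 \<and> E mon_y = mon (0, 0) b0 \<and>
    F mon_x = mon (1, 1) (inverse b0) \<and> F mon_y = mon (0, 2) (- q * inverse b0)"
proof -
  have w: "\<exists>n\<ge>0. u = (0 + n * 2, -1 + n * 1)" if "Poly_Mapping.lookup w u \<noteq> 0" for u
    using support_w_exponents[OF assms, of "fst u" "snd u"] that
    by (intro exI[of _ "snd u + 1"]) (auto simp: prod_eq_iff)
  have v: "\<exists>n\<ge>0. u = (- 0 + n * 2, - (-1) + n * 1)" if "Poly_Mapping.lookup v u \<noteq> 0" for u
    using support_v_exponents[OF assms, of "fst u" "snd u"] that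
    by (intro exI[of _ "snd u - 1"]) (auto simp: prod_eq_iff)
  obtain c d where wv: "w = mon (0, -1) c" "v = mon (0, 1) d"
    and z00: "Poly_Mapping.lookup z (0, 0) = - 1 / (q - inverse q)"
    by (rule rigid[OF assms(1) _ w v]) auto
  have "d * c - inverse q * inverse q * (c * d) = - 1 / (q - inverse q)"
    using z00[unfolded z_def, unfolded wv] q_nonzero
    by (simp add: lookup_minus power_int_minus power2_eq_square)
  note s = scalar_identities[OF this]
  have "E mon_x = 0" "E mon_y = mon (0, 0) (c * (inverse q * inverse q) - c)"
    "F mon_x = mon (1, 1) (d * q - inverse q * d)" "F mon_y = mon (0, 2) (d - q * q * d)"
    using assms q_nonzero
    by (simp_all add: wv power_int_minus power2_eq_square q_cancel flip: single_diff)
  then show ?thesis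
    unfolding s(3,4) using s(1) by blast
qed

lemma case_c0:
  assumes "\<alpha> = q powi 2" "\<beta> = q powi (-1)"
  shows "\<exists>c0. c0 \<noteq> 0 \<and> E mon_x = mon (2, 0) (- q * inverse c0) \<and> E mon_y = mon (1, 1) (inverse c0) \<and>
    F mon_x = mon (0, 0) c0 \<and> F mon_y = 0"
proof -
  have w: "\<exists>n\<ge>0. u = (1 + n * 1, 0 + n * 2)" if "Poly_Mapping.lookup w u \<noteq> 0" for u
    using support_w_exponents[OF assms, of "fst u" "snd u"] that
    by (intro exI[of _ "fst u - 1"]) (auto simp: prod_eq_iff)
  have v: "\<exists>n\<ge>0. u = (- 1 + n * 1, - 0 + n * 2)" if "Poly_Mapping.lookup v u \<noteq> 0" for u
    using support_v_exponents[OF assms, of "fst u" "snd u"] that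
    by (intro exI[of _ "fst u + 1"]) (auto simp: prod_eq_iff)
  obtain c d where wv: "w = mon (1, 0) c" "v = mon (-1, 0) d"
    and z00: "Poly_Mapping.lookup z (0, 0) = - 1 / (q - inverse q)"
    by (rule rigid[OF assms(1) _ w v]) auto
  have "d * c - inverse q * inverse q * (c * d) = - 1 / (q - inverse q)"
    using z00[unfolded z_def, unfolded wv] q_nonzero
    by (simp add: lookup_minus power_int_minus power2_eq_square)
  note s = scalar_identities[OF this]
  have "E mon_x = mon (2, 0) (c * (q * q) - c)" "E mon_y = mon (1, 1) (c * inverse q - c * q)"
    "F mon_x = mon (0, 0) (d - inverse q * inverse q * d)" "F mon_y = 0"
    using assms q_nonzero
    by (simp_all add: wv power_int_minus power2_eq_square q_cancel flip: single_diff)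
  then show ?thesis
    unfolding s(5,6) using s(2) by blast
qed

lemma case_a0:
  assumes "\<alpha> = q powi (-2)" "\<beta> = q powi (-1)"
  shows "\<exists>a0 s t. a0 \<noteq> 0 \<and> E mon_x = mon (0, 0) a0 \<and> E mon_y = 0 \<and>
    F mon_x = mon (2, 0) (- q * inverse a0) + mon (0, 4) t \<and>
    F mon_y = mon (1, 1) (- q * inverse a0) + mon (0, 3) s"
proof -
  have "u = (-1, 0)" if "Poly_Mapping.lookup w u \<noteq> 0" for u
    using support_w_exponents[OF assms, of "fst u" "snd u"] that by (auto simp: prod_eq_iff)
  then have w: "w = mon (-1, 0) (Poly_Mapping.lookup w (-1, 0))"
    by (intro poly_mapping_eqI) (auto simp: lookup_single when_def)
  have v: "u = (1, 0) \<or> u = (0, 2) \<or> u = (-1, 4)" if "Poly_Mapping.lookup v u \<noteq> 0" for u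
  proof -
    have "fst u \<ge> -1 \<and> snd u \<ge> 0 \<and> -2 * fst u - snd u = -2"
      using support_v_exponents[OF assms, of "fst u" "snd u"] that by auto
    then have "snd u = 2 - 2 * fst u" "fst u = -1 \<or> fst u = 0 \<or> fst u = 1" by auto
    then show ?thesis by (auto simp: prod_eq_iff)
  qed
  have v: "v = mon (1, 0) (Poly_Mapping.lookup v (1, 0)) + mon (0, 2) (Poly_Mapping.lookup v (0, 2))
      + mon (-1, 4) (Poly_Mapping.lookup v (-1, 4))"
    by (rule poly_mapping_eqI) (use v in \<open>auto simp: lookup_single lookup_add when_def\<close>)
  obtain c where w: "w = mon (-1, 0) c" using w by blast
  obtain d d' d'' where v: "v = mon (1, 0) d + mon (0, 2) d' + mon (-1, 4) d''" using v by blast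
  have "\<alpha>\<^sup>2 = q powi (-2 * 2)" by (simp only: assms(1) power_int_mult power_int_numeral)
  then have "\<alpha>\<^sup>2 \<noteq> 1" using powi_eq_1[of "-2 * 2"] by simp
  then have z00: "Poly_Mapping.lookup z (0, 0) = - 1 / (q - inverse q)" by (simp add: z_const)
  have "d * c - inverse q * inverse q * (c * d) = - 1 / (q - inverse q)"
    using z00[unfolded z_def, unfolded w v] q_nonzero
    by (simp add: lookup_minus lookup_add mul_add_left mul_add_right lookup_single when_def power_int_minus power2_eq_square)
  note s = scalar_identities[OF this]
  have "E mon_x = mon (0, 0) (c * (inverse q * inverse q) - c)" "E mon_y = 0"
    using assms q_nonzero
    by (simp_all add: w power_int_minus power2_eq_square q_cancel flip: single_diff)
  moreover have "F mon_x = mon (2, 0) (d - q * q * d) + mon (0, 4) (d'' * q ^ 4 - q * q * d'')"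
    "F mon_y = mon (1, 1) (d - q * q * d) + mon (0, 3) (d' - q * d')"
    using assms q_nonzero
    by (simp_all add: v mul_add_left mul_add_right power_int_minus power2_eq_square q_cancel single_diff mult.assoc)
      (simp_all add: mult_ac)
  ultimately show ?thesis
    unfolding s(4) using s(1) by blast
qed

lemma case_d0:
  assumes "\<alpha> = q powi 1" "\<beta> = q powi 2"
  shows "\<exists>d0 s t. d0 \<noteq> 0 \<and> E mon_x = mon (1, 1) (- q * inverse d0) + mon (3, 0) s \<and>
    E mon_y = mon (0, 2) (- q * inverse d0) + mon (4, 0) t \<and> F mon_x = 0 \<and> F mon_y = mon (0, 0) d0"
proof -
  have "u = (0, -1)" if "Poly_Mapping.lookup v u \<noteq> 0" for u
    using support_v_exponents[OF assms, of "fst u" "snd u"] that by (auto simp: prod_eq_iff)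
  then have v: "v = mon (0, -1) (Poly_Mapping.lookup v (0, -1))"
    by (intro poly_mapping_eqI) (auto simp: lookup_single when_def)
  have w: "u = (0, 1) \<or> u = (2, 0) \<or> u = (4, -1)" if "Poly_Mapping.lookup w u \<noteq> 0" for u
  proof -
    have "fst u \<ge> 0 \<and> snd u \<ge> -1 \<and> fst u + 2 * snd u = 2"
      using support_w_exponents[OF assms, of "fst u" "snd u"] that by auto
    then have "fst u = 2 - 2 * snd u" "snd u = -1 \<or> snd u = 0 \<or> snd u = 1" by auto
    then show ?thesis by (auto simp: prod_eq_iff)
  qed
  have w: "w = mon (0, 1) (Poly_Mapping.lookup w (0, 1)) + mon (2, 0) (Poly_Mapping.lookup w (2, 0))
      + mon (4, -1) (Poly_Mapping.lookup w (4, -1))"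
    by (rule poly_mapping_eqI) (use w in \<open>auto simp: lookup_single lookup_add when_def\<close>)
  obtain d where v: "v = mon (0, -1) d" using v by blast
  obtain c c' c'' where w: "w = mon (0, 1) c + mon (2, 0) c' + mon (4, -1) c''" using w by blast
  have "\<alpha>\<^sup>2 = q powi 2" by (simp add: assms)
  then have "\<alpha>\<^sup>2 \<noteq> 1" using powi_eq_1[of 2] by simp
  then have z00: "Poly_Mapping.lookup z (0, 0) = - 1 / (q - inverse q)" by (simp add: z_const)
  have "d * c - inverse q * inverse q * (c * d) = - 1 / (q - inverse q)"
    using z00[unfolded z_def, unfolded w v] q_nonzero
    by (simp add: lookup_minus lookup_add mul_add_left mul_add_right lookup_single when_def power_int_minus power2_eq_square)
  note s = scalar_identities[OF this]
  have "F mon_y = mon (0, 0) (d - inverse q * inverse q * d)" "F mon_x = 0"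
    using assms q_nonzero
    by (simp_all add: v power_int_minus power2_eq_square q_cancel flip: single_diff)
  moreover have "E mon_x = mon (1, 1) (c * (q * q) - c) + mon (3, 0) (c' * q - c')"
    "E mon_y = mon (0, 2) (c * (q * q) - c) + mon (4, 0) (c'' * (q * q) - c'' * q ^ 4)"
    using assms q_nonzero
    by (simp_all add: w mul_add_left mul_add_right power_int_minus power2_eq_square q_cancel single_diff mult.assoc)
  ultimately show ?thesis
    unfolding s(6) using s(2) by blast
qed

end

section \<open>Classification of the actions\<close>

locale plane_action = generic_torus +
  fixes K K' E F :: "torus \<Rightarrow> torus"
  assumes linear: "plane_linear K" "plane_linear K'" "plane_linear E" "plane_linear F"
    and K_mul: "\<And>p r. \<lbrakk>p \<in> plane; r \<in> plane\<rbrakk> \<Longrightarrow> K (p \<star> r) = K p \<star> K r"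
    and K'_mul: "\<And>p r. \<lbrakk>p \<in> plane; r \<in> plane\<rbrakk> \<Longrightarrow> K' (p \<star> r) = K' p \<star> K' r"
    and E_mul: "\<And>p r. \<lbrakk>p \<in> plane; r \<in> plane\<rbrakk> \<Longrightarrow> E (p \<star> r) = p \<star> E r + E p \<star> K r"
    and F_mul: "\<And>p r. \<lbrakk>p \<in> plane; r \<in> plane\<rbrakk> \<Longrightarrow> F (p \<star> r) = F p \<star> r + K' p \<star> F r"
    and KK': "\<And>p. p \<in> plane \<Longrightarrow> K (K' p) = p" and K'K: "\<And>p. p \<in> plane \<Longrightarrow> K' (K p) = p"
    and KE: "\<And>p. p \<in> plane \<Longrightarrow> K (E p) = scale (q\<^sup>2) (E (K p))"
    and KF: "\<And>p. p \<in> plane \<Longrightarrow> K (F p) = scale (inverse (q\<^sup>2)) (F (K p))"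
    and EF: "\<And>p. p \<in> plane \<Longrightarrow> E (F p) - F (E p) = scale (1 / (q - inverse q)) (K p - K' p)"
begin

text \<open>
  Lemma \<open>skew_derivation_inner\<close> applies to \<open>E\<close> and to \<open>K F\<close>: the skew derivation \<open>F\<close> has its twist on
  the other side, and composition with \<open>K\<close> moves it.  Undoing this composition gives \<open>v\<close>.
\<close>

lemma implementing_elements:
  obtains \<alpha> \<beta> w v where "implementing_pair q \<alpha> \<beta> w v"
    "\<And>p. p \<in> plane \<Longrightarrow> K p = diag \<alpha> \<beta> p"
    "\<And>p. p \<in> plane \<Longrightarrow> E p = w \<star> diag \<alpha> \<beta> p - p \<star> w"
    "\<And>p. p \<in> plane \<Longrightarrow> F p = v \<star> p - diag (inverse \<alpha>) (inverse \<beta>) p \<star> v"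
proof -
  note [simp] = linear[THEN plane_linearD(1)]
  obtain \<alpha> \<beta> where ab: "\<alpha> \<noteq> 0" "\<beta> \<noteq> 0" and K: "\<And>p. p \<in> plane \<Longrightarrow> K p = diag \<alpha> \<beta> p"
    and K': "\<And>p. p \<in> plane \<Longrightarrow> K' p = diag (inverse \<alpha>) (inverse \<beta>) p"
    using plane_automorphism[OF linear(1,2) K_mul K'_mul KK' K'K] by blast
  let ?D = "diag \<alpha> \<beta>" and ?D' = "diag (inverse \<alpha>) (inverse \<beta>)"
  have ne1: "q powi 2 \<noteq> 1" "q powi (-2) \<noteq> 1"
    using powi_eq_1[of 2] powi_eq_1[of "-2"] by simp_all
  have E_weight: "?D (E p) = scale (q powi 2) (E (?D p))" if "p \<in> plane" for p
    using KE[OF that] that by (simp add: K)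
  have E_leibniz: "E (p \<star> r) = p \<star> E r + E p \<star> ?D r" if "p \<in> plane" "r \<in> plane" for p r
    using E_mul[OF that] that by (simp add: K)
  obtain w where w: "\<And>p. p \<in> plane \<Longrightarrow> E p = w \<star> ?D p - p \<star> w"
    and sw: "\<And>i j. Poly_Mapping.lookup w (i, j) \<noteq> 0 \<Longrightarrow> -1 \<le> i \<and> -1 \<le> j \<and> (i = -1 \<longrightarrow> \<beta> = inverse q) \<and>
      (j = -1 \<longrightarrow> \<alpha> = q) \<and> \<alpha> powi i * \<beta> powi j = q powi 2"
    using skew_derivation_inner[OF ab linear(3) E_leibniz E_weight ne1(1)] by blast
  \<comment> \<open>\<open>F\<close> has its twist \<open>K'\<close> on the left factor; \<open>K F\<close> has the twist \<open>K\<close> on the right one, as \<open>E\<close> does.\<close>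
  define G where "G p = K (F p)" for p
  have G_linear: "plane_linear G"
    unfolding plane_linear_def G_def by (simp add: linear[THEN plane_linearD(2)] linear[THEN plane_linearD(3)])
  have G_leibniz: "G (p \<star> r) = p \<star> G r + G p \<star> ?D r" if "p \<in> plane" "r \<in> plane" for p r
    using that unfolding G_def
    by (simp add: F_mul plane_linearD(2)[OF linear(1)] K_mul KK' K[of r])
  have G_weight: "?D (G p) = scale (q powi (-2)) (G (?D p))" if "p \<in> plane" for p
    using that KF[OF that] unfolding G_def
    by (simp add: power_int_minus plane_linearD(3)[OF linear(1)] flip: K)
  obtain v' where v': "\<And>p. p \<in> plane \<Longrightarrow> G p = v' \<star> ?D p - p \<star> v'"
    and sv: "\<And>i j. Poly_Mapping.lookup v' (i, j) \<noteq> 0 \<Longrightarrow> -1 \<le> i \<and> -1 \<le> j \<and> (i = -1 \<longrightarrow> \<beta> = inverse q) \<and>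
      (j = -1 \<longrightarrow> \<alpha> = q) \<and> \<alpha> powi i * \<beta> powi j = q powi (-2)"
    using skew_derivation_inner[OF ab G_linear G_leibniz G_weight ne1(2)] by blast
  define v where "v = ?D' v'"
  have F: "F p = v \<star> p - ?D' p \<star> v" if "p \<in> plane" for p
  proof -
    have "F p = ?D' (G p)"
      using K'K[of "F p"] that K'[of "G p"] by (simp add: G_def)
    then show ?thesis
      using that ab by (simp add: v' diag_linear diag_mul v_def)
  qed
  have "v = scale (q powi 2) v'"
  proof -
    have "?D v' = scale (q powi (-2)) v'" using sv by (intro diag_weight) blast
    then have "scale (q powi 2) (?D v') = v'" by (simp add: power_int_minus q_nonzero)
    then show ?thesis using ab unfolding v_def by (metis diag_inverse(2) diag_linear(3))
  qed
  then have sv: "-1 \<le> i \<and> -1 \<le> j \<and> (i = -1 \<longrightarrow> \<beta> = inverse q) \<and>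
      (j = -1 \<longrightarrow> \<alpha> = q) \<and> \<alpha> powi i * \<beta> powi j = q powi (-2)"
    if "Poly_Mapping.lookup v (i, j) \<noteq> 0" for i j
    using sv[of i j] that by simp
  have Dw: "?D w = scale (q powi 2) w" and Dv: "?D v = scale (q powi (-2)) v"
    using sw sv by (intro diag_weight; blast)+
  have D'w: "?D' w = scale (q powi (-2)) w"
  proof -
    have "scale (q powi (-2)) (?D w) = w" by (simp add: Dw power_int_minus q_nonzero)
    then show ?thesis using ab by (metis diag_inverse(2) diag_linear(3))
  qed
  have "implementing_pair q \<alpha> \<beta> w v"
  proof unfold_locales
    fix p assume p: "p \<in> plane"
    have "E (F p) = w \<star> ?D (v \<star> p - ?D' p \<star> v) - (v \<star> p - ?D' p \<star> v) \<star> w"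
      using w[OF plane_linearD(1)[OF linear(4) p]] by (simp only: F[OF p])
    also have "\<dots> = scale (q powi (-2)) (w \<star> v \<star> ?D p) - scale (q powi (-2)) (w \<star> p \<star> v)
        - v \<star> p \<star> w + ?D' p \<star> v \<star> w"
      using ab by (simp add: diag_linear diag_mul Dv mul_minus mul_scale mul_assoc)
    finally have 1: "E (F p) = \<dots>" .
    have "F (E p) = v \<star> (w \<star> ?D p - p \<star> w) - ?D' (w \<star> ?D p - p \<star> w) \<star> v"
      using F[OF plane_linearD(1)[OF linear(3) p]] by (simp only: w[OF p])
    also have "\<dots> = v \<star> w \<star> ?D p - v \<star> p \<star> w - scale (q powi (-2)) (w \<star> p \<star> v)
        + scale (q powi (-2)) (?D' p \<star> w \<star> v)"
      using ab by (simp add: diag_linear diag_mul D'w mul_minus mul_scale mul_assoc)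
    finally have 2: "F (E p) = \<dots>" .
    show "?D' p \<star> (v \<star> w - scale (q powi (-2)) (w \<star> v)) - (v \<star> w - scale (q powi (-2)) (w \<star> v)) \<star> ?D p
      = scale (1 / (q - inverse q)) (?D p - ?D' p)"
      using EF[OF p] unfolding 1 2 K[OF p] K'[OF p]
      by (simp add: mul_minus mul_scale mul_assoc algebra_simps)
  qed (use ab sw sv in auto)
  then show ?thesis using that K w F by blast
qed

definition on_generators :: "torus \<Rightarrow> torus \<Rightarrow> torus \<Rightarrow> torus \<Rightarrow> torus \<Rightarrow> torus \<Rightarrow> bool" where
  "on_generators kx ky ex ey fx fy \<longleftrightarrow> K mon_x = kx \<and> K mon_y = ky \<and> E mon_x = ex \<and> E mon_y = ey \<and> F mon_x = fx \<and> F mon_y = fy"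

theorem classification:
  "(\<exists>\<sigma>\<in>{1, -1}. \<exists>\<rho>\<in>{1, -1}. on_generators (mon (1, 0) \<sigma>) (mon (0, 1) \<rho>) 0 0 0 0) \<or>
   (\<exists>\<tau>. \<tau> \<noteq> 0 \<and> on_generators (mon (1, 0) q) (mon (0, 1) (inverse q))
      0 (mon (1, 0) \<tau>) (mon (0, 1) (inverse \<tau>)) 0) \<or>
   (\<exists>b0. b0 \<noteq> 0 \<and> on_generators (mon (1, 0) q) (mon (0, 1) (inverse (q\<^sup>2)))
      0 (mon (0, 0) b0) (mon (1, 1) (inverse b0)) (mon (0, 2) (- q * inverse b0))) \<or>
   (\<exists>c0. c0 \<noteq> 0 \<and> on_generators (mon (1, 0) (q\<^sup>2)) (mon (0, 1) (inverse q))
      (mon (2, 0) (- q * inverse c0)) (mon (1, 1) (inverse c0)) (mon (0, 0) c0) 0) \<or>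
   (\<exists>a0 s t. a0 \<noteq> 0 \<and> on_generators (mon (1, 0) (inverse (q\<^sup>2))) (mon (0, 1) (inverse q))
      (mon (0, 0) a0) 0 (mon (2, 0) (- q * inverse a0) + mon (0, 4) t)
      (mon (1, 1) (- q * inverse a0) + mon (0, 3) s)) \<or>
   (\<exists>d0 s t. d0 \<noteq> 0 \<and> on_generators (mon (1, 0) q) (mon (0, 1) (q\<^sup>2))
      (mon (1, 1) (- q * inverse d0) + mon (3, 0) s) (mon (0, 2) (- q * inverse d0) + mon (4, 0) t)
      0 (mon (0, 0) d0))"
proof -
  obtain \<alpha> \<beta> w v where pair: "implementing_pair q \<alpha> \<beta> w v"
    and K: "\<And>p. p \<in> plane \<Longrightarrow> K p = diag \<alpha> \<beta> p"
    and E: "\<And>p. p \<in> plane \<Longrightarrow> E p = w \<star> diag \<alpha> \<beta> p - p \<star> w"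
    and F: "\<And>p. p \<in> plane \<Longrightarrow> F p = v \<star> p - diag (inverse \<alpha>) (inverse \<beta>) p \<star> v"
    using implementing_elements by blast
  interpret W: implementing_pair q \<alpha> \<beta> w v by (rule pair)
  have gens: "mon_x \<in> plane" "mon_y \<in> plane" by simp_all
  have on': "on_generators (mon (1, 0) \<alpha>) (mon (0, 1) \<beta>) ex ey fx fy \<longleftrightarrow>
      W.E mon_x = ex \<and> W.E mon_y = ey \<and> W.F mon_x = fx \<and> W.F mon_y = fy" for ex ey fx fy
    unfolding on_generators_def using K[of mon_x] K[of mon_y]
    by (simp only: E[OF gens(1)] E[OF gens(2)] F[OF gens(1)] F[OF gens(2)]) simp
  show ?thesis
  proof (cases "\<alpha>\<^sup>2 = 1 \<and> \<beta>\<^sup>2 = 1")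
    case True
    then have "w = 0" "v = 0" using W.involutive_case by auto
    then have "on_generators (mon (1, 0) \<alpha>) (mon (0, 1) \<beta>) 0 0 0 0"
      unfolding on' by simp
    moreover have "\<alpha> \<in> {1, -1}" "\<beta> \<in> {1, -1}" using True by (auto simp: power2_eq_1_iff)
    ultimately show ?thesis by blast
  next
    case False
    then have "\<alpha>\<^sup>2 \<noteq> 1 \<or> \<beta>\<^sup>2 \<noteq> 1" by blast
    then show ?thesis
    proof (cases rule: W.weights)
      case tau
      have ab: "\<alpha> = q" "\<beta> = inverse q" using tau by (simp_all add: power_int_minus)
      have "\<exists>\<tau>. \<tau> \<noteq> 0 \<and> on_generators (mon (1, 0) \<alpha>) (mon (0, 1) \<beta>) 0 (mon (1, 0) \<tau>) (mon (0, 1) (inverse \<tau>)) 0"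
        unfolding on' by (rule W.case_tau[OF tau])
      then show ?thesis unfolding ab by blast
    next
      case b0
      have ab: "\<alpha> = q" "\<beta> = inverse (q\<^sup>2)" using b0 by (simp_all add: power_int_minus)
      have "\<exists>b0. b0 \<noteq> 0 \<and> on_generators (mon (1, 0) \<alpha>) (mon (0, 1) \<beta>) 0 (mon (0, 0) b0) (mon (1, 1) (inverse b0)) (mon (0, 2) (- q * inverse b0))"
        unfolding on' by (rule W.case_b0[OF b0])
      then show ?thesis unfolding ab by blast
    next
      case c0
      have ab: "\<alpha> = q\<^sup>2" "\<beta> = inverse q" using c0 by (simp_all add: power_int_minus)
      have "\<exists>c0. c0 \<noteq> 0 \<and> on_generators (mon (1, 0) \<alpha>) (mon (0, 1) \<beta>) (mon (2, 0) (- q * inverse c0)) (mon (1, 1) (inverse c0)) (mon (0, 0) c0) 0"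
        unfolding on' by (rule W.case_c0[OF c0])
      then show ?thesis unfolding ab by blast
    next
      case a0
      have ab: "\<alpha> = inverse (q\<^sup>2)" "\<beta> = inverse q" using a0 by (simp_all add: power_int_minus)
      have "\<exists>a0 s t. a0 \<noteq> 0 \<and> on_generators (mon (1, 0) \<alpha>) (mon (0, 1) \<beta>) (mon (0, 0) a0) 0
        (mon (2, 0) (- q * inverse a0) + mon (0, 4) t) (mon (1, 1) (- q * inverse a0) + mon (0, 3) s)"
        unfolding on' by (rule W.case_a0[OF a0])
      then show ?thesis unfolding ab by blast
    next
      case d0
      have ab: "\<alpha> = q" "\<beta> = q\<^sup>2" using d0 by (simp_all add: power_int_minus)
      have "\<exists>d0 s t. d0 \<noteq> 0 \<and> on_generators (mon (1, 0) \<alpha>) (mon (0, 1) \<beta>) 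
        (mon (1, 1) (- q * inverse d0) + mon (3, 0) s) (mon (0, 2) (- q * inverse d0) + mon (4, 0) t)
        0 (mon (0, 0) d0)"
        unfolding on' by (rule W.case_d0[OF d0])
      then show ?thesis unfolding ab by blast
    qed
  qed
qed

end

section \<open>The quantum plane as a subalgebra of the quantum torus\<close>

context quantum_torus
begin

definition torus_algebra :: "(complex, torus) module" where
  "torus_algebra = \<lparr>carrier = UNIV, monoid.mult = mul, one = mon (0, 0) 1, ring.zero = 0,
     add = (+), smult = scale\<rparr>"

lemma torus_algebra_simps [simp]:
  "carrier torus_algebra = UNIV" "f \<otimes>\<^bsub>torus_algebra\<^esub> g = f \<star> g" "\<one>\<^bsub>torus_algebra\<^esub> = mon (0, 0) 1"
  "\<zero>\<^bsub>torus_algebra\<^esub> = 0" "f \<oplus>\<^bsub>torus_algebra\<^esub> g = f + g" "c \<odot>\<^bsub>torus_algebra\<^esub> f = scale c f"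
  by (simp_all add: torus_algebra_def)

lemma unital_algebra_torus: "unital_algebra torus_algebra"
proof (rule unital_algebraI)
  have "abelian_group torus_algebra"
    by (rule abelian_groupI) (auto simp: algebra_simps intro: exI[of _ "- _"] add.left_inverse)
  then show "ring torus_algebra"
    by (rule ringI[OF _ monoidI]) (simp_all add: mul_assoc mul_add_left mul_add_right)
qed (simp_all add: scale_add mul_scale)

sublocale T: unital_algebra torus_algebra
  by (rule unital_algebra_torus)

definition gens :: "plane_gen \<Rightarrow> torus" where
  "gens g = (case g of gen_x \<Rightarrow> mon_x | gen_y \<Rightarrow> mon_y)"

lemma gens_simps [simp]: "gens gen_x = mon_x" "gens gen_y = mon_y"
  by (simp_all add: gens_def)

abbreviation ev :: "plane_gen free \<Rightarrow> torus" where
  "ev \<equiv> free_eval torus_algebra gens"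

abbreviation A :: "(complex, plane_gen free set) module" where
  "A \<equiv> quantum_plane q"

abbreviation cls :: "plane_gen free \<Rightarrow> plane_gen free set" where
  "cls \<equiv> presented_class (plane_relations q)"

lemma ev_relations: "r \<in> plane_relations q \<Longrightarrow> ev r = \<zero>\<^bsub>torus_algebra\<^esub>"
proof -
  have minus: "f \<ominus>\<^bsub>torus_algebra\<^esub> f = 0" for f
    using T.r_neg[of f] by (simp add: T.minus_eq)
  assume "r \<in> plane_relations q"
  then show ?thesis
    by (simp add: plane_relations_def T.free_eval_diff T.free_eval_mult T.free_eval_scale T.free_eval_gen minus)
qed

definition to_torus :: "plane_gen free set \<Rightarrow> torus" where
  "to_torus = induced_hom torus_algebra gens"

lemma to_torus_cls: "to_torus (cls f) = ev f"
  unfolding to_torus_def by (rule T.induced_hom_class) (simp_all add: ev_relations[simplified])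

definition ordered_word :: "int \<times> int \<Rightarrow> plane_gen word" where
  "ordered_word u = Word (replicate (nat (fst u)) gen_x @ replicate (nat (snd u)) gen_y)"

text \<open>
  The linear section of evaluation that reads \<open>x\<^sup>i y\<^sup>j\<close> as a word.  It shows that the ordered monomials
  are a basis of the presented algebra: they span it because every class has such a representative,
  and they are independent because the torus separates them.
\<close>

definition ordered_lift :: "torus \<Rightarrow> plane_gen free" where
  "ordered_lift p = (\<Sum>u\<in>Poly_Mapping.keys p. Poly_Mapping.single (ordered_word u) (Poly_Mapping.lookup p u))"

lemma ordered_lift_superset:
  "finite S \<Longrightarrow> Poly_Mapping.keys p \<subseteq> S \<Longrightarrow>
    ordered_lift p = (\<Sum>u\<in>S. Poly_Mapping.single (ordered_word u) (Poly_Mapping.lookup p u))"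
  unfolding ordered_lift_def by (rule sum.mono_neutral_left) (auto simp: in_keys_iff)

lemma ordered_lift_add: "ordered_lift (f + g) = ordered_lift f + ordered_lift g"
proof -
  let ?S = "Poly_Mapping.keys f \<union> Poly_Mapping.keys g"
  show ?thesis
    using keys_add[of f g]
    by (simp add: ordered_lift_superset[of ?S] lookup_add single_add sum.distrib)
qed

lemma ordered_lift_mon: "ordered_lift (mon u c) = Poly_Mapping.single (ordered_word u) c"
  by (simp add: ordered_lift_superset[of "{u}"])

lemma ordered_lift_zero [simp]: "ordered_lift 0 = 0"
  by (simp add: ordered_lift_def)

lemma cls_mult_cong: "cls f = cls g \<Longrightarrow> cls (h * f) = cls (h * g)" "cls f = cls g \<Longrightarrow> cls (f * h) = cls (g * h)"
  by (metis presented_simps(2))+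

lemma cls_add_cong: "cls f = cls f' \<Longrightarrow> cls g = cls g' \<Longrightarrow> cls (f + g) = cls (f' + g')"
  by (metis presented_simps(3))

lemma gen_times_word: "free_gen g * Poly_Mapping.single (Word xs) c = Poly_Mapping.single (Word (g # xs)) c"
  by (simp add: free_gen_def mult_single plus_word_def)

lemma cls_reorder:
  "cls (Poly_Mapping.single (Word (gen_y # replicate m gen_x @ ws)) c) =
   cls (Poly_Mapping.single (Word (replicate m gen_x @ gen_y # ws)) (c * q ^ m))"
proof (induction m arbitrary: c)
  case (Suc m)
  have "cls (free_gen gen_y * free_gen gen_x) = cls (free_scale q (free_gen gen_x * free_gen gen_y))"
    by (rule presented_relation) (simp add: plane_relations_def)
  from cls_mult_cong(2)[OF this, of "Poly_Mapping.single (Word (replicate m gen_x @ ws)) c"]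
  have "cls (Poly_Mapping.single (Word (gen_y # gen_x # replicate m gen_x @ ws)) c) =
      cls (free_gen gen_x * Poly_Mapping.single (Word (gen_y # replicate m gen_x @ ws)) (c * q))"
    by (simp add: mult.assoc gen_times_word free_scale_def mult_single zero_word_def plus_word_def mult.commute)
  also have "\<dots> = cls (free_gen gen_x * Poly_Mapping.single (Word (replicate m gen_x @ gen_y # ws)) (c * q * q ^ m))"
    by (rule cls_mult_cong(1)[OF Suc.IH])
  finally show ?case
    by (simp add: gen_times_word mult.assoc)
qed simp

text \<open>
  The span of the ordered words is stable under left multiplication by generators, hence contains the
  class of every word.
\<close>

lemma cls_gen_times_lift:
  "p \<in> plane \<Longrightarrow> cls (free_gen g * ordered_lift p) = cls (ordered_lift (gens g \<star> p))"
proof (induction p rule: plane_induct)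
  case (single i j c)
  show ?case
  proof (cases g)
    case gen_x
    with single show ?thesis
      by (simp add: ordered_lift_mon ordered_word_def gen_times_word nat_add_distrib)
  next
    case gen_y
    have "replicate n gen_y @ [gen_y] = gen_y # replicate n gen_y" for n
      by (induction n) simp_all
    with gen_y single cls_reorder[of "nat i" "replicate (nat j) gen_y" c] show ?thesis
      by (simp add: ordered_lift_mon ordered_word_def gen_times_word nat_add_distrib power_int_def)
  qed
next
  case (add f h)
  then show ?case unfolding ordered_lift_add distrib_left mul_add_right by (intro cls_add_cong)
qed simp

lemma normal_form_word:
  "word_eval torus_algebra gens (Word xs) \<in> plane \<and>
   cls (Poly_Mapping.single (Word xs) c) = cls (ordered_lift (scale c (word_eval torus_algebra gens (Word xs))))"
proof (induction xs)
  case Nil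
  show ?case by (simp add: word_eval_def ordered_lift_mon ordered_word_def)
next
  case (Cons g xs)
  let ?e = "word_eval torus_algebra gens (Word xs)"
  have e: "word_eval torus_algebra gens (Word (g # xs)) = gens g \<star> ?e"
    by (simp add: word_eval_def)
  have g: "gens g \<in> plane" by (cases g) simp_all
  have "cls (Poly_Mapping.single (Word (g # xs)) c) = cls (free_gen g * ordered_lift (scale c ?e))"
    unfolding gen_times_word[symmetric] using Cons by (intro cls_mult_cong(1)) blast
  also have "\<dots> = cls (ordered_lift (gens g \<star> scale c ?e))"
    using Cons by (intro cls_gen_times_lift) simp
  finally show ?case using Cons g by (simp add: e mul_scale)
qed

lemma ev_plane: "ev f \<in> plane" and normal_form: "cls f = cls (ordered_lift (ev f))"
proof -
  have "ev f \<in> plane \<and> cls f = cls (ordered_lift (ev f))"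
  proof (induction f rule: free_induct)
    case (single w c)
    show ?case
      using normal_form_word[of "letters w" c] by (simp add: T.free_eval_single)
  next
    case (add f g)
    then have "cls (f + g) = cls (ordered_lift (ev f) + ordered_lift (ev g))"
      by (intro cls_add_cong) simp_all
    with add show ?case by (simp add: T.free_eval_add ordered_lift_add)
  qed
  then show "ev f \<in> plane" "cls f = cls (ordered_lift (ev f))" by blast+
qed

lemma ev_ordered_lift: "p \<in> plane \<Longrightarrow> ev (ordered_lift p) = p"
proof (induction p rule: plane_induct)
  case zero
  show ?case using T.free_eval_single[of gens 0 0] by simp
next
  case (single i j c)
  have y: "foldr (\<lambda>g. (\<star>) (gens g)) (replicate n gen_y) (mon (0, 0) 1) = mon (0, int n) 1" for n
    by (induction n) (simp_all add: add.commute)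
  have x: "foldr (\<lambda>g. (\<star>) (gens g)) (replicate m gen_x) (mon (0, int n) 1) = mon (int m, int n) 1" for m n
    by (induction m) (simp_all add: add.commute)
  show ?case
    using single y[of "nat j"] x[of "nat i" "nat j"]
    by (simp add: ordered_lift_mon T.free_eval_single word_eval_def ordered_word_def)
qed (simp_all add: ordered_lift_add T.free_eval_add)

definition from_torus :: "torus \<Rightarrow> plane_gen free set" where
  "from_torus p = cls (ordered_lift p)"

lemma plane_carrierE:
  assumes "a \<in> carrier A"
  obtains f where "a = cls f"
  using assms unfolding quantum_plane_def carrier_presented by blast

lemma from_torus_closed [simp]: "from_torus p \<in> carrier A"
  by (simp add: from_torus_def quantum_plane_def)

lemma to_torus_closed [simp]: "a \<in> carrier A \<Longrightarrow> to_torus a \<in> plane"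
  by (elim plane_carrierE) (simp add: to_torus_cls ev_plane)

lemma from_to_torus [simp]: "a \<in> carrier A \<Longrightarrow> from_torus (to_torus a) = a"
  by (elim plane_carrierE) (simp add: to_torus_cls from_torus_def flip: normal_form)

lemma to_from_torus [simp]: "p \<in> plane \<Longrightarrow> to_torus (from_torus p) = p"
  by (simp add: to_torus_cls from_torus_def ev_ordered_lift)

lemma unital_algebra_plane: "unital_algebra A"
  by (simp add: quantum_plane_def unital_algebra_presented)

sublocale A: unital_algebra A
  by (rule unital_algebra_plane)

lemma cls_simps: "cls f \<otimes>\<^bsub>A\<^esub> cls g = cls (f * g)" "cls f \<oplus>\<^bsub>A\<^esub> cls g = cls (f + g)"
  "c \<odot>\<^bsub>A\<^esub> cls f = cls (free_scale c f)"
  by (simp_all add: quantum_plane_def)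

lemma to_torus_hom [simp]:
  assumes "a \<in> carrier A"
  shows "b \<in> carrier A \<Longrightarrow> to_torus (a \<otimes>\<^bsub>A\<^esub> b) = to_torus a \<star> to_torus b"
    "b \<in> carrier A \<Longrightarrow> to_torus (a \<oplus>\<^bsub>A\<^esub> b) = to_torus a + to_torus b"
    "to_torus (c \<odot>\<^bsub>A\<^esub> a) = scale c (to_torus a)"
  using assms
  by (auto elim!: plane_carrierE simp: cls_simps to_torus_cls T.free_eval_mult
      T.free_eval_add T.free_eval_scale)

lemma to_torus_one [simp]: "to_torus \<one>\<^bsub>A\<^esub> = mon (0, 0) 1"
  and to_torus_zero [simp]: "to_torus \<zero>\<^bsub>A\<^esub> = 0"
  using T.free_eval_one[of gens] T.free_eval_single[of gens 0 0]
  by (simp_all add: quantum_plane_def to_torus_cls)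

lemma plane_gens_closed [simp]: "plane_x q \<in> carrier A" "plane_y q \<in> carrier A"
  by (simp_all add: plane_x_def plane_y_def presented_gen_def quantum_plane_def)

lemma to_torus_gens [simp]: "to_torus (plane_x q) = mon_x" "to_torus (plane_y q) = mon_y"
  by (simp_all add: plane_x_def plane_y_def presented_gen_def to_torus_cls T.free_eval_gen)

lemma to_torus_power [simp]:
  "to_torus (plane_x q [^]\<^bsub>A\<^esub> n) = mon (int n, 0) 1" "to_torus (plane_y q [^]\<^bsub>A\<^esub> n) = mon (0, int n) 1"
  for n :: nat
  by (induction n) (simp_all add: add.commute)

lemma from_torus_hom:
  assumes "p \<in> plane" "r \<in> plane"
  shows "from_torus (p \<star> r) = from_torus p \<otimes>\<^bsub>A\<^esub> from_torus r"
    "from_torus (p + r) = from_torus p \<oplus>\<^bsub>A\<^esub> from_torus r"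
    "from_torus (scale c p) = c \<odot>\<^bsub>A\<^esub> from_torus p"
  using assms from_to_torus[of "from_torus p \<otimes>\<^bsub>A\<^esub> from_torus r"]
    from_to_torus[of "from_torus p \<oplus>\<^bsub>A\<^esub> from_torus r"] from_to_torus[of "c \<odot>\<^bsub>A\<^esub> from_torus p"]
  by simp_all

end

section \<open>From module algebra structures to operators on the plane\<close>

lemma End_algebra_simps:
  "S \<otimes>\<^bsub>End_algebra A\<^esub> T = compose (carrier A) S T" "\<one>\<^bsub>End_algebra A\<^esub> = (\<lambda>x\<in>carrier A. x)"
  "S \<oplus>\<^bsub>End_algebra A\<^esub> T = (\<lambda>x\<in>carrier A. S x \<oplus>\<^bsub>A\<^esub> T x)"
  "c \<odot>\<^bsub>End_algebra A\<^esub> T = (\<lambda>x\<in>carrier A. c \<odot>\<^bsub>A\<^esub> T x)"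
  by (simp_all add: End_algebra_def)

locale module_algebra =
  fixes H :: "('h, 'm) hopf_algebra_scheme" and A :: "(complex, 'a, 'n) module_scheme"
    and \<pi> :: "'h \<Rightarrow> 'a \<Rightarrow> 'a"
  assumes structure_\<pi>: "module_algebra_structure H A \<pi>"
    and algebra_H: "unital_algebra H" and algebra_A: "unital_algebra A"
begin

sublocale H: unital_algebra H by (rule algebra_H)
sublocale A: unital_algebra A by (rule algebra_A)

lemma hom: "\<pi> \<in> algebra_hom H (End_algebra A)"
  using structure_\<pi> by (simp add: module_algebra_structure_def)

lemma action_closed [simp]: "\<lbrakk>h \<in> carrier H; a \<in> carrier A\<rbrakk> \<Longrightarrow> \<pi> h a \<in> carrier A"
  using hom by (auto simp: algebra_hom_def ring_hom_def End_algebra_def Pi_iff PiE_iff)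

lemma action_linear:
  assumes "h \<in> carrier H" "a \<in> carrier A"
  shows "b \<in> carrier A \<Longrightarrow> \<pi> h (a \<oplus>\<^bsub>A\<^esub> b) = \<pi> h a \<oplus>\<^bsub>A\<^esub> \<pi> h b" "\<pi> h (c \<odot>\<^bsub>A\<^esub> a) = c \<odot>\<^bsub>A\<^esub> \<pi> h a"
proof -
  have "\<pi> h \<in> carrier (End_algebra A)"
    using hom assms(1) by (auto simp: algebra_hom_def ring_hom_def)
  then show "b \<in> carrier A \<Longrightarrow> \<pi> h (a \<oplus>\<^bsub>A\<^esub> b) = \<pi> h a \<oplus>\<^bsub>A\<^esub> \<pi> h b" "\<pi> h (c \<odot>\<^bsub>A\<^esub> a) = c \<odot>\<^bsub>A\<^esub> \<pi> h a"
    using assms(2) by (auto simp: End_algebra_def)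
qed

lemma action_mult: "\<lbrakk>g \<in> carrier H; h \<in> carrier H; a \<in> carrier A\<rbrakk> \<Longrightarrow> \<pi> (g \<otimes>\<^bsub>H\<^esub> h) a = \<pi> g (\<pi> h a)"
  using hom by (auto simp: algebra_hom_def ring_hom_def End_algebra_simps compose_def)

lemma action_add: "\<lbrakk>g \<in> carrier H; h \<in> carrier H; a \<in> carrier A\<rbrakk> \<Longrightarrow> \<pi> (g \<oplus>\<^bsub>H\<^esub> h) a = \<pi> g a \<oplus>\<^bsub>A\<^esub> \<pi> h a"
  using hom by (auto simp: algebra_hom_def ring_hom_def End_algebra_simps)

lemma action_scale: "\<lbrakk>h \<in> carrier H; a \<in> carrier A\<rbrakk> \<Longrightarrow> \<pi> (c \<odot>\<^bsub>H\<^esub> h) a = c \<odot>\<^bsub>A\<^esub> \<pi> h a"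
  using hom by (auto simp: algebra_hom_def ring_hom_def End_algebra_simps)

lemma action_one: "a \<in> carrier A \<Longrightarrow> \<pi> \<one>\<^bsub>H\<^esub> a = a"
  using hom by (auto simp: algebra_hom_def ring_hom_def End_algebra_simps)

text \<open>
  A module algebra structure is stated for all expansions of the coproduct as a finite sum of pure
  tensors; the generators only need expansions of length one and two.
\<close>

lemma action_grouplike:
  assumes "h \<in> carrier H" "comult H h = pure_tensor H H g g'" "g \<in> carrier H" "g' \<in> carrier H"
    and "a \<in> carrier A" "b \<in> carrier A"
  shows "\<pi> h (a \<otimes>\<^bsub>A\<^esub> b) = \<pi> g a \<otimes>\<^bsub>A\<^esub> \<pi> g' b"
proof -
  interpret T: unital_algebra "tensor_algebra H H"
    by (rule unital_algebra_tensor[OF algebra_H algebra_H])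
  have "comult H h = (\<Oplus>\<^bsub>tensor_algebra H H\<^esub>i\<in>{..<Suc 0}. pure_tensor H H g g')"
    using assms by (simp add: lessThan_Suc pure_tensor_closed)
  moreover have "(\<lambda>_. g) \<in> {..<Suc 0} \<rightarrow> carrier H" "(\<lambda>_. g') \<in> {..<Suc 0} \<rightarrow> carrier H"
    using assms by auto
  ultimately have "\<pi> h (a \<otimes>\<^bsub>A\<^esub> b) = (\<Oplus>\<^bsub>A\<^esub>i\<in>{..<Suc 0}. \<pi> g a \<otimes>\<^bsub>A\<^esub> \<pi> g' b)"
    using structure_\<pi>[unfolded module_algebra_structure_def] assms(1,5,6) by blast
  then show ?thesis
    using assms by (simp add: lessThan_Suc)
qed

lemma action_skew_primitive:
  assumes h: "h \<in> carrier H"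
    and co: "comult H h = pure_tensor H H g g' \<oplus>\<^bsub>tensor_algebra H H\<^esub> pure_tensor H H l l'"
    and car: "g \<in> carrier H" "g' \<in> carrier H" "l \<in> carrier H" "l' \<in> carrier H"
    and ab: "a \<in> carrier A" "b \<in> carrier A"
  shows "\<pi> h (a \<otimes>\<^bsub>A\<^esub> b) = \<pi> g a \<otimes>\<^bsub>A\<^esub> \<pi> g' b \<oplus>\<^bsub>A\<^esub> \<pi> l a \<otimes>\<^bsub>A\<^esub> \<pi> l' b"
proof -
  interpret T: unital_algebra "tensor_algebra H H"
    by (rule unital_algebra_tensor[OF algebra_H algebra_H])
  define s s' where "s = (\<lambda>i::nat. if i = 0 then g else l)" and "s' = (\<lambda>i::nat. if i = 0 then g' else l')"
  have "comult H h = (\<Oplus>\<^bsub>tensor_algebra H H\<^esub>i\<in>{..<Suc (Suc 0)}. pure_tensor H H (s i) (s' i))"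
    using car by (simp add: lessThan_Suc pure_tensor_closed co s_def s'_def T.a_comm)
  moreover have "s \<in> {..<Suc (Suc 0)} \<rightarrow> carrier H" "s' \<in> {..<Suc (Suc 0)} \<rightarrow> carrier H"
    using car by (auto simp: s_def s'_def)
  ultimately have "\<pi> h (a \<otimes>\<^bsub>A\<^esub> b) = (\<Oplus>\<^bsub>A\<^esub>i\<in>{..<Suc (Suc 0)}. \<pi> (s i) a \<otimes>\<^bsub>A\<^esub> \<pi> (s' i) b)"
    using structure_\<pi>[unfolded module_algebra_structure_def] h ab by blast
  then show ?thesis
    using car ab by (simp add: lessThan_Suc s_def s'_def A.a_comm)
qed

end

section \<open>The classification\<close>

context
  fixes q :: complex and \<pi> :: "uq_gen free set \<Rightarrow> plane_gen free set \<Rightarrow> plane_gen free set"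
  assumes q: "generic_torus q"
    and module_algebra: "module_algebra_structure (Uq q) (quantum_plane q) \<pi>"
begin

interpretation generic_torus q by (rule q)

interpretation U: unital_algebra "uq_algebra q" by (rule unital_algebra_uq)

lemma unital_algebra_Uq: "unital_algebra (Uq q)"
proof (rule unital_algebraI)
  have "abelian_group (Uq q)"
    by (rule abelian_groupI)
      (auto simp: Uq_simps U.add.m_ac intro: bexI[of _ "\<ominus>\<^bsub>uq_algebra q\<^esub> _"] U.l_neg)
  then show "ring (Uq q)"
    by (rule ringI[OF _ monoidI]) (simp_all add: Uq_simps U.m_assoc U.l_distr U.r_distr)
qed (simp_all add: Uq_simps U.smult_distrib_left U.smult_distrib_right U.smult_smult U.smult_mult_left
    U.smult_mult_right)

interpretation M: module_algebra "Uq q" A \<pi>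
  by (rule module_algebra.intro[OF module_algebra unital_algebra_Uq unital_algebra_plane])

abbreviation act :: "uq_gen \<Rightarrow> torus \<Rightarrow> torus" where
  "act g p \<equiv> to_torus (\<pi> (uq_gen q g) (from_torus p))"

lemma gen_closed [simp]: "uq_gen q g \<in> carrier (Uq q)"
  by (simp add: Uq_simps)

lemma act_linear: "plane_linear (act g)"
  unfolding plane_linear_def
  by (simp add: from_torus_hom M.action_linear)

lemma act_comult:
  assumes "p \<in> plane" "r \<in> plane"
  shows "act gen_k (p \<star> r) = act gen_k p \<star> act gen_k r"
    "act gen_kinv (p \<star> r) = act gen_kinv p \<star> act gen_kinv r"
    "act gen_e (p \<star> r) = p \<star> act gen_e r + act gen_e p \<star> act gen_k r"
    "act gen_f (p \<star> r) = act gen_f p \<star> r + act gen_kinv p \<star> act gen_f r"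
proof -
  let ?k = "uq_gen q gen_k" and ?k' = "uq_gen q gen_kinv" and ?e = "uq_gen q gen_e" and ?f = "uq_gen q gen_f"
  let ?a = "from_torus p" and ?b = "from_torus r"
  note co = uq_comult(2-)[OF q_nonzero, folded tensor_algebra_Uq Uq_simps]
  have one: "\<one>\<^bsub>Uq q\<^esub> \<in> carrier (Uq q)" by (simp add: Uq_simps)
  have "\<pi> ?k (?a \<otimes>\<^bsub>A\<^esub> ?b) = \<pi> ?k ?a \<otimes>\<^bsub>A\<^esub> \<pi> ?k ?b"
    by (rule M.action_grouplike[OF _ co(1)]) simp_all
  then show "act gen_k (p \<star> r) = act gen_k p \<star> act gen_k r"
    using assms by (simp add: from_torus_hom)
  have "\<pi> ?k' (?a \<otimes>\<^bsub>A\<^esub> ?b) = \<pi> ?k' ?a \<otimes>\<^bsub>A\<^esub> \<pi> ?k' ?b"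
    by (rule M.action_grouplike[OF _ co(2)]) simp_all
  then show "act gen_kinv (p \<star> r) = act gen_kinv p \<star> act gen_kinv r"
    using assms by (simp add: from_torus_hom)
  have "\<pi> ?e (?a \<otimes>\<^bsub>A\<^esub> ?b) = \<pi> \<one>\<^bsub>Uq q\<^esub> ?a \<otimes>\<^bsub>A\<^esub> \<pi> ?e ?b \<oplus>\<^bsub>A\<^esub> \<pi> ?e ?a \<otimes>\<^bsub>A\<^esub> \<pi> ?k ?b"
    by (rule M.action_skew_primitive[OF _ co(3)]) (simp_all add: one)
  then show "act gen_e (p \<star> r) = p \<star> act gen_e r + act gen_e p \<star> act gen_k r"
    using assms by (simp add: from_torus_hom M.action_one)
  have "\<pi> ?f (?a \<otimes>\<^bsub>A\<^esub> ?b) = \<pi> ?f ?a \<otimes>\<^bsub>A\<^esub> \<pi> \<one>\<^bsub>Uq q\<^esub> ?b \<oplus>\<^bsub>A\<^esub> \<pi> ?k' ?a \<otimes>\<^bsub>A\<^esub> \<pi> ?f ?b"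
    by (rule M.action_skew_primitive[OF _ co(4)]) (simp_all add: one)
  then show "act gen_f (p \<star> r) = act gen_f p \<star> r + act gen_kinv p \<star> act gen_f r"
    using assms by (simp add: from_torus_hom M.action_one)
qed

lemma act_relations:
  assumes "p \<in> plane"
  shows "act gen_k (act gen_kinv p) = p" "act gen_kinv (act gen_k p) = p"
    "act gen_k (act gen_e p) = scale (q\<^sup>2) (act gen_e (act gen_k p))"
    "act gen_k (act gen_f p) = scale (inverse (q\<^sup>2)) (act gen_f (act gen_k p))"
    "act gen_e (act gen_f p) - act gen_f (act gen_e p) =
      scale (1 / (q - inverse q)) (act gen_k p - act gen_kinv p)"
proof -
  let ?k = "uq_gen q gen_k" and ?k' = "uq_gen q gen_kinv" and ?e = "uq_gen q gen_e" and ?f = "uq_gen q gen_f"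
  let ?a = "from_torus p" and ?U = "Uq q"
  have mult: "to_torus (\<pi> (uq_gen q g \<otimes>\<^bsub>?U\<^esub> uq_gen q h) ?a) = act g (act h p)" for g h
    by (simp add: M.action_mult)
  note rel = uq_algebra_relations(1-4)[of q, folded Uq_simps]
  show "act gen_k (act gen_kinv p) = p" "act gen_kinv (act gen_k p) = p"
    unfolding mult[symmetric] rel(1,2) using assms by (simp_all add: M.action_one)
  show "act gen_k (act gen_e p) = scale (q\<^sup>2) (act gen_e (act gen_k p))"
    "act gen_k (act gen_f p) = scale (inverse (q\<^sup>2)) (act gen_f (act gen_k p))"
    unfolding mult[symmetric] rel(3,4) by (simp_all add: M.action_scale)
  have neg: "a \<ominus>\<^bsub>uq_algebra q\<^esub> b = a \<oplus>\<^bsub>uq_algebra q\<^esub> (-1) \<odot>\<^bsub>uq_algebra q\<^esub> b"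
    if "b \<in> carrier (uq_algebra q)" for a b
    using that by (simp add: U.minus_eq U.smult_minus_one)
  have "?e \<otimes>\<^bsub>?U\<^esub> ?f \<oplus>\<^bsub>?U\<^esub> (-1) \<odot>\<^bsub>?U\<^esub> (?f \<otimes>\<^bsub>?U\<^esub> ?e) =
      (1 / (q - inverse q)) \<odot>\<^bsub>?U\<^esub> (?k \<oplus>\<^bsub>?U\<^esub> (-1) \<odot>\<^bsub>?U\<^esub> ?k')"
    using uq_algebra_relations(5)[of q] by (simp add: neg Uq_simps)
  from arg_cong[OF this, of "\<lambda>h. to_torus (\<pi> h ?a)"]
  have "act gen_e (act gen_f p) + scale (-1) (act gen_f (act gen_e p)) =
      scale (1 / (q - inverse q)) (act gen_k p + scale (-1) (act gen_kinv p))"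
    by (simp add: M.action_add M.action_scale M.action_mult)
  moreover have "f + scale (-1) g = f - g" for f g
    by (rule poly_mapping_eqI) (simp add: lookup_add lookup_minus)
  ultimately show "act gen_e (act gen_f p) - act gen_f (act gen_e p) =
      scale (1 / (q - inverse q)) (act gen_k p - act gen_kinv p)"
    by simp
qed

interpretation P: plane_action q "act gen_k" "act gen_kinv" "act gen_e" "act gen_f"
  by unfold_locales (use act_linear act_comult act_relations in \<open>simp_all\<close>)

lemma action_on_generators_iff:
  assumes "kx \<in> carrier A" "ky \<in> carrier A" "ex \<in> carrier A" "ey \<in> carrier A" "fx \<in> carrier A" "fy \<in> carrier A"
  shows "action_on_generators q \<pi> kx ky ex ey fx fy \<longleftrightarrow>
    P.on_generators (to_torus kx) (to_torus ky) (to_torus ex) (to_torus ey) (to_torus fx) (to_torus fy)"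
proof -
  have gen: "from_torus mon_x = plane_x q" "from_torus mon_y = plane_y q"
    by (simp_all flip: to_torus_gens)
  have eq: "to_torus (\<pi> (uq_gen q g) a) = to_torus b \<longleftrightarrow> \<pi> (uq_gen q g) a = b"
    if "a \<in> carrier A" "b \<in> carrier A" for g a b
    using that by (metis M.action_closed gen_closed from_to_torus)
  show ?thesis
    using assms by (simp add: action_on_generators_def P.on_generators_def gen eq)
qed

lemma action_classification:
  shows
    "(\<exists>\<sigma>\<in>{1, -1}. \<exists>\<rho>\<in>{1, -1}. action_on_generators q \<pi>
        (\<sigma> \<odot>\<^bsub>A\<^esub> plane_x q) (\<rho> \<odot>\<^bsub>A\<^esub> plane_y q)
        \<zero>\<^bsub>A\<^esub> \<zero>\<^bsub>A\<^esub>
        \<zero>\<^bsub>A\<^esub> \<zero>\<^bsub>A\<^esub>) \<or>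
     (\<exists>\<tau>. \<tau> \<noteq> 0 \<and> action_on_generators q \<pi>
        (q \<odot>\<^bsub>A\<^esub> plane_x q) (inverse q \<odot>\<^bsub>A\<^esub> plane_y q)
        \<zero>\<^bsub>A\<^esub> (\<tau> \<odot>\<^bsub>A\<^esub> plane_x q)
        (inverse \<tau> \<odot>\<^bsub>A\<^esub> plane_y q) \<zero>\<^bsub>A\<^esub>) \<or>
     (\<exists>b0. b0 \<noteq> 0 \<and> action_on_generators q \<pi>
        (q \<odot>\<^bsub>A\<^esub> plane_x q) (inverse (q\<^sup>2) \<odot>\<^bsub>A\<^esub> plane_y q)
        \<zero>\<^bsub>A\<^esub> (b0 \<odot>\<^bsub>A\<^esub> \<one>\<^bsub>A\<^esub>)
        (inverse b0 \<odot>\<^bsub>A\<^esub> (plane_x q \<otimes>\<^bsub>A\<^esub> plane_y q)) ((- q * inverse b0) \<odot>\<^bsub>A\<^esub> (plane_y q [^]\<^bsub>A\<^esub> (2::nat)))) \<or>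
     (\<exists>c0. c0 \<noteq> 0 \<and> action_on_generators q \<pi>
        (q\<^sup>2 \<odot>\<^bsub>A\<^esub> plane_x q) (inverse q \<odot>\<^bsub>A\<^esub> plane_y q)
        ((- q * inverse c0) \<odot>\<^bsub>A\<^esub> (plane_x q [^]\<^bsub>A\<^esub> (2::nat))) (inverse c0 \<odot>\<^bsub>A\<^esub> (plane_x q \<otimes>\<^bsub>A\<^esub> plane_y q))
        (c0 \<odot>\<^bsub>A\<^esub> \<one>\<^bsub>A\<^esub>) \<zero>\<^bsub>A\<^esub>) \<or>
     (\<exists>a0 s t. a0 \<noteq> 0 \<and> action_on_generators q \<pi>
        (inverse (q\<^sup>2) \<odot>\<^bsub>A\<^esub> plane_x q) (inverse q \<odot>\<^bsub>A\<^esub> plane_y q)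
        (a0 \<odot>\<^bsub>A\<^esub> \<one>\<^bsub>A\<^esub>) \<zero>\<^bsub>A\<^esub>
        ((- q * inverse a0) \<odot>\<^bsub>A\<^esub> (plane_x q [^]\<^bsub>A\<^esub> (2::nat)) \<oplus>\<^bsub>A\<^esub> t \<odot>\<^bsub>A\<^esub> (plane_y q [^]\<^bsub>A\<^esub> (4::nat)))
        ((- q * inverse a0) \<odot>\<^bsub>A\<^esub> (plane_x q \<otimes>\<^bsub>A\<^esub> plane_y q) \<oplus>\<^bsub>A\<^esub> s \<odot>\<^bsub>A\<^esub> (plane_y q [^]\<^bsub>A\<^esub> (3::nat)))) \<or>
     (\<exists>d0 s t. d0 \<noteq> 0 \<and> action_on_generators q \<pi>
        (q \<odot>\<^bsub>A\<^esub> plane_x q) (q\<^sup>2 \<odot>\<^bsub>A\<^esub> plane_y q)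
        ((- q * inverse d0) \<odot>\<^bsub>A\<^esub> (plane_x q \<otimes>\<^bsub>A\<^esub> plane_y q) \<oplus>\<^bsub>A\<^esub> s \<odot>\<^bsub>A\<^esub> (plane_x q [^]\<^bsub>A\<^esub> (3::nat)))
        ((- q * inverse d0) \<odot>\<^bsub>A\<^esub> (plane_y q [^]\<^bsub>A\<^esub> (2::nat)) \<oplus>\<^bsub>A\<^esub> t \<odot>\<^bsub>A\<^esub> (plane_x q [^]\<^bsub>A\<^esub> (4::nat)))
        \<zero>\<^bsub>A\<^esub> (d0 \<odot>\<^bsub>A\<^esub> \<one>\<^bsub>A\<^esub>))"
  using P.classification by (simp add: action_on_generators_iff)

end

theorem mainTheorem7:
  fixes q :: complex
    and A :: "(complex, plane_gen free set) module" (structure)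
    and x y :: "plane_gen free set"
    and \<pi> :: "uq_gen free set \<Rightarrow> plane_gen free set \<Rightarrow> plane_gen free set"
  assumes q_nonzero: "q \<noteq> 0"
    and q_not_root_of_unity: "\<And>n::nat. n > 0 \<Longrightarrow> q ^ n \<noteq> 1"
    and A: "A = quantum_plane q" and x: "x = plane_x q" and y: "y = plane_y q"
    and structure_\<pi>: "module_algebra_structure (Uq q) A \<pi>"
  shows
    "(\<exists>\<sigma>\<in>{1, -1}. \<exists>\<rho>\<in>{1, -1}. action_on_generators q \<pi>
        (\<sigma> \<odot> x) (\<rho> \<odot> y)
        \<zero> \<zero>
        \<zero> \<zero>) \<or>
     (\<exists>\<tau>. \<tau> \<noteq> 0 \<and> action_on_generators q \<pi>
        (q \<odot> x) (inverse q \<odot> y)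
        \<zero> (\<tau> \<odot> x)
        (inverse \<tau> \<odot> y) \<zero>) \<or>
     (\<exists>b0. b0 \<noteq> 0 \<and> action_on_generators q \<pi>
        (q \<odot> x) (inverse (q\<^sup>2) \<odot> y)
        \<zero> (b0 \<odot> \<one>)
        (inverse b0 \<odot> (x \<otimes> y)) ((- q * inverse b0) \<odot> (y [^] (2::nat)))) \<or>
     (\<exists>c0. c0 \<noteq> 0 \<and> action_on_generators q \<pi>
        (q\<^sup>2 \<odot> x) (inverse q \<odot> y)
        ((- q * inverse c0) \<odot> (x [^] (2::nat))) (inverse c0 \<odot> (x \<otimes> y))
        (c0 \<odot> \<one>) \<zero>) \<or>
     (\<exists>a0 s t. a0 \<noteq> 0 \<and> action_on_generators q \<pi>
        (inverse (q\<^sup>2) \<odot> x) (inverse q \<odot> y)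
        (a0 \<odot> \<one>) \<zero>
        ((- q * inverse a0) \<odot> (x [^] (2::nat)) \<oplus> t \<odot> (y [^] (4::nat)))
        ((- q * inverse a0) \<odot> (x \<otimes> y) \<oplus> s \<odot> (y [^] (3::nat)))) \<or>
     (\<exists>d0 s t. d0 \<noteq> 0 \<and> action_on_generators q \<pi>
        (q \<odot> x) (q\<^sup>2 \<odot> y)
        ((- q * inverse d0) \<odot> (x \<otimes> y) \<oplus> s \<odot> (x [^] (3::nat)))
        ((- q * inverse d0) \<odot> (y [^] (2::nat)) \<oplus> t \<odot> (x [^] (4::nat)))
        \<zero> (d0 \<odot> \<one>))"
proof -
  have "generic_torus q"
    by unfold_locales (use q_nonzero q_not_root_of_unity in auto)
  from action_classification[OF this structure_\<pi>[unfolded A]] show ?thesis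
    unfolding A x y .
qed

end
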